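(* Let $((A,l_A),(B,l_B),\phi,U,\star)$ be a semi-simple equipped Cardy--Frobenius algebra over $\mathbb{C}$. Then it is isomorphic to a direct sum of finitely many equipped Cardy--Frobenius algebras of the form $H^{\mathbb{D}_i}_{n_i,\mu_i}\otimes\mathbb{C}$, with $\mathbb{D}_i\in\{\mathbb{R},\mathbb{C},\mathbb{H}\}$, $n_i\ge 1$ an integer and $\mu_i\in\mathbb{C}\setminus\{0\}$, and of $\mathrm{Ker}(\phi)\subset A$.
   Context: All algebras are finite-dimensional, associative and unital over a field $\mathbb{K}$ (here $\mathbb{K}=\mathbb{C}$); the zero algebra is allowed. A Frobenius pair $(C,l_C)$ is an algebra $C$ with a linear functional $l_C:C\to\mathbb{K}$ such that the bilinear form $(c_1,c_2)_C=l_C(c_1c_2)$ is symmetric and non-degenerate. A Cardy--Frobenius algebra $((A,l_A),(B,l_B),\phi)$ consists of: (1) a commutative Frobenius pair $(A,l_A)$; (2) a Frobenius pair $(B,l_B)$, not necessarily commutative; (3) an algebra homomorphism $\phi:A\to B$ whose image is contained in the center of $B$ and which satisfies the Cardy condition $(\phi^*(b'),\phi^*(b''))_A=\mathrm{Tr}\,W^B_{b'b''}$ for all $b',b''\in B$. Here $\phi^*:B\to A$ is the dual map, defined by $(\phi^*(b),a)_A=(b,\phi(a))_B$, and $W^B_{b'b''}:B\to B$ is the linear operator $b\mapsto b'bb''$. An equipped Cardy--Frobenius algebra $((A,l_A),(B,l_B),\phi,U,\star)$ is a Cardy--Frobenius algebra together with: involutive linear anti-automorphisms $\star:A\to A$ and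 $\star:B\to B$ such that $l_A(x^\star)=l_A(x)$, $l_B(x^\star)=l_B(x)$, $\phi(x^\star)=\phi(x)^\star$; and an element $U\in A$ such that $U^2=K_A^\star$ and $\phi(U)=K_B^\star$. Here, for a Frobenius pair $(C,l_C)$ with basis $\gamma_1,\dots,\gamma_N$ and with $(F_C^{ij})$ the inverse of the matrix $((\gamma_i,\gamma_j)_C)$, one puts $K_C^\star=\sum_{i,j}F_C^{ij}\gamma_i\gamma_j^\star$. It is semi-simple if $A$ and $B$ are semi-simple. Direct sums are taken componentwise (in $A$, $B$, $l_A$, $l_B$, $\phi$, $U$, $\star$). An isomorphism is a pair of algebra isomorphisms of the $A$- and $B$-parts compatible with $l_A,l_B,\phi,U,\star$. The algebras $H^{\mathbb{D}}_{n,\mu}\otimes\mathbb{C}$: let $\mathbb{D}\in\{\mathbb{R},\mathbb{C},\mathbb{H}\}$, $d=\dim_{\mathbb{R}}\mathbb{D}$, $n$ an integer, $\mu\in\mathbb{C}\setminus\{0\}$. Put $A_R=Z(\mathbb{D})$ and $B_R=\mathrm{Mat}_n(\mathbb{D})$, with $l_{B_R}(x)=\mu\,\mathrm{Re}\,\mathrm{Tr}(x)$, $l_{A_R}(a)=\mu^2\,\mathrm{Re}(a)/d$, $\phi_R(a)=a\,\mathrm{Id}$, $a^{\star_R}=\overline{a}$, $x^{\star_R}=\overline{x}^{\,t}$ (standard conjugation of $\mathbb{D}$ and matrix transposition), $U_R=(2-d)/\mu$. Then $H^{\mathbb{D}}_{n,\mu}\otimes\mathbb{C}$ has $A=A_R\otimes_{\mathbb{R}}\mathbb{C}$,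 $B=B_R\otimes_{\mathbb{R}}\mathbb{C}$, with $l_A,l_B,\phi,\star$ the $\mathbb{C}$-linear extensions of $l_{A_R},l_{B_R},\phi_R,\star_R$ and $U=1\otimes\frac{2-d}{\mu}\in A$. The summand $\mathrm{Ker}(\phi)$ is regarded as an equipped Cardy--Frobenius algebra with $A$-part the ideal $\mathrm{Ker}(\phi)$ of $A$ (with the restrictions of $l_A$ and $\star$, and the component of $U$ in $\mathrm{Ker}(\phi)$) and $B$-part equal to $0$. *)

theory Defs
  imports "HOL-Algebra.QuotRing" "Jordan_Normal_Form.VS_Connect"
begin

section \<open>Finite-dimensional complex algebras\<close>

text \<open>
  Associative unital algebras over \<open>\<complex>\<close> are records of type \<^typ>\<open>(complex, 'a) module\<close>.
  The library locale \<^locale>\<open>algebra\<close> cannot be used since it requires commutativity.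
  Zero and one may coincide, so the zero algebra is included.
\<close>

definition fd_algebra :: "(complex, 'a) module \<Rightarrow> bool" where
  "fd_algebra C \<longleftrightarrow>
     ring C \<and> vectorspace class_ring C \<and> vectorspace.fin_dim class_ring C \<and>
     (\<forall>c. \<forall>x\<in>carrier C. \<forall>y\<in>carrier C.
        (c \<odot>\<^bsub>C\<^esub> x) \<otimes>\<^bsub>C\<^esub> y = c \<odot>\<^bsub>C\<^esub> (x \<otimes>\<^bsub>C\<^esub> y) \<and>
        x \<otimes>\<^bsub>C\<^esub> (c \<odot>\<^bsub>C\<^esub> y) = c \<odot>\<^bsub>C\<^esub> (x \<otimes>\<^bsub>C\<^esub> y))"

definition alg_hom :: "(complex, 'a) module \<Rightarrow> (complex, 'b) module \<Rightarrow> ('a \<Rightarrow> 'b) set" where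
  "alg_hom C D = Ring.ring_hom C D \<inter> LinearCombinations.module_hom class_ring C D"

definition alg_iso :: "(complex, 'a) module \<Rightarrow> (complex, 'b) module \<Rightarrow> ('a \<Rightarrow> 'b) set" where
  "alg_iso C D = ring_iso C D \<inter> LinearCombinations.module_hom class_ring C D"

definition ring_center :: "('a, 'm) ring_scheme \<Rightarrow> 'a set" where
  "ring_center R = {z \<in> carrier R. \<forall>x\<in>carrier R. z \<otimes>\<^bsub>R\<^esub> x = x \<otimes>\<^bsub>R\<^esub> z}"

definition left_ideal :: "'a set \<Rightarrow> ('a, 'm) ring_scheme \<Rightarrow> bool" where
  "left_ideal L R \<longleftrightarrow> additive_subgroup L R \<and> (\<forall>x\<in>carrier R. \<forall>y\<in>L. x \<otimes>\<^bsub>R\<^esub> y \<in> L)"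

definition maximal_left_ideal :: "'a set \<Rightarrow> ('a, 'm) ring_scheme \<Rightarrow> bool" where
  "maximal_left_ideal L R \<longleftrightarrow>
     left_ideal L R \<and> L \<noteq> carrier R \<and>
     (\<forall>J. left_ideal J R \<and> L \<subseteq> J \<longrightarrow> J = L \<or> J = carrier R)"

definition jacobson_radical :: "('a, 'm) ring_scheme \<Rightarrow> 'a set" where
  "jacobson_radical R = {x \<in> carrier R. \<forall>L. maximal_left_ideal L R \<longrightarrow> x \<in> L}"

text \<open>The usual definition of semisimplicity for finite-dimensional algebras.\<close>

definition semisimple_alg :: "('a, 'm) ring_scheme \<Rightarrow> bool" where
  "semisimple_alg R \<longleftrightarrow> jacobson_radical R = {\<zero>\<^bsub>R\<^esub>}"

text \<open>
  The trace of an operator and the element \<open>K\<^sup>\<star>\<close> are computed in an arbitrarily chosen basis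
  \<open>\<gamma>\<close>; neither depends on the choice.  In \<open>lin_trace\<close> and \<open>K_star\<close> the matrices selected by
  \<open>SOME\<close> are unique for linear \<open>T\<close>, respectively for a non-degenerate form.
\<close>

definition some_basis :: "(complex, 'a) module \<Rightarrow> 'a list" where
  "some_basis C = (SOME \<gamma>. distinct \<gamma> \<and> vectorspace.basis class_ring C (set \<gamma>))"

definition mat_trace :: "'r::comm_monoid_add mat \<Rightarrow> 'r" where
  "mat_trace M = (\<Sum>i<dim_row M. M $$ (i, i))"

definition lin_trace :: "(complex, 'a) module \<Rightarrow> ('a \<Rightarrow> 'a) \<Rightarrow> complex" where
  "lin_trace C T =
     (let \<gamma> = some_basis C; N = length \<gamma>;
          M = (SOME M. M \<in> carrier_mat N N \<and>
                 (\<forall>j<N. T (\<gamma> ! j) = (\<Oplus>\<^bsub>C\<^esub>i\<in>{..<N}. M $$ (i, j) \<odot>\<^bsub>C\<^esub> (\<gamma> ! i))))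
      in mat_trace M)"

section \<open>Equipped Cardy-Frobenius algebras\<close>

definition frobenius_pair :: "(complex, 'a) module \<Rightarrow> ('a \<Rightarrow> complex) \<Rightarrow> bool" where
  "frobenius_pair C l \<longleftrightarrow>
     fd_algebra C \<and>
     (\<forall>x\<in>carrier C. \<forall>y\<in>carrier C. l (x \<oplus>\<^bsub>C\<^esub> y) = l x + l y) \<and>
     (\<forall>c. \<forall>x\<in>carrier C. l (c \<odot>\<^bsub>C\<^esub> x) = c * l x) \<and>
     (\<forall>x\<in>carrier C. \<forall>y\<in>carrier C. l (x \<otimes>\<^bsub>C\<^esub> y) = l (y \<otimes>\<^bsub>C\<^esub> x)) \<and>
     (\<forall>x\<in>carrier C. (\<forall>y\<in>carrier C. l (x \<otimes>\<^bsub>C\<^esub> y) = 0) \<longrightarrow> x = \<zero>\<^bsub>C\<^esub>)"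

definition K_star :: "(complex, 'a) module \<Rightarrow> ('a \<Rightarrow> complex) \<Rightarrow> ('a \<Rightarrow> 'a) \<Rightarrow> 'a" where
  "K_star C l star =
     (let \<gamma> = some_basis C; N = length \<gamma>;
          G = mat N N (\<lambda>(i, j). l (\<gamma> ! i \<otimes>\<^bsub>C\<^esub> \<gamma> ! j));
          F = (SOME F. F \<in> carrier_mat N N \<and> inverts_mat F G \<and> inverts_mat G F)
      in \<Oplus>\<^bsub>C\<^esub>i\<in>{..<N}. \<Oplus>\<^bsub>C\<^esub>j\<in>{..<N}. F $$ (i, j) \<odot>\<^bsub>C\<^esub> (\<gamma> ! i \<otimes>\<^bsub>C\<^esub> star (\<gamma> ! j)))"

definition involutive_anti_automorphism :: "(complex, 'a) module \<Rightarrow> ('a \<Rightarrow> 'a) \<Rightarrow> bool" where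
  "involutive_anti_automorphism C star \<longleftrightarrow>
     star \<in> LinearCombinations.module_hom class_ring C C \<and>
     (\<forall>x\<in>carrier C. \<forall>y\<in>carrier C. star (x \<otimes>\<^bsub>C\<^esub> y) = star y \<otimes>\<^bsub>C\<^esub> star x) \<and>
     (\<forall>x\<in>carrier C. star (star x) = x)"

record ('a, 'b) cf_data =
  algA :: "(complex, 'a) module"
  formA :: "'a \<Rightarrow> complex"
  algB :: "(complex, 'b) module"
  formB :: "'b \<Rightarrow> complex"
  phi :: "'a \<Rightarrow> 'b"

record ('a, 'b) ecf_data = "('a, 'b) cf_data" +
  elemU :: 'a
  starA :: "'a \<Rightarrow> 'a"
  starB :: "'b \<Rightarrow> 'b"

definition phi_dual :: "('a, 'b, 'm) cf_data_scheme \<Rightarrow> 'b \<Rightarrow> 'a" where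
  "phi_dual X b =
     (THE z. z \<in> carrier (algA X) \<and>
        (\<forall>a\<in>carrier (algA X).
           formA X (z \<otimes>\<^bsub>algA X\<^esub> a) = formB X (b \<otimes>\<^bsub>algB X\<^esub> phi X a)))"

definition cardy_frobenius :: "('a, 'b, 'm) cf_data_scheme \<Rightarrow> bool" where
  "cardy_frobenius X \<longleftrightarrow>
     cring (algA X) \<and> frobenius_pair (algA X) (formA X) \<and>
     frobenius_pair (algB X) (formB X) \<and>
     phi X \<in> alg_hom (algA X) (algB X) \<and>
     phi X ` carrier (algA X) \<subseteq> ring_center (algB X) \<and>
     (\<forall>b'\<in>carrier (algB X). \<forall>b''\<in>carrier (algB X).
        formA X (phi_dual X b' \<otimes>\<^bsub>algA X\<^esub> phi_dual X b'') =
        lin_trace (algB X) (\<lambda>b. b' \<otimes>\<^bsub>algB X\<^esub> b \<otimes>\<^bsub>algB X\<^esub> b''))"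

definition equipped_cardy_frobenius :: "('a, 'b) ecf_data \<Rightarrow> bool" where
  "equipped_cardy_frobenius X \<longleftrightarrow>
     cardy_frobenius X \<and>
     involutive_anti_automorphism (algA X) (starA X) \<and>
     involutive_anti_automorphism (algB X) (starB X) \<and>
     (\<forall>a\<in>carrier (algA X). formA X (starA X a) = formA X a) \<and>
     (\<forall>b\<in>carrier (algB X). formB X (starB X b) = formB X b) \<and>
     (\<forall>a\<in>carrier (algA X). phi X (starA X a) = starB X (phi X a)) \<and>
     elemU X \<in> carrier (algA X) \<and>
     elemU X \<otimes>\<^bsub>algA X\<^esub> elemU X = K_star (algA X) (formA X) (starA X) \<and>
     phi X (elemU X) = K_star (algB X) (formB X) (starB X)"

definition semisimple_ecf :: "('a, 'b) ecf_data \<Rightarrow> bool" where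
  "semisimple_ecf X \<longleftrightarrow> semisimple_alg (algA X) \<and> semisimple_alg (algB X)"

definition ecf_isomorphic :: "('a, 'b) ecf_data \<Rightarrow> ('c, 'd) ecf_data \<Rightarrow> bool" where
  "ecf_isomorphic X Y \<longleftrightarrow>
     (\<exists>f\<in>alg_iso (algA X) (algA Y). \<exists>g\<in>alg_iso (algB X) (algB Y).
        (\<forall>a\<in>carrier (algA X). formA Y (f a) = formA X a) \<and>
        (\<forall>b\<in>carrier (algB X). formB Y (g b) = formB X b) \<and>
        (\<forall>a\<in>carrier (algA X). g (phi X a) = phi Y (f a)) \<and>
        f (elemU X) = elemU Y \<and>
        (\<forall>a\<in>carrier (algA X). f (starA X a) = starA Y (f a)) \<and>
        (\<forall>b\<in>carrier (algB X). g (starB X b) = starB Y (g b)))"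

section \<open>Direct sums\<close>

definition alg_sum2 ::
    "(complex, 'a) module \<Rightarrow> (complex, 'b) module \<Rightarrow> (complex, 'a \<times> 'b) module" where
  "alg_sum2 C D = \<lparr>
     carrier = carrier C \<times> carrier D,
     mult = (\<lambda>(x, y) (x', y'). (x \<otimes>\<^bsub>C\<^esub> x', y \<otimes>\<^bsub>D\<^esub> y')),
     one = (\<one>\<^bsub>C\<^esub>, \<one>\<^bsub>D\<^esub>),
     zero = (\<zero>\<^bsub>C\<^esub>, \<zero>\<^bsub>D\<^esub>),
     add = (\<lambda>(x, y) (x', y'). (x \<oplus>\<^bsub>C\<^esub> x', y \<oplus>\<^bsub>D\<^esub> y')),
     smult = (\<lambda>c (x, y). (c \<odot>\<^bsub>C\<^esub> x, c \<odot>\<^bsub>D\<^esub> y))\<rparr>"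

definition alg_sum :: "'i set \<Rightarrow> ('i \<Rightarrow> (complex, 'a) module) \<Rightarrow> (complex, 'i \<Rightarrow> 'a) module" where
  "alg_sum I C = \<lparr>
     carrier = (\<Pi>\<^sub>E i\<in>I. carrier (C i)),
     mult = (\<lambda>x y. \<lambda>i\<in>I. x i \<otimes>\<^bsub>C i\<^esub> y i),
     one = (\<lambda>i\<in>I. \<one>\<^bsub>C i\<^esub>),
     zero = (\<lambda>i\<in>I. \<zero>\<^bsub>C i\<^esub>),
     add = (\<lambda>x y. \<lambda>i\<in>I. x i \<oplus>\<^bsub>C i\<^esub> y i),
     smult = (\<lambda>c x. \<lambda>i\<in>I. c \<odot>\<^bsub>C i\<^esub> x i)\<rparr>"

definition ecf_sum2 ::
    "('a, 'b) ecf_data \<Rightarrow> ('c, 'd) ecf_data \<Rightarrow> ('a \<times> 'c, 'b \<times> 'd) ecf_data" where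
  "ecf_sum2 X Y = \<lparr>
     algA = alg_sum2 (algA X) (algA Y),
     formA = (\<lambda>(x, y). formA X x + formA Y y),
     algB = alg_sum2 (algB X) (algB Y),
     formB = (\<lambda>(x, y). formB X x + formB Y y),
     phi = map_prod (phi X) (phi Y),
     elemU = (elemU X, elemU Y),
     starA = map_prod (starA X) (starA Y),
     starB = map_prod (starB X) (starB Y)\<rparr>"

text \<open>Intended for finite index sets; the empty sum is the zero object.\<close>

definition ecf_sum ::
    "'i set \<Rightarrow> ('i \<Rightarrow> ('a, 'b) ecf_data) \<Rightarrow> ('i \<Rightarrow> 'a, 'i \<Rightarrow> 'b) ecf_data" where
  "ecf_sum I X = \<lparr>
     algA = alg_sum I (\<lambda>i. algA (X i)),
     formA = (\<lambda>x. \<Sum>i\<in>I. formA (X i) (x i)),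
     algB = alg_sum I (\<lambda>i. algB (X i)),
     formB = (\<lambda>x. \<Sum>i\<in>I. formB (X i) (x i)),
     phi = (\<lambda>x. \<lambda>i\<in>I. phi (X i) (x i)),
     elemU = (\<lambda>i\<in>I. elemU (X i)),
     starA = (\<lambda>x. \<lambda>i\<in>I. starA (X i) (x i)),
     starB = (\<lambda>x. \<lambda>i\<in>I. starB (X i) (x i))\<rparr>"

section \<open>The kernel summand\<close>

text \<open>
  For semisimple \<open>A\<close> the ideal \<open>Ker \<phi>\<close> has its own identity \<open>e\<close>, and \<open>A\<close> is the direct sum of the
  ideals \<open>Ker \<phi> = e A\<close> and \<open>(1 - e) A\<close>; so \<open>e U\<close> is the component of \<open>U\<close> in \<open>Ker \<phi>\<close>.
  The \<open>B\<close>-part is the zero algebra, carried by \<open>{0} \<subseteq> B\<close>.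
\<close>

definition ker_unit :: "('a, 'b, 'm) cf_data_scheme \<Rightarrow> 'a" where
  "ker_unit X =
     (THE e. e \<in> a_kernel (algA X) (algB X) (phi X) \<and>
        (\<forall>x\<in>a_kernel (algA X) (algB X) (phi X).
           e \<otimes>\<^bsub>algA X\<^esub> x = x \<and> x \<otimes>\<^bsub>algA X\<^esub> e = x))"

definition ecf_ker :: "('a, 'b) ecf_data \<Rightarrow> ('a, 'b) ecf_data" where
  "ecf_ker X = X\<lparr>
     algA := (algA X)\<lparr>carrier := a_kernel (algA X) (algB X) (phi X), one := ker_unit X\<rparr>,
     algB := (algB X)\<lparr>carrier := {\<zero>\<^bsub>algB X\<^esub>}, one := \<zero>\<^bsub>algB X\<^esub>\<rparr>,
     elemU := ker_unit X \<otimes>\<^bsub>algA X\<^esub> elemU X\<rparr>"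

section \<open>Quaternions\<close>

codatatype quat = Quat (QRe: real) (QI: real) (QJ: real) (QK: real)

lemma quat_eq_iff: "x = y \<longleftrightarrow> QRe x = QRe y \<and> QI x = QI y \<and> QJ x = QJ y \<and> QK x = QK y"
  by (auto intro: quat.expand)

instantiation quat :: real_algebra_1
begin

primcorec zero_quat where
  "QRe 0 = 0" | "QI 0 = 0" | "QJ 0 = 0" | "QK 0 = 0"

primcorec one_quat where
  "QRe 1 = 1" | "QI 1 = 0" | "QJ 1 = 0" | "QK 1 = 0"

primcorec plus_quat where
  "QRe (x + y) = QRe x + QRe y"
| "QI (x + y) = QI x + QI y"
| "QJ (x + y) = QJ x + QJ y"
| "QK (x + y) = QK x + QK y"

primcorec uminus_quat where
  "QRe (- x) = - QRe x"
| "QI (- x) = - QI x"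
| "QJ (- x) = - QJ x"
| "QK (- x) = - QK x"

primcorec minus_quat where
  "QRe (x - y) = QRe x - QRe y"
| "QI (x - y) = QI x - QI y"
| "QJ (x - y) = QJ x - QJ y"
| "QK (x - y) = QK x - QK y"

primcorec times_quat where
  "QRe (x * y) = QRe x * QRe y - QI x * QI y - QJ x * QJ y - QK x * QK y"
| "QI (x * y) = QRe x * QI y + QI x * QRe y + QJ x * QK y - QK x * QJ y"
| "QJ (x * y) = QRe x * QJ y - QI x * QK y + QJ x * QRe y + QK x * QI y"
| "QK (x * y) = QRe x * QK y + QI x * QJ y - QJ x * QI y + QK x * QRe y"

primcorec scaleR_quat where
  "QRe (scaleR r x) = r * QRe x"
| "QI (scaleR r x) = r * QI x"
| "QJ (scaleR r x) = r * QJ x"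
| "QK (scaleR r x) = r * QK x"

instance
  by standard (simp_all add: quat_eq_iff algebra_simps)

end

primcorec qcnj :: "quat \<Rightarrow> quat" where
  "QRe (qcnj x) = QRe x"
| "QI (qcnj x) = - QI x"
| "QJ (qcnj x) = - QJ x"
| "QK (qcnj x) = - QK x"

text \<open>
  \<open>\<real>\<close>, \<open>\<complex>\<close> and \<open>\<bbbH>\<close> are all realised inside the quaternions, as \<^term>\<open>\<real> :: quat set\<close>,
  \<open>quat_complexes\<close> and \<^term>\<open>UNIV :: quat set\<close>.  The standard conjugation and real part of each are
  the restrictions of those of the quaternions.
\<close>

definition quat_complexes :: "quat set" where
  "quat_complexes = {x. QJ x = 0 \<and> QK x = 0}"

section \<open>The algebras \<open>H\<^bsub>n,\<mu>\<^esub> \<otimes> \<complex>\<close>\<close>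

definition division_alg :: "quat set \<Rightarrow> (real, quat) module" where
  "division_alg D = \<lparr>carrier = D, mult = (*), one = 1, zero = 0, add = (+), smult = (*\<^sub>R)\<rparr>"

definition center_alg :: "quat set \<Rightarrow> (real, quat) module" where
  "center_alg D = (division_alg D)\<lparr>carrier := ring_center (division_alg D)\<rparr>"

definition mat_alg :: "quat set \<Rightarrow> nat \<Rightarrow> (real, quat mat) module" where
  "mat_alg D n = \<lparr>
     carrier = {M \<in> carrier_mat n n. elements_mat M \<subseteq> D},
     mult = (*), one = 1\<^sub>m n, zero = 0\<^sub>m n n, add = (+),
     smult = (\<lambda>r. map_mat ((*\<^sub>R) r))\<rparr>"

text \<open>
  The complexification \<open>R \<otimes>\<^sub>\<real> \<complex>\<close> of a real algebra: the pair \<open>(x, y)\<close> stands for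
  \<open>x \<otimes> 1 + y \<otimes> \<i>\<close>.
\<close>

definition complexify :: "(real, 'r) module \<Rightarrow> (complex, 'r \<times> 'r) module" where
  "complexify R = \<lparr>
     carrier = carrier R \<times> carrier R,
     mult = (\<lambda>(x, y) (x', y').
       (x \<otimes>\<^bsub>R\<^esub> x' \<oplus>\<^bsub>R\<^esub> (-1) \<odot>\<^bsub>R\<^esub> (y \<otimes>\<^bsub>R\<^esub> y'), x \<otimes>\<^bsub>R\<^esub> y' \<oplus>\<^bsub>R\<^esub> y \<otimes>\<^bsub>R\<^esub> x')),
     one = (\<one>\<^bsub>R\<^esub>, \<zero>\<^bsub>R\<^esub>),
     zero = (\<zero>\<^bsub>R\<^esub>, \<zero>\<^bsub>R\<^esub>),
     add = (\<lambda>(x, y) (x', y'). (x \<oplus>\<^bsub>R\<^esub> x', y \<oplus>\<^bsub>R\<^esub> y')),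
     smult = (\<lambda>c (x, y).
       (Re c \<odot>\<^bsub>R\<^esub> x \<oplus>\<^bsub>R\<^esub> (- Im c) \<odot>\<^bsub>R\<^esub> y, Re c \<odot>\<^bsub>R\<^esub> y \<oplus>\<^bsub>R\<^esub> Im c \<odot>\<^bsub>R\<^esub> x))\<rparr>"

text \<open>\<open>\<complex>\<close>-linear extensions of a real-linear functional and of a real-linear map.\<close>

definition extend_form :: "('r \<Rightarrow> complex) \<Rightarrow> 'r \<times> 'r \<Rightarrow> complex" where
  "extend_form l = (\<lambda>(x, y). l x + \<i> * l y)"

definition extend_map :: "('r \<Rightarrow> 's) \<Rightarrow> 'r \<times> 'r \<Rightarrow> 's \<times> 's" where
  "extend_map f = map_prod f f"

definition H_ecf :: "quat set \<Rightarrow> nat \<Rightarrow> complex \<Rightarrow> (quat \<times> quat, quat mat \<times> quat mat) ecf_data" where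
  "H_ecf D n \<mu> =
     (let d = of_nat (Real_Vector_Spaces.dim D) in \<lparr>
       algA = complexify (center_alg D),
       formA = extend_form (\<lambda>a. \<mu>\<^sup>2 * of_real (QRe a) / d),
       algB = complexify (mat_alg D n),
       formB = extend_form (\<lambda>x. \<mu> * of_real (QRe (mat_trace x))),
       phi = extend_map (\<lambda>a. a \<cdot>\<^sub>m 1\<^sub>m n),
       elemU = ((2 - d) / \<mu>) \<odot>\<^bsub>complexify (center_alg D)\<^esub> \<one>\<^bsub>complexify (center_alg D)\<^esub>,
       starA = extend_map qcnj,
       starB = extend_map (\<lambda>x. transpose_mat (map_mat qcnj x))\<rparr>)"

end

theory Submission
  imports Defs "HOL-Computational_Algebra.Fundamental_Theorem_Algebra"
begin

text \<open>
  Both algebras embed into one ring of linear operators.  A primitive idempotent \<open>e\<close> of \<open>B\<close> yields a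
  self-adjoint idempotent \<open>\<epsilon>\<close> with \<open>\<epsilon> B \<epsilon> = D \<otimes> \<complex>\<close> compatibly with the involutions: if
  \<open>e\<^sup>\<star> B e = 0\<close> then \<open>D = \<complex>\<close>; otherwise \<open>e\<^sup>\<star> B e\<close> is a line, on which \<open>\<star>\<close> acts as \<open>1\<close> (\<open>D = \<real>\<close>) or
  \<open>-1\<close> (\<open>D\<close> the quaternions).  A maximal family \<open>v\<^sub>a \<in> B \<epsilon>\<close> with \<open>v\<^sub>a\<^sup>\<star> v\<^sub>b = \<delta>\<^sub>a\<^sub>b \<epsilon>\<close> gives matrix units
  \<open>\<Gamma>\<^sub>a\<^sub>b(p) = v\<^sub>a p v\<^sub>b\<^sup>\<star>\<close> for \<open>p \<in> D\<close>, whose span is a two-sided ideal \<open>Mat\<^sub>n(D) \<otimes> \<complex>\<close>, and \<open>B\<close> is the sum of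
  finitely many such blocks.

  In a block with \<open>l\<^sub>B = \<mu> Re Tr\<close> the elements \<open>\<Gamma>\<^sub>a\<^sub>b(q)\<close> and \<open>\<Gamma>\<^sub>b\<^sub>a(q\<^sup>\<star>) / \<mu>\<close>, for \<open>q\<close> in the standard basis
  of \<open>D\<close>, are dual bases.  Hence the Cardy condition says \<open>\<phi> (\<phi>\<^sup>* \<Gamma>\<^sub>0\<^sub>0(p)) = (d / \<mu>) \<Sigma>\<^sub>a \<Gamma>\<^sub>a\<^sub>a(p)\<close> for central
  \<open>p\<close>, so \<open>p \<mapsto> (\<mu> / d) \<phi>\<^sup>* \<Gamma>\<^sub>0\<^sub>0(p)\<close> embeds \<open>Z(D) \<otimes> \<complex>\<close> into \<open>A\<close> as a complement of \<open>Ker \<phi>\<close> over that block; and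
  \<open>\<Sigma>\<^sub>q q\<^sup>2 = 2 - d\<close> determines \<open>\<phi> U = K\<^sub>B\<^sup>\<star>\<close> there.
\<close>

section \<open>Primitive idempotents\<close>

text \<open>The difficulty lies in the involution rather than in the algebra structure: a Wedderburn
  isomorphism alone would leave an unknown involution on every matrix block. The matrix units are
  therefore built so that \<open>star\<close> is conjugate transposition from the start. Over the
  complex numbers every nonzero scalar has a square root, so no signature survives, and the
  behaviour of \<open>star\<close> on one primitive idempotent decides which D occurs. In the real
  case the primitive idempotent itself need not be self-adjoint, and a vector with nonzero square
  has to be found before it can be replaced. Semisimplicity is used in the form "x S x = 0 implies x
  = 0"; together with the non-degenerate form it takes the place of positivity in the orthogonality
  arguments. The form on A is not normalised by any choice: the Cardy condition forces the value
  \<mu>^2 Re(p) / d on the copy of the centre of D. One factor \<mu> comes from the form on B, the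
  quotient \<mu> / d from inverting the constant in the formula for \<phi> \<phi>*. The image of
  \<phi>* is orthogonal to Ker \<phi>, so the Cardy condition says nothing about the kernel, which
  stays as a summand of its own.\<close>

locale complex_algebra = vector_space scale
  for scale :: "complex \<Rightarrow> 'r::ring \<Rightarrow> 'r" (infixr "*\<^sub>C" 75) +
  assumes scale_left [simp]: "(c *\<^sub>C x) * y = c *\<^sub>C (x * y)"
    and scale_right [simp]: "x * (c *\<^sub>C y) = c *\<^sub>C (x * y)"

text \<open>The algebra is a subset \<open>S\<close> of an ambient ring, and its unit is a
  parameter: the class \<open>ring\<close> provides none, and the unit of an embedded algebra need
  not be the identity of the ambient ring. The clause \<open>semiprime\<close> is what
  semisimplicity contributes.\<close>

locale involutive_frobenius = complex_algebra scale
  for scale :: "complex \<Rightarrow> 'r::ring \<Rightarrow> 'r" (infixr "*\<^sub>C" 75) +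
  fixes S :: "'r set" and unit :: 'r and l :: "'r \<Rightarrow> complex" and star :: "'r \<Rightarrow> 'r"
  assumes zero_closed [simp, intro]: "0 \<in> S"
    and add_closed [simp, intro]: "x \<in> S \<Longrightarrow> y \<in> S \<Longrightarrow> x + y \<in> S"
    and scale_closed [simp, intro]: "x \<in> S \<Longrightarrow> c *\<^sub>C x \<in> S"
    and mult_closed [simp, intro]: "x \<in> S \<Longrightarrow> y \<in> S \<Longrightarrow> x * y \<in> S"
    and unit_closed [simp, intro]: "unit \<in> S"
    and unit_left [simp]: "x \<in> S \<Longrightarrow> unit * x = x"
    and unit_right [simp]: "x \<in> S \<Longrightarrow> x * unit = x"
    and finite_span: "\<exists>T. finite T \<and> S \<subseteq> span T"
    and l_add: "x \<in> S \<Longrightarrow> y \<in> S \<Longrightarrow> l (x + y) = l x + l y"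
    and l_scale: "x \<in> S \<Longrightarrow> l (c *\<^sub>C x) = c * l x"
    and l_commute: "x \<in> S \<Longrightarrow> y \<in> S \<Longrightarrow> l (x * y) = l (y * x)"
    and l_nondegenerate: "x \<in> S \<Longrightarrow> (\<And>y. y \<in> S \<Longrightarrow> l (x * y) = 0) \<Longrightarrow> x = 0"
    and star_closed [simp, intro]: "x \<in> S \<Longrightarrow> star x \<in> S"
    and star_add: "x \<in> S \<Longrightarrow> y \<in> S \<Longrightarrow> star (x + y) = star x + star y"
    and star_scale: "x \<in> S \<Longrightarrow> star (c *\<^sub>C x) = c *\<^sub>C star x"
    and star_mult: "x \<in> S \<Longrightarrow> y \<in> S \<Longrightarrow> star (x * y) = star y * star x"
    and star_star [simp]: "x \<in> S \<Longrightarrow> star (star x) = x"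
    and l_star [simp]: "x \<in> S \<Longrightarrow> l (star x) = l x"
    and semiprime: "x \<in> S \<Longrightarrow> (\<And>y. y \<in> S \<Longrightarrow> x * y * x = 0) \<Longrightarrow> x = 0"
begin

lemma uminus_closed [simp, intro]: "x \<in> S \<Longrightarrow> - x \<in> S"
  using scale_closed[of x "-1"] by simp

lemma diff_closed [simp, intro]: "x \<in> S \<Longrightarrow> y \<in> S \<Longrightarrow> x - y \<in> S"
  using add_closed[of x "- y"] by simp

lemma sum_closed [intro]: "(\<And>i. i \<in> I \<Longrightarrow> f i \<in> S) \<Longrightarrow> sum f I \<in> S"
  by (induct I rule: infinite_finite_induct) auto

lemma l_zero [simp]: "l 0 = 0"
  using l_scale[of 0 0] by simp

lemma l_uminus: "x \<in> S \<Longrightarrow> l (- x) = - l x"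
  using l_scale[of x "-1"] by simp

lemma l_diff: "x \<in> S \<Longrightarrow> y \<in> S \<Longrightarrow> l (x - y) = l x - l y"
  using l_add[of x "- y"] by (simp add: l_uminus)

lemma l_sum: "(\<And>i. i \<in> I \<Longrightarrow> f i \<in> S) \<Longrightarrow> l (sum f I) = (\<Sum>i\<in>I. l (f i))"
proof (induct I rule: infinite_finite_induct)
  case (insert a I)
  have "l (f a + sum f I) = l (f a) + l (sum f I)"
    by (rule l_add) (use insert in \<open>auto intro!: sum_closed\<close>)
  with insert show ?case by simp
qed auto

lemma star_zero [simp]: "star 0 = 0"
  using star_scale[of 0 0] by simp

lemma star_uminus: "x \<in> S \<Longrightarrow> star (- x) = - star x"
  using star_scale[of x "-1"] by simp

lemma star_diff: "x \<in> S \<Longrightarrow> y \<in> S \<Longrightarrow> star (x - y) = star x - star y"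
  using star_add[of x "- y"] by (simp add: star_uminus)

lemma star_sum: "(\<And>i. i \<in> I \<Longrightarrow> f i \<in> S) \<Longrightarrow> star (sum f I) = (\<Sum>i\<in>I. star (f i))"
proof (induct I rule: infinite_finite_induct)
  case (insert a I)
  have "star (f a + sum f I) = star (f a) + star (sum f I)"
    by (rule star_add) (use insert in \<open>auto intro!: sum_closed\<close>)
  with insert show ?case by simp
qed auto

lemma star_unit: "star unit = unit"
  by (metis star_closed star_mult star_star unit_closed unit_left unit_right)

text \<open>Vectors separated by the functionals \<open>l (w i * _)\<close> are independent, so a
  finite spanning set bounds their number. This makes maximal families exist, both for orthonormal
  vectors and for blocks, without any positivity of the form.\<close>

lemma biorthogonal_bound:
  "\<exists>N. \<forall>m v w. (\<forall>i<m. v i \<in> S \<and> w i \<in> S) \<longrightarrow>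
     (\<forall>i<m. \<forall>j<m. l (w i * v j) = 0 \<longleftrightarrow> i \<noteq> j) \<longrightarrow> m \<le> (N :: nat)"
proof -
  obtain T where T: "finite T" "S \<subseteq> span T" using finite_span by blast
  show ?thesis
  proof (intro exI allI impI)
    fix m :: nat and v w :: "nat \<Rightarrow> 'r"
    assume vw: "\<forall>i<m. v i \<in> S \<and> w i \<in> S"
      and d: "\<forall>i<m. \<forall>j<m. l (w i * v j) = 0 \<longleftrightarrow> i \<noteq> j"
    have inj: "inj_on v {..<m}"
      by (rule inj_onI) (metis d lessThan_iff)
    have "independent (v ` {..<m})"
    proof (rule independent_if_scalars_zero)
      fix f x assume s: "(\<Sum>x\<in>v ` {..<m}. f x *\<^sub>C x) = 0" and x: "x \<in> v ` {..<m}"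
      then obtain i where i: "i < m" "x = v i" by auto
      have "0 = l (w i * (\<Sum>j<m. f (v j) *\<^sub>C v j))"
        using s by (simp add: sum.reindex[OF inj])
      also have "\<dots> = (\<Sum>j<m. f (v j) * l (w i * v j))"
        using vw i by (subst sum_distrib_left, subst l_sum) (auto simp: l_scale)
      also have "\<dots> = (\<Sum>j<m. if j = i then f (v i) * l (w i * v i) else 0)"
        by (rule sum.cong) (use d i in auto)
      also have "\<dots> = f (v i) * l (w i * v i)" using i by simp
      finally show "f x = 0" using d i by auto
    qed simp
    moreover have "v ` {..<m} \<subseteq> span T" using vw T by auto
    ultimately have "card (v ` {..<m}) \<le> card T"
      using independent_span_bound[OF T(1)] by blast
    then show "m \<le> card T" by (simp add: card_image[OF inj])
  qed
qed

lemma subspace_eq_of_dim: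
  assumes V: "subspace V" and W: "W \<subseteq> S" and VW: "V \<subseteq> W" and d: "dim W \<le> dim V"
  shows "V = W"
proof -
  obtain T where T: "finite T" "S \<subseteq> span T" using finite_span by blast
  obtain B where B: "B \<subseteq> V" "independent B" "V \<subseteq> span B" "card B = dim V"
    using basis_exists by blast
  obtain B' where B': "B \<subseteq> B'" "B' \<subseteq> W" "independent B'" "W \<subseteq> span B'"
    using maximal_independent_subset_extend[of B W] B VW by blast
  have "finite B'" using independent_span_bound[OF T(1) B'(3)] B' W T by blast
  moreover have "card B' = dim W" using B' by (simp add: basis_card_eq_dim)
  ultimately have "B = B'" using card_subset_eq[of B' B] card_mono[of B' B] B B' d by auto
  then have "W \<subseteq> V" using B'(4) span_minimal[OF B(1) V] by blast
  with VW show ?thesis by blast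
qed

lemma subspace_left_ideal: "b \<in> S \<Longrightarrow> subspace ((\<lambda>y. y * b) ` S)"
  unfolding subspace_def image_iff
proof (intro conjI ballI allI)
  show "\<exists>y\<in>S. 0 = y * b" by (rule bexI[of _ 0]) auto
next
  fix x y assume "x \<in> (\<lambda>y. y * b) ` S" "y \<in> (\<lambda>y. y * b) ` S"
  then obtain x' y' where "x' \<in> S" "x = x' * b" "y' \<in> S" "y = y' * b" by blast
  then show "\<exists>z\<in>S. x + y = z * b" by (intro bexI[of _ "x' + y'"]) (auto simp: distrib_right)
next
  fix c x assume "x \<in> (\<lambda>y. y * b) ` S"
  then obtain x' where "x' \<in> S" "x = x' * b" by blast
  then show "\<exists>z\<in>S. c *\<^sub>C x = z * b" by (intro bexI[of _ "c *\<^sub>C x'"]) auto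
qed

text \<open>The idempotent generates a left ideal of minimal dimension.\<close>

lemma ex_division_idempotent:
  assumes c: "c \<in> S" "c \<noteq> 0" "c * c = c" "\<And>x. x \<in> S \<Longrightarrow> c * x = x * c"
  obtains e where "e \<in> S" "e \<noteq> 0" "e * e = e" "c * e = e"
    "\<And>x. x \<in> S \<Longrightarrow> e * x * e \<noteq> 0 \<Longrightarrow> \<exists>y\<in>S. (e * y * e) * (e * x * e) = e"
proof -
  define L where "L b = (\<lambda>y. y * b) ` S" for b
  define P where "P b \<longleftrightarrow> b \<in> S \<and> c * b = b \<and> b \<noteq> 0" for b
  have "P c" using c(1-3) by (auto simp: P_def)
  then obtain b where Pb: "P b" and min: "\<And>x. P x \<Longrightarrow> dim (L b) \<le> dim (L x)"
    using ex_has_least_nat[of P c "\<lambda>x. dim (L x)"] by blast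
  have b: "b \<in> S" "c * b = b" "b \<noteq> 0" using Pb by (auto simp: P_def)
  have LS: "L b \<subseteq> S" using b by (auto simp: L_def)
  have bL: "b \<in> L b" unfolding L_def using b unit_left by (metis image_eqI unit_closed)
  have minL: "L x = L b" if x: "x \<in> L b" "x \<noteq> 0" for x
  proof -
    obtain y where y: "y \<in> S" "x = y * b" using x(1) by (auto simp: L_def)
    have "c * x = y * (c * b)" using y c by (metis mult.assoc)
    then have "P x" using y b x by (auto simp: P_def)
    moreover have "L x \<subseteq> L b" using y by (auto simp: L_def mult.assoc[symmetric])
    ultimately show ?thesis
      using subspace_eq_of_dim[OF _ LS] subspace_left_ideal min unfolding L_def P_def by blast
  qed
  \<comment> \<open>Semiprimeness gives a = y b in \<open>L b\<close> with b a nonzero. By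
    minimality b a generates \<open>L b\<close> again, so a = d (b a), and e = d b acts on a as a
    left identity.\<close>
  obtain y where y: "y \<in> S" "b * y * b \<noteq> 0" using semiprime b by blast
  define a where "a = y * b"
  have a: "a \<in> S" "a \<in> L b" "b * a \<noteq> 0"
    using y b by (auto simp: a_def L_def mult.assoc)
  have "b * a \<in> L b" using b y by (auto simp: L_def a_def mult.assoc[symmetric])
  then have "a \<in> L (b * a)" using minL a by blast
  then obtain d where d: "d \<in> S" "a = d * (b * a)" by (auto simp: L_def)
  define e where "e = d * b"
  have e: "e \<in> S" "e \<in> L b" "e * a = a" using d b by (auto simp: e_def L_def mult.assoc)
  have e0: "e \<noteq> 0" using e a by auto
  have ce: "c * e = e" using d b c by (metis e_def mult.assoc)
  \<comment> \<open>The element e e - e lies in \<open>L b\<close> and is annihilated by right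
    multiplication with a. If it were nonzero it would generate \<open>L b\<close>, and then b a =
    0.\<close>
  have idem: "e * e = e"
  proof (rule ccontr)
    define k where "k = e * e - e"
    assume "e * e \<noteq> e"
    then have "k \<noteq> 0" by (simp add: k_def)
    moreover have "k = (e * d - d) * b"
      by (simp add: k_def e_def left_diff_distrib mult.assoc)
    then have "k \<in> L b" using e d by (auto simp: L_def)
    ultimately have "L k = L b" by (rule minL[rotated])
    then obtain y where y: "b = y * k" using bL by (auto simp: L_def)
    have "k * a = 0" using e by (simp add: k_def left_diff_distrib mult.assoc)
    then have "b * a = 0" by (simp add: y mult.assoc)
    then show False using a by simp
  qed
  show thesis
  proof (rule that[OF e(1) e0 idem ce])
    fix x assume x: "x \<in> S" "e * x * e \<noteq> 0"
    have "e * x * e = (e * x * d) * b" by (simp add: e_def mult.assoc)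
    then have "e * x * e \<in> L b" using x e d by (auto simp: L_def)
    then have "e \<in> L (e * x * e)" using minL x e by blast
    then obtain y where y: "y \<in> S" "e = y * (e * x * e)" by (auto simp: L_def)
    have "(e * y * e) * (e * x * e) = e * (y * (e * e * x * e))" by (simp add: mult.assoc)
    also have "\<dots> = e" using y(2) idem by simp
    finally show "\<exists>y\<in>S. (e * y * e) * (e * x * e) = e" using y by blast
  qed
qed

text \<open>The relation is packaged as a polynomial so that roots can be split off later. A
  repetition \<open>p i = p j\<close> is treated separately because independence concerns the set of
  values and would not notice it.\<close>

lemma ex_polynomial_relation:
  assumes p: "\<And>i. p i \<in> S"
  shows "\<exists>q :: complex poly. q \<noteq> 0 \<and> (\<Sum>i\<le>degree q. coeff q i *\<^sub>C p i) = 0"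
proof -
  obtain T where T: "finite T" "S \<subseteq> span T" using finite_span by blast
  define N where "N = card T"
  show ?thesis
  proof (cases "inj_on p {..N}")
    case False
    then obtain i j where ij: "i \<noteq> j" "p i = p j" by (auto simp: inj_on_def)
    define q where "q = monom (1::complex) i - monom 1 j"
    have c: "coeff q k = (if k = i then 1 else if k = j then -1 else 0)" for k
      using ij by (auto simp: q_def)
    have deg: "i \<le> degree q" "j \<le> degree q" using ij by (auto intro!: le_degree simp: c)
    have "(\<Sum>k\<le>degree q. coeff q k *\<^sub>C p k) =
        (\<Sum>k\<le>degree q. (if k = i then p i else 0) + (if k = j then - p j else 0))"
      by (rule sum.cong) (use ij in \<open>auto simp: c\<close>)
    also have "\<dots> = 0" using deg ij by (simp add: sum.distrib)
    finally have "(\<Sum>k\<le>degree q. coeff q k *\<^sub>C p k) = 0" .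
    moreover have "q \<noteq> 0" using c[of i] by auto
    ultimately show ?thesis by blast
  next
    case inj: True
    then have "card (p ` {..N}) = Suc N" by (simp add: card_image)
    then have "\<not> independent (p ` {..N})"
      using independent_span_bound[OF T(1), of "p ` {..N}"] p T by (auto simp: N_def)
    then obtain f x where f: "(\<Sum>x\<in>p ` {..N}. f x *\<^sub>C x) = 0" and x: "x \<in> p ` {..N}" "f x \<noteq> 0"
      using independent_if_scalars_zero[of "p ` {..N}"] by blast
    define q where "q = (\<Sum>i\<le>N. monom (f (p i)) i)"
    have c: "coeff q k = (if k \<le> N then f (p k) else 0)" for k
      by (simp add: q_def coeff_sum)
    have deg: "degree q \<le> N" by (rule degree_le) (simp add: c)
    have "(\<Sum>k\<le>degree q. coeff q k *\<^sub>C p k) = (\<Sum>k\<le>N. coeff q k *\<^sub>C p k)"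
      by (rule sum.mono_neutral_left) (use deg in \<open>auto simp: coeff_eq_0\<close>)
    also have "\<dots> = 0" using f by (simp add: c sum.reindex[OF inj])
    finally have "(\<Sum>k\<le>degree q. coeff q k *\<^sub>C p k) = 0" .
    moreover obtain k where "k \<le> N" "x = p k" using x by auto
    with x c[of k] have "q \<noteq> 0" by auto
    ultimately show ?thesis by blast
  qed
qed

text \<open>A finite-dimensional division algebra over \<open>\<complex>\<close> is \<open>\<complex>\<close>: a polynomial of least degree that
  annihilates \<open>x\<close> is linear.\<close>

lemma division_idempotent_scalar:
  assumes e: "e \<in> S" "e \<noteq> 0" "e * e = e"
    and div: "\<And>x. x \<in> S \<Longrightarrow> e * x * e \<noteq> 0 \<Longrightarrow> \<exists>y\<in>S. (e * y * e) * (e * x * e) = e"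
    and x: "x \<in> S"
  shows "\<exists>k. e * x * e = k *\<^sub>C e"
proof -
  define X where "X = e * x * e"
  have X: "X \<in> S" "e * X = X" "X * e = X" using e x by (auto simp: X_def mult.assoc[symmetric])
     (simp add: mult.assoc)
  \<comment> \<open>Powers of \<open>X\<close> start from \<open>e\<close>, the unit of the corner
    \<open>e S e\<close>.\<close>
  define p where "p i = (((*) X) ^^ i) e" for i
  have p0: "p 0 = e" and pS: "p (Suc i) = X * p i" for i by (simp_all add: p_def)
  have p: "p i \<in> S" "e * p i = p i" for i
    by (induct i) (use X e in \<open>auto simp: p0 pS mult.assoc[symmetric]\<close>)
  define ev where "ev q = (\<Sum>i\<le>degree q. coeff q i *\<^sub>C p i)" for q :: "complex poly"
  have ev: "ev q = (\<Sum>i\<le>n. coeff q i *\<^sub>C p i)" if "degree q \<le> n" for q n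
    unfolding ev_def by (rule sum.mono_neutral_left) (use that in \<open>auto simp: coeff_eq_0\<close>)
  have evS: "ev q \<in> S" "e * ev q = ev q" for q
    by (auto simp: ev_def sum_distrib_left p intro!: sum_closed)
  have ev_mult: "ev ([:-c, 1:] * q) = (X - c *\<^sub>C e) * ev q" for c q
  proof -
    define n where "n = degree q"
    have "degree ([:-c, 1:] * q) \<le> Suc n"
      using degree_mult_le[of "[:-c, 1:]" q] by (simp add: n_def)
    moreover have "[:-c, 1:] * q = pCons 0 q - Polynomial.smult c q" by simp
    ultimately have "ev ([:-c, 1:] * q) = (\<Sum>i\<le>Suc n. coeff (pCons 0 q - Polynomial.smult c q) i *\<^sub>C p i)"
      by (metis ev)
    also have "\<dots> = (\<Sum>i\<le>Suc n. coeff (pCons 0 q) i *\<^sub>C p i) - c *\<^sub>C (\<Sum>i\<le>Suc n. coeff q i *\<^sub>C p i)"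
      by (simp add: scale_left_diff_distrib sum_subtractf scale_sum_right del: sum.atMost_Suc)
    also have "(\<Sum>i\<le>Suc n. coeff (pCons 0 q) i *\<^sub>C p i) = X * (\<Sum>i\<le>n. coeff q i *\<^sub>C p i)"
      by (subst sum.atMost_Suc_shift) (simp add: pS sum_distrib_left)
    also have "(\<Sum>i\<le>n. coeff q i *\<^sub>C p i) = ev q" by (simp add: ev_def n_def)
    also have "(\<Sum>i\<le>Suc n. coeff q i *\<^sub>C p i) = ev q" by (rule ev[symmetric]) (simp add: n_def)
    finally show ?thesis by (simp add: left_diff_distrib evS)
  qed
  have "q \<noteq> 0 \<Longrightarrow> ev q = 0 \<Longrightarrow> \<exists>k. X = k *\<^sub>C e" for q
  proof (induct "degree q" arbitrary: q)
    case 0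
    then obtain a where a: "q = [:a:]" by (metis degree_0_id)
    then show ?case using 0 e by (simp add: ev_def p0)
  next
    case (Suc d)
    then obtain c where "poly q c = 0"
      using fundamental_theorem_of_algebra_alt[of q] by (metis degree_pCons_0 nat.simps(3))
    then obtain r where r: "q = [:-c, 1:] * r" by (metis dvdE poly_eq_0_iff_dvd)
    have r0: "r \<noteq> 0" using r Suc by auto
    have dr: "degree r = d" using Suc(2) r r0 by (simp add: degree_mult_eq del: mult_pCons_left)
    have z: "(X - c *\<^sub>C e) * ev r = 0" using Suc r by (simp only: ev_mult)
    \<comment> \<open>For a root c, either X = c e, or X - c e is invertible in the corner and
      cancels, which leaves an annihilating polynomial of smaller degree.\<close>
    show ?case
    proof (cases "X = c *\<^sub>C e")
      case False
      have *: "e * (x - c *\<^sub>C e) * e = X - c *\<^sub>C e"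
        by (simp add: X_def algebra_simps e)
      then have "\<exists>y\<in>S. (e * y * e) * (X - c *\<^sub>C e) = e"
        using div[of "x - c *\<^sub>C e"] False x e by auto
      then obtain y where "(e * y * e) * (X - c *\<^sub>C e) = e" by blast
      then have "ev r = 0" using z by (metis evS(2) mult.assoc mult_zero_right)
      then show ?thesis using Suc(1)[OF dr[symmetric] r0] by blast
    qed auto
  qed
  moreover obtain q where "q \<noteq> 0" "ev q = 0"
    using ex_polynomial_relation[of p, OF p(1)] unfolding ev_def by metis
  ultimately show ?thesis unfolding X_def by metis
qed

lemma ex_primitive_idempotent:
  assumes c: "c \<in> S" "c \<noteq> 0" "c * c = c" "\<And>x. x \<in> S \<Longrightarrow> c * x = x * c"
  obtains e where "e \<in> S" "e \<noteq> 0" "e * e = e" "c * e = e" "\<And>x. x \<in> S \<Longrightarrow> \<exists>k. e * x * e = k *\<^sub>C e"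
proof (rule ex_division_idempotent[OF assms])
  fix e assume e: "e \<in> S" "e \<noteq> 0" "e * e = e" "c * e = e"
    and div: "\<And>x. x \<in> S \<Longrightarrow> e * x * e \<noteq> 0 \<Longrightarrow> \<exists>y\<in>S. (e * y * e) * (e * x * e) = e"
  show thesis
    by (rule that[OF e]) (rule division_idempotent_scalar[OF e(1-3) div])
qed

end

section \<open>Self-adjoint idempotents with real, complex or quaternionic corner\<close>

definition qi :: quat where "qi = Quat 0 1 0 0"
definition qj :: quat where "qj = Quat 0 0 1 0"
definition qk :: quat where "qk = Quat 0 0 0 1"

lemma quat_unit_sel [simp]:
  "QRe qi = 0" "QI qi = 1" "QJ qi = 0" "QK qi = 0"
  "QRe qj = 0" "QI qj = 0" "QJ qj = 1" "QK qj = 0"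
  "QRe qk = 0" "QI qk = 0" "QJ qk = 0" "QK qk = 1"
  by (simp_all add: qi_def qj_def qk_def)

definition real_forms :: "quat set set" where
  "real_forms = {\<real>, quat_complexes, UNIV}"

lemma quat_Reals_iff: "(x :: quat) \<in> \<real> \<longleftrightarrow> QI x = 0 \<and> QJ x = 0 \<and> QK x = 0"
proof
  assume "x \<in> \<real>"
  then show "QI x = 0 \<and> QJ x = 0 \<and> QK x = 0" by (auto elim!: Reals_cases simp: of_real_def)
next
  assume "QI x = 0 \<and> QJ x = 0 \<and> QK x = 0"
  then have "x = of_real (QRe x)" by (simp add: quat_eq_iff of_real_def)
  then show "x \<in> \<real>" by (metis Reals_of_real)
qed

lemmas real_forms_cases = real_forms_def quat_Reals_iff quat_complexes_def

lemma real_form_closed: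
  assumes "D \<in> real_forms"
  shows "0 \<in> D" "1 \<in> D"
    "p \<in> D \<Longrightarrow> q \<in> D \<Longrightarrow> p + q \<in> D" "p \<in> D \<Longrightarrow> q \<in> D \<Longrightarrow> p * q \<in> D"
    "p \<in> D \<Longrightarrow> r *\<^sub>R p \<in> D" "p \<in> D \<Longrightarrow> qcnj p \<in> D"
  using assms by (auto simp: real_forms_cases)

lemma qcnj_simps [simp]: "qcnj (qcnj p) = p" "qcnj (p + q) = qcnj p + qcnj q"
  "qcnj (p * q) = qcnj q * qcnj p" "qcnj (r *\<^sub>R p) = r *\<^sub>R qcnj p" "qcnj 0 = 0" "qcnj 1 = 1"
  by (simp_all add: quat_eq_iff)

lemma mult_eq_assoc: "x * y = z \<Longrightarrow> x * (y * q) = z * (q :: 'a::semigroup_mult)"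
  by (simp add: mult.assoc[symmetric])

context involutive_frobenius
begin

text \<open>The last clause says that the complexification of \<open>G\<close> fills the corner
  \<open>e S e\<close>. That \<open>e\<close> is a self-adjoint idempotent follows from
  \<open>G 1 = e\<close>; injectivity of the complexified map follows from the form, see
  \<open>seed_inj\<close>.\<close>

definition seed :: "quat set \<Rightarrow> 'r \<Rightarrow> (quat \<Rightarrow> 'r) \<Rightarrow> bool" where
  "seed D e G \<longleftrightarrow> D \<in> real_forms \<and> e \<in> S \<and> e \<noteq> 0 \<and> G 1 = e \<and> G ` D \<subseteq> S \<and>
     (\<forall>p\<in>D. \<forall>q\<in>D. G (p + q) = G p + G q) \<and>
     (\<forall>r. \<forall>p\<in>D. G (r *\<^sub>R p) = of_real r *\<^sub>C G p) \<and>
     (\<forall>p\<in>D. \<forall>q\<in>D. G (p * q) = G p * G q) \<and>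
     (\<forall>p\<in>D. star (G p) = G (qcnj p)) \<and>
     (\<forall>x\<in>S. \<exists>p\<in>D. \<exists>q\<in>D. e * x * e = G p + \<i> *\<^sub>C G q)"

lemma star_corner_scalar:
  assumes e: "e \<in> S" and sc: "\<And>x. x \<in> S \<Longrightarrow> \<exists>k. e * x * e = k *\<^sub>C e" and x: "x \<in> S"
  shows "\<exists>k. star e * x * star e = k *\<^sub>C star e"
proof -
  obtain k where "e * star x * e = k *\<^sub>C e" using sc[of "star x"] x by blast
  then have "star (e * star x * e) = k *\<^sub>C star e" using e by (simp add: star_scale)
  moreover have "star (e * star x * e) = star e * x * star e" using e x by (simp add: star_mult mult.assoc)
  ultimately show ?thesis by auto
qed

lemma seed_real:
  assumes e: "e \<in> S" "e \<noteq> 0" "e * e = e" "star e = e"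
    and sc: "\<And>x. x \<in> S \<Longrightarrow> \<exists>k. e * x * e = k *\<^sub>C e"
  shows "seed \<real> e (\<lambda>p. of_real (QRe p) *\<^sub>C e)"
  unfolding seed_def
proof (intro conjI ballI allI)
  fix x assume "x \<in> S"
  then obtain k where k: "e * x * e = k *\<^sub>C e" using sc by blast
  have "k = of_real (QRe (of_real (Re k))) + \<i> * of_real (QRe (of_real (Im k)))"
    by (simp add: of_real_def[where ?'a = quat] complex_eq_iff)
  then have "e * x * e = of_real (QRe (of_real (Re k))) *\<^sub>C e + \<i> *\<^sub>C of_real (QRe (of_real (Im k))) *\<^sub>C e"
    by (metis k scale_left_distrib scale_scale)
  then show "\<exists>p\<in>\<real>. \<exists>q\<in>\<real>. e * x * e = of_real (QRe p) *\<^sub>C e + \<i> *\<^sub>C of_real (QRe q) *\<^sub>C e"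
    using Reals_of_real by blast
qed (use e in \<open>auto simp: real_forms_def star_scale scale_left_distrib quat_Reals_iff\<close>)

text \<open>Here \<open>e\<close> and \<open>star e\<close> are orthogonal and the corner of their
  sum is the product of two copies of the complex numbers, exchanged by \<open>star\<close>. The map
  p |-> (p, conj p) identifies it with the complexification of the complex numbers.\<close>

lemma seed_complex:
  assumes e: "e \<in> S" "e \<noteq> 0" "e * e = e"
    and sc: "\<And>x. x \<in> S \<Longrightarrow> \<exists>k. e * x * e = k *\<^sub>C e"
    and orth: "\<And>x. x \<in> S \<Longrightarrow> star e * x * e = 0"
  shows "seed quat_complexes (e + star e)
    (\<lambda>p. Complex (QRe p) (QI p) *\<^sub>C e + Complex (QRe p) (- QI p) *\<^sub>C star e)"
proof -
  define f where "f = star e"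
  have f: "f \<in> S" "f * f = f" "star f = e" "star e = f" using e star_mult[of e e] by (auto simp: f_def)
  have orth: "f * x * e = 0" if "x \<in> S" for x using orth[OF that] by (simp add: f_def)
  \<comment> \<open>The involution maps f S e to itself, so it does not transfer the vanishing to e
    S f; semiprimeness does.\<close>
  have orth': "e * x * f = 0" if x: "x \<in> S" for x
  proof (rule semiprime)
    show "e * x * f \<in> S" using x e f by auto
    fix y assume y: "y \<in> S"
    have "e * x * f * y * (e * x * f) = e * x * (f * y * e) * x * f" by (simp add: mult.assoc)
    then show "e * x * f * y * (e * x * f) = 0" using orth[OF y] by simp
  qed
  have fe: "f * e = 0" using orth[of unit] e f by simp
  have ef: "e * f = 0" using orth'[of unit] e f by simp
  have e0: "e + f \<noteq> 0"
  proof
    assume "e + f = 0"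
    then have "e * (e + f) = 0" by simp
    then show False using e ef by (simp add: distrib_left)
  qed
  have sp: "\<exists>p\<in>quat_complexes. \<exists>q\<in>quat_complexes.
      (e + f) * x * (e + f) = Complex (QRe p) (QI p) *\<^sub>C e + Complex (QRe p) (- QI p) *\<^sub>C f +
        \<i> *\<^sub>C (Complex (QRe q) (QI q) *\<^sub>C e + Complex (QRe q) (- QI q) *\<^sub>C f)" if x: "x \<in> S" for x
  proof -
    obtain k where k: "e * x * e = k *\<^sub>C e" using sc x by blast
    obtain k' where k': "f * x * f = k' *\<^sub>C f"
      using star_corner_scalar[OF e(1) sc x] unfolding f(4) by blast
    have *: "(e + f) * x * (e + f) = k *\<^sub>C e + k' *\<^sub>C f"
      using orth'[OF x] orth[OF x] k k' by (simp add: distrib_left distrib_right)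
    \<comment> \<open>Solution of k = p + i q and k' = conj p + i conj q, namely p = (k + conj k') /
      2 and q = (k - conj k') / (2 i).\<close>
    define p where "p = Quat (Re ((k + k') / 2)) (Im ((k - k') / 2)) 0 0"
    define q where "q = Quat (Im ((k + k') / 2)) (- Re ((k - k') / 2)) 0 0"
    have "k = Complex (QRe p) (QI p) + \<i> * Complex (QRe q) (QI q)"
      "k' = Complex (QRe p) (- QI p) + \<i> * Complex (QRe q) (- QI q)"
      by (auto simp: p_def q_def complex_eq_iff field_simps)
    then have "(e + f) * x * (e + f) = Complex (QRe p) (QI p) *\<^sub>C e + Complex (QRe p) (- QI p) *\<^sub>C f +
        \<i> *\<^sub>C (Complex (QRe q) (QI q) *\<^sub>C e + Complex (QRe q) (- QI q) *\<^sub>C f)"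
      unfolding * by (simp add: scale_left_distrib scale_right_distrib)
    moreover have "p \<in> quat_complexes" "q \<in> quat_complexes"
      by (auto simp: p_def q_def quat_complexes_def)
    ultimately show ?thesis by blast
  qed
  have 1: "Complex 1 0 = 1" by (simp add: complex_eq_iff)
  have m: "Complex (QRe (p * q)) (QI (p * q)) = Complex (QRe q) (QI q) * Complex (QRe p) (QI p)"
    "Complex (QRe (p * q)) (- QI (p * q)) = Complex (QRe q) (- QI q) * Complex (QRe p) (- QI p)"
    if "p \<in> quat_complexes" "q \<in> quat_complexes" for p q
    using that by (auto simp: quat_complexes_def complex_eq_iff algebra_simps)
  have a: "Complex (QRe (p + q)) (QI (p + q)) = Complex (QRe p) (QI p) + Complex (QRe q) (QI q)"
    "Complex (QRe (p + q)) (- QI (p + q)) = Complex (QRe p) (- QI p) + Complex (QRe q) (- QI q)"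
    for p q by (auto simp: complex_eq_iff)
  have s: "Complex (QRe (r *\<^sub>R q)) (QI (r *\<^sub>R q)) = of_real r * Complex (QRe q) (QI q)"
    "Complex (QRe (r *\<^sub>R q)) (- QI (r *\<^sub>R q)) = of_real r * Complex (QRe q) (- QI q)"
    for r q by (auto simp: complex_eq_iff)
  show ?thesis
    unfolding seed_def f(4) using e f sp e0
    by (auto simp: real_forms_def 1 m a s star_add star_scale scale_left_distrib scale_right_distrib
      distrib_left distrib_right ef fe simp del: times_quat.sel plus_quat.sel scaleR_quat.sel)
qed

text \<open>\<open>e, t, w, star e\<close> are matrix units of a \<open>2 \<times> 2\<close> matrix algebra whose involution is of
  symplectic type, that is, quaternionic conjugation.\<close>

lemma seed_quat:
  assumes e: "e \<in> S" "e \<noteq> 0" "e * e = e"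
    and sc: "\<And>x. x \<in> S \<Longrightarrow> \<exists>k. e * x * e = k *\<^sub>C e"
    and w: "w \<in> S" "star e * w = w" "w * e = w" "star w = - w"
    and t: "t \<in> S" "e * t = t" "t * star e = t" "star t = - t"
    and tw: "t * w = e" and wt: "w * t = star e"
  shows "seed UNIV (e + star e) (\<lambda>p. Complex (QRe p) (QI p) *\<^sub>C e + Complex (QRe p) (- QI p) *\<^sub>C star e
    + Complex (QJ p) (QK p) *\<^sub>C t + Complex (- QJ p) (QK p) *\<^sub>C w)"
proof -
  define f where "f = star e"
  have f: "f \<in> S" "f * f = f" "star f = e" "star e = f" using e star_mult[of e e] by (auto simp: f_def)
  note w = w[unfolded f(4)] and t = t[unfolded f(4)] and wt = wt[unfolded f(4)]
  have scf: "\<exists>k. f * x * f = k *\<^sub>C f" if "x \<in> S" for x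
    using star_corner_scalar[OF e(1) sc that] unfolding f(4) .
  have scw: "\<exists>k. f * x * e = k *\<^sub>C w" if x: "x \<in> S" for x
  proof -
    obtain k where k: "e * (t * x) * e = k *\<^sub>C e" using sc x t by blast
    have "f * x * e = w * (t * x * e)" using wt by (simp add: mult.assoc[symmetric])
    also have "t * x * e = e * (t * x) * e" using t by (simp add: mult.assoc[symmetric])
    finally show ?thesis using k w by auto
  qed
  have sct: "\<exists>k. e * x * f = k *\<^sub>C t" if x: "x \<in> S" for x
  proof -
    obtain k where k: "f * (w * x) * f = k *\<^sub>C f" using scf x w by blast
    have "e * x * f = t * (w * x * f)" using tw by (simp add: mult.assoc[symmetric])
    also have "w * x * f = f * (w * x) * f" using w by (simp add: mult.assoc[symmetric])
    finally show ?thesis using k t by auto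
  qed
  have tw0: "t \<noteq> 0" "w \<noteq> 0" using tw e by auto
  \<comment> \<open>The product lies on the line of \<open>w\<close>. It is self-adjoint whereas
    \<open>star w = - w\<close>, so it vanishes; \<open>e * f\<close> is treated in the same way
    with \<open>t\<close>.\<close>
  have fe: "f * e = 0"
  proof -
    obtain k where k: "f * e = k *\<^sub>C w" using scw[of unit] f e by auto
    have "star (f * e) = f * e" using e f by (simp add: star_mult)
    then have "- (k *\<^sub>C w) = k *\<^sub>C w" using k w by (simp add: star_scale)
    then have "(2 * k) *\<^sub>C w = 0"
      by (metis add.right_inverse mult_2 scale_left_distrib)
    then show ?thesis using tw0 k by simp
  qed
  have ef: "e * f = 0"
  proof -
    obtain k where k: "e * f = k *\<^sub>C t" using sct[of unit] f e by auto
    have "star (e * f) = e * f" using e f by (simp add: star_mult)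
    then have "- (k *\<^sub>C t) = k *\<^sub>C t" using k t by (simp add: star_scale)
    then have "(2 * k) *\<^sub>C t = 0"
      by (metis add.right_inverse mult_2 scale_left_distrib)
    then show ?thesis using tw0 k by simp
  qed
  have ew: "e * w = 0" using ef w by (metis mult.assoc mult_zero_left)
  have ft: "f * t = 0" using fe t by (metis mult.assoc mult_zero_left)
  have wf: "w * f = 0" using ef w by (metis mult.assoc mult_zero_right)
  have te: "t * e = 0" using fe t by (metis mult.assoc mult_zero_right)
  have ww: "w * w = 0" using ew w by (metis mult.assoc mult_zero_right)
  have tt: "t * t = 0" using ft t by (metis mult.assoc mult_zero_right)
  note tab = e(3) f(2) fe ef ew ft wf te ww tt w(2,3) t(2,3) tw wt
  have prod: "(a1 *\<^sub>C e + d1 *\<^sub>C f + b1 *\<^sub>C t + c1 *\<^sub>C w) * (a2 *\<^sub>C e + d2 *\<^sub>C f + b2 *\<^sub>C t + c2 *\<^sub>C w)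
     = (a1 * a2 + b1 * c2) *\<^sub>C e + (c1 * b2 + d1 * d2) *\<^sub>C f + (a1 * b2 + b1 * d2) *\<^sub>C t
       + (c1 * a2 + d1 * c2) *\<^sub>C w" for a1 b1 c1 d1 a2 b2 c2 d2
    by (simp add: distrib_left distrib_right tab scale_left_distrib scale_right_distrib mult.commute add_ac)
  \<comment> \<open>The usual complex 2 x 2 matrices of quaternions, with rows (a + b i, c + d i)
    and (-c + d i, a - b i), where \<open>e\<close>, \<open>t\<close>, \<open>w\<close>,
    \<open>f\<close> are the units at positions 11, 12, 21, 22.\<close>
  define G where "G p = Complex (QRe p) (QI p) *\<^sub>C e + Complex (QRe p) (- QI p) *\<^sub>C f
    + Complex (QJ p) (QK p) *\<^sub>C t + Complex (- QJ p) (QK p) *\<^sub>C w" for p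
  have "e + f \<noteq> 0"
  proof
    assume "e + f = 0"
    then have "e * (e + f) = 0" by simp
    then show False using e ef by (simp add: distrib_left)
  qed
  moreover have "G 1 = e + f"
  proof -
    have "Complex 1 0 = 1" "Complex 0 0 = 0" by (simp_all add: complex_eq_iff)
    then show ?thesis by (simp add: G_def)
  qed
  moreover have "G p \<in> S" for p using e f t w by (auto simp: G_def)
  moreover have "G (p + q) = G p + G q" for p q
  proof -
    have "Complex (QRe (p + q)) (QI (p + q)) = Complex (QRe p) (QI p) + Complex (QRe q) (QI q)"
      "Complex (QRe (p + q)) (- QI (p + q)) = Complex (QRe p) (- QI p) + Complex (QRe q) (- QI q)"
      "Complex (QJ (p + q)) (QK (p + q)) = Complex (QJ p) (QK p) + Complex (QJ q) (QK q)"
      "Complex (- QJ (p + q)) (QK (p + q)) = Complex (- QJ p) (QK p) + Complex (- QJ q) (QK q)"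
      by (auto simp: complex_eq_iff)
    then show ?thesis unfolding G_def by (simp only: scale_left_distrib add_ac)
  qed
  moreover have "G (r *\<^sub>R p) = of_real r *\<^sub>C G p" for r p
  proof -
    have "Complex (QRe (r *\<^sub>R p)) (QI (r *\<^sub>R p)) = of_real r * Complex (QRe p) (QI p)"
      "Complex (QRe (r *\<^sub>R p)) (- QI (r *\<^sub>R p)) = of_real r * Complex (QRe p) (- QI p)"
      "Complex (QJ (r *\<^sub>R p)) (QK (r *\<^sub>R p)) = of_real r * Complex (QJ p) (QK p)"
      "Complex (- QJ (r *\<^sub>R p)) (QK (r *\<^sub>R p)) = of_real r * Complex (- QJ p) (QK p)"
      by (auto simp: complex_eq_iff)
    then show ?thesis unfolding G_def by (simp only: scale_right_distrib scale_scale)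
  qed
  moreover have "G (p * q) = G p * G q" for p q
    unfolding G_def prod
    by (intro arg_cong2[of _ _ _ _ "(+)"] arg_cong2[of _ _ _ _ "scale"])
      (auto simp: complex_eq_iff algebra_simps)
  moreover have "star (G p) = G (qcnj p)" for p
  proof -
    have "Complex (- QJ p) (- QK p) = - Complex (QJ p) (QK p)" "Complex (QJ p) (- QK p) = - Complex (- QJ p) (QK p)"
      by (auto simp: complex_eq_iff)
    then show ?thesis
      unfolding G_def using e f t w by (simp add: star_add star_scale add_ac)
  qed
  moreover have "\<exists>p. \<exists>q. (e + f) * x * (e + f) = G p + \<i> *\<^sub>C G q" if x: "x \<in> S" for x
  proof -
    obtain a where a: "e * x * e = a *\<^sub>C e" using sc x by blast
    obtain d where d: "f * x * f = d *\<^sub>C f" using scf x by blast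
    obtain b where b: "e * x * f = b *\<^sub>C t" using sct x by blast
    obtain c where c: "f * x * e = c *\<^sub>C w" using scw x by blast
    have *: "(e + f) * x * (e + f) = a *\<^sub>C e + d *\<^sub>C f + b *\<^sub>C t + c *\<^sub>C w"
      by (simp add: distrib_left distrib_right a b c d)
    \<comment> \<open>The splitting into p + i q is that of \<open>seed_complex\<close>, applied to
      the pairs (a, d) and (b, -c).\<close>
    define p where "p = Quat (Re ((a + d) / 2)) (Im ((a - d) / 2)) (Re ((b - c) / 2)) (Im ((b + c) / 2))"
    define q where "q = Quat (Im ((a + d) / 2)) (- Re ((a - d) / 2)) (Im ((b - c) / 2)) (- Re ((b + c) / 2))"
    have eq: "a = Complex (QRe p) (QI p) + \<i> * Complex (QRe q) (QI q)"
      "d = Complex (QRe p) (- QI p) + \<i> * Complex (QRe q) (- QI q)"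
      "b = Complex (QJ p) (QK p) + \<i> * Complex (QJ q) (QK q)"
      "c = Complex (- QJ p) (QK p) + \<i> * Complex (- QJ q) (QK q)"
      by (auto simp: p_def q_def complex_eq_iff field_simps)
    have "(e + f) * x * (e + f) = G p + \<i> *\<^sub>C G q"
      unfolding * G_def by (subst eq(1), subst eq(2), subst eq(3), subst eq(4))
        (simp add: scale_left_distrib scale_right_distrib add_ac)
    then show ?thesis by blast
  qed
  ultimately have "seed UNIV (e + f) G"
    unfolding seed_def using e f by (auto simp: real_forms_def)
  then show ?thesis unfolding G_def f(4) .
qed

text \<open>If \<open>star\<close> acts as 1 on the line of \<open>w\<close>, then v |->
  \<open>star v * v\<close> is a nonzero quadratic form on S e with values on that line. Rescaling a
  non-isotropic vector to \<open>star v * v = w\<close> yields the self-adjoint primitive idempotent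
  v t star v, which replaces \<open>e\<close>. The central idempotent \<open>c\<close> keeps the
  construction inside the part of the algebra not yet decomposed.\<close>

lemma ex_seed:
  assumes c: "c \<in> S" "c \<noteq> 0" "c * c = c" "\<And>x. x \<in> S \<Longrightarrow> c * x = x * c" "star c = c"
  shows "\<exists>D e G. seed D e G \<and> c * e = e"
proof -
  obtain e where e: "e \<in> S" "e \<noteq> 0" "e * e = e" "c * e = e"
    and sc: "\<And>x. x \<in> S \<Longrightarrow> \<exists>k. e * x * e = k *\<^sub>C e"
    using ex_primitive_idempotent[OF c(1-4)] by metis
  define f where "f = star e"
  have f: "f \<in> S" "f * f = f" "star f = e" "star e = f" using e star_mult[of e e] by (auto simp: f_def)
  have cf: "c * f = f"
    using star_mult[OF c(1) e(1)] e(4) c(4)[OF f(1)] c(5) f by simp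
  have cef: "c * (e + f) = e + f" using e cf by (simp add: distrib_left)
  show ?thesis
  proof (cases "\<forall>x\<in>S. f * x * e = 0")
    case True
    then show ?thesis using seed_complex[OF e(1-3) sc] cef unfolding f(4) by blast
  next
    case False
    then obtain x where x: "x \<in> S" "f * x * e \<noteq> 0" by blast
    define w where "w = f * x * e"
    have w: "w \<in> S" "w \<noteq> 0" "f * w = w" "w * e = w"
      using x e f by (auto simp: w_def mult.assoc[symmetric]) (simp add: mult.assoc)
    \<comment> \<open>Semiprimeness makes e y w a nonzero multiple of e; \<open>t\<close> is e y f
      rescaled so that t w = e.\<close>
    obtain y where y: "y \<in> S" "w * y * w \<noteq> 0" using semiprime[OF w(1)] w(2) by blast
    obtain m where "e * (y * f * x) * e = m *\<^sub>C e" using sc[of "y * f * x"] x y f by auto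
    then have lam: "e * y * w = m *\<^sub>C e" by (simp add: w_def mult.assoc)
    have "w * y * w = w * (e * y * w)" using w by (simp add: mult.assoc[symmetric])
    then have lam0: "m \<noteq> 0" using y(2) lam by auto
    define t where "t = (1 / m) *\<^sub>C (e * y * f)"
    have t: "t \<in> S" "e * t = t" "t * f = t"
      using y e f by (auto simp: t_def mult.assoc[symmetric]) (simp add: mult.assoc)
    have tw: "t * w = e"
      using lam lam0 w by (simp add: t_def mult.assoc)
    have scf: "\<exists>k. f * z * f = k *\<^sub>C f" if "z \<in> S" for z
      using star_corner_scalar[OF e(1) sc that] unfolding f(4) .
    have wt: "w * t = f"
    proof -
      obtain k where "f * (w * t) * f = k *\<^sub>C f" using scf w t by blast
      then have k: "w * t = k *\<^sub>C f" using w t by (simp add: mult.assoc[symmetric]) (simp add: mult.assoc)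
      have "w * t * w = w" using tw w by (simp add: mult.assoc)
      then have "k *\<^sub>C w = 1 *\<^sub>C w" using w k by simp
      then have "k = 1" using w by (metis scale_cancel_right)
      then show ?thesis using k by simp
    qed
    have scw: "\<exists>k. f * z * e = k *\<^sub>C w" if z: "z \<in> S" for z
    proof -
      obtain k where k: "e * (t * z) * e = k *\<^sub>C e" using sc z t by blast
      have "f * z * e = w * (t * z * e)" using wt by (simp add: mult.assoc[symmetric])
      also have "t * z * e = e * (t * z) * e" using t by (simp add: mult.assoc[symmetric])
      finally show ?thesis using k w by auto
    qed
    have "star w = f * star x * e" using x e f by (simp add: w_def star_mult mult.assoc)
    then obtain k where k: "star w = k *\<^sub>C w" using scw x by (metis star_closed)
    \<comment> \<open>The involution acts on the line of \<open>w\<close> by a scalar of square 1,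
      and \<open>t\<close> inherits the same scalar.\<close>
    have "star (star w) = (k * k) *\<^sub>C w" using k w by (simp add: star_scale)
    then have "(k * k) *\<^sub>C w = 1 *\<^sub>C w" using w by simp
    then have kk: "k * k = 1" using w by (metis scale_cancel_right)
    have st: "star t = k *\<^sub>C t"
    proof -
      have "star w * star t = f" using star_mult[OF t(1) w(1)] tw f by simp
      then have "k *\<^sub>C (w * star t) = f" using k by simp
      then have "t * (k *\<^sub>C (w * star t)) = t" using t by simp
      then have "k *\<^sub>C (e * star t) = t" using tw by (simp add: mult.assoc[symmetric])
      moreover have "e * star t = star t" using star_mult[OF t(1) f(1)] t f by simp
      ultimately have "k *\<^sub>C k *\<^sub>C star t = k *\<^sub>C t" by simp
      then show ?thesis using kk by simp
    qed
    consider "k = 1" | "k = -1" using kk by (metis square_eq_1_iff)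
    then show ?thesis
    proof cases
      case 2
      then show ?thesis
        using seed_quat[OF e(1-3) sc, of w t] w t st k tw wt cef unfolding f(4) by fastforce
    next
      case 1
      have sw: "star w = w" and stt: "star t = t" using 1 k st by auto
      have "\<exists>v\<in>S. v * e = v \<and> star v * v \<noteq> 0"
      proof (rule ccontr)
        assume "\<not> ?thesis"
        then have iso: "star v * v = 0" if "v \<in> S" "v * e = v" for v using that by blast
        \<comment> \<open>Polarisation at the pair (a, e): both mixed terms equal \<open>w\<close>,
          so a form vanishing on all of S e would give w + w = 0.\<close>
        define a where "a = star x * e"
        have a: "a \<in> S" "a * e = a" "star a * e = w"
          using x e f by (auto simp: a_def w_def star_mult mult.assoc)
        have "star (a + e) * (a + e) = 0"
          by (rule iso) (use a e in \<open>auto simp: distrib_right\<close>)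
        moreover have "star (a + e) * (a + e) = star a * a + star e * e + (star a * e + star e * a)"
          using a e by (simp add: star_add distrib_left distrib_right add_ac)
        moreover have "star e * a = w"
          using star_mult[of "star a" e] a e sw by simp
        ultimately have "w + w = 0" using iso[OF a(1,2)] iso[OF e(1,3)] a by simp
        then have "(2::complex) *\<^sub>C w = 0" by (metis one_add_one scale_left_distrib scale_one)
        then show False using w by simp
      qed
      then obtain v0 where v0: "v0 \<in> S" "v0 * e = v0" "star v0 * v0 \<noteq> 0" by blast
      have scv: "\<exists>k. star v * z * v = k *\<^sub>C w" if v: "v \<in> S" "v * e = v" "z \<in> S" for v z
      proof -
        have "star v = f * star v" using star_mult[OF v(1) e(1)] v f by simp
        then have "star v * z * v = f * (star v * z * v) * e" using v by (metis mult.assoc)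
        then show ?thesis using scw[of "star v * z * v"] v by auto
      qed
      obtain \<beta> where be: "star v0 * v0 = \<beta> *\<^sub>C w" using scv[of v0 unit] v0 by auto
      have be0: "\<beta> \<noteq> 0" using be v0 by auto
      define v where "v = (1 / csqrt \<beta>) *\<^sub>C v0"
      have v: "v \<in> S" "v * e = v" "star v * v = w"
      proof -
        have "csqrt \<beta> * csqrt \<beta> = \<beta>" by (metis power2_csqrt power2_eq_square)
        then show "star v * v = w" using v0 be be0 by (simp add: v_def star_scale field_simps)
      qed (use v0 in \<open>auto simp: v_def\<close>)
      \<comment> \<open>From \<open>star v * v = w\<close> and t w = e follow h h = v t w t star v =
        h. Each \<open>star v * z * v\<close> lies on the line of \<open>w\<close>, so the corner of
        \<open>h\<close> is again one-dimensional.\<close>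
      define h where "h = v * t * star v"
      have h: "h \<in> S" using v t by (auto simp: h_def)
      have sv: "f * star v = star v" using star_mult[OF v(1) e(1)] v f by simp
      have corner: "h * z * h = k' *\<^sub>C h" if "z \<in> S" "star v * z * v = k' *\<^sub>C w" for z k'
      proof -
        have "h * z * h = v * t * (star v * z * v) * t * star v" by (simp add: h_def mult.assoc)
        also have "\<dots> = k' *\<^sub>C (v * (t * w) * t * star v)" using that by (simp add: mult.assoc)
        also have "v * (t * w) * t * star v = h" by (simp only: tw v(2) h_def)
        finally show ?thesis .
      qed
      have hh: "h * h = h" using corner[of unit 1] v h by simp
      have "star v * h * v = (star v * v) * t * (star v * v)" by (simp add: h_def mult.assoc)
      also have "\<dots> = w" by (simp only: v(3) wt w(3))
      finally have "star v * h * v = w" .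
      then have h0: "h \<noteq> 0" using w by auto
      have sh: "star h = h" using v t stt by (simp add: h_def star_mult mult.assoc)
      have "c * v = v" using v e c(4)[of v] c(1) by (metis mult.assoc)
      then have ch: "c * h = h" by (simp add: h_def mult.assoc[symmetric])
      have "seed \<real> h (\<lambda>p. of_real (QRe p) *\<^sub>C h)"
        by (rule seed_real[OF h h0 hh sh]) (use corner scv[OF v(1,2)] in metis)
      then show ?thesis using ch by blast
    qed
  qed
qed

end

section \<open>Orthonormal families and blocks\<close>

text \<open>Testing with \<open>qcnj p\<close> gives the squared norm of p.\<close>

lemma real_form_nondegenerate:
  assumes "D \<in> real_forms" "p \<in> D" "\<And>q. q \<in> D \<Longrightarrow> QRe (p * q) = 0"
  shows "p = 0"
proof -
  have "QRe (p * qcnj p) = 0" using assms real_form_closed(6) by blast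
  then have "QRe p ^ 2 + QI p ^ 2 + QJ p ^ 2 + QK p ^ 2 = 0" by (simp add: power2_eq_square)
  then have "QRe p ^ 2 = 0 \<and> QI p ^ 2 = 0 \<and> QJ p ^ 2 = 0 \<and> QK p ^ 2 = 0"
    by (smt (verit) zero_le_power2)
  then show ?thesis by (simp add: quat_eq_iff)
qed

text \<open>Over the reals a skew element is zero. Over the complex numbers it is a multiple of i,
  which cannot anticommute with i. A purely imaginary quaternion anticommuting with i, j and k loses
  its three components one by one.\<close>

lemma skew_semilinear_zero:
  assumes "D \<in> real_forms" "p \<in> D" "qcnj p = - p" "\<And>q. q \<in> D \<Longrightarrow> p * q = qcnj q * p"
  shows "p = 0"
proof -
  consider "D = \<real>" | "D = quat_complexes" | "D = UNIV" using assms(1) by (auto simp: real_forms_def)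
  then show ?thesis
  proof cases
    case 1
    then show ?thesis using assms(2,3) by (simp add: quat_Reals_iff quat_eq_iff)
  next
    case 2
    then have "p * qi = qcnj qi * p" by (intro assms(4)) (simp add: quat_complexes_def)
    then show ?thesis using assms(2,3) 2 by (simp add: quat_complexes_def quat_eq_iff)
  next
    case 3
    then have "p * qi = qcnj qi * p" "p * qj = qcnj qj * p" "p * qk = qcnj qk * p"
      by (auto intro: assms(4))
    then show ?thesis using assms(3) by (simp add: quat_eq_iff)
  qed
qed

text \<open>A block is recorded by its matrix units inside \<open>S\<close> and not by an
  isomorphism onto a matrix algebra, so that products between different blocks and with arbitrary
  elements make sense. Injectivity of \<open>\<Gamma>\<close> comes from \<open>G_form\<close> and
  \<open>mu\<close>, see \<open>G_inj\<close>.\<close>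

locale block = involutive_frobenius scale S unit l star
  for scale :: "complex \<Rightarrow> 'r::ring \<Rightarrow> 'r" (infixr "*\<^sub>C" 75) and S unit l star +
  fixes D :: "quat set" and n :: nat and \<mu> :: complex and \<Gamma> :: "nat \<Rightarrow> nat \<Rightarrow> quat \<Rightarrow> 'r"
  assumes D: "D \<in> real_forms" and n: "n \<ge> 1" and mu: "\<mu> \<noteq> 0"
    and G_closed: "a < n \<Longrightarrow> b < n \<Longrightarrow> p \<in> D \<Longrightarrow> \<Gamma> a b p \<in> S"
    and G_add: "a < n \<Longrightarrow> b < n \<Longrightarrow> p \<in> D \<Longrightarrow> q \<in> D \<Longrightarrow> \<Gamma> a b (p + q) = \<Gamma> a b p + \<Gamma> a b q"
    and G_scale: "a < n \<Longrightarrow> b < n \<Longrightarrow> p \<in> D \<Longrightarrow> \<Gamma> a b (r *\<^sub>R p) = of_real r *\<^sub>C \<Gamma> a b p"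
    and G_mult: "a < n \<Longrightarrow> b < n \<Longrightarrow> c < n \<Longrightarrow> d < n \<Longrightarrow> p \<in> D \<Longrightarrow> q \<in> D \<Longrightarrow>
      \<Gamma> a b p * \<Gamma> c d q = (if b = c then \<Gamma> a d (p * q) else 0)"
    and G_star: "a < n \<Longrightarrow> b < n \<Longrightarrow> p \<in> D \<Longrightarrow> star (\<Gamma> a b p) = \<Gamma> b a (qcnj p)"
    and G_form: "a < n \<Longrightarrow> b < n \<Longrightarrow> p \<in> D \<Longrightarrow> l (\<Gamma> a b p) = (if a = b then \<mu> * of_real (QRe p) else 0)"
    and z_central: "x \<in> S \<Longrightarrow> (\<Sum>a<n. \<Gamma> a a 1) * x = x * (\<Sum>a<n. \<Gamma> a a 1)"
    and z_span: "x \<in> S \<Longrightarrow> \<exists>M N. (\<forall>a<n. \<forall>b<n. M a b \<in> D \<and> N a b \<in> D) \<and>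
      x * (\<Sum>a<n. \<Gamma> a a 1) = (\<Sum>a<n. \<Sum>b<n. \<Gamma> a b (M a b) + \<i> *\<^sub>C \<Gamma> a b (N a b))"

section \<open>The form on a corner, orthonormal families and the matrix units they produce\<close>

context involutive_frobenius
begin

text \<open>Invariance of \<open>l\<close> under \<open>star\<close> identifies the values at p and
  at \<open>qcnj p\<close>, so only their mean, the real part, counts.\<close>

lemma seed_form:
  assumes G: "seed D e G" and p: "p \<in> D"
  shows "l (G p) = l e * of_real (QRe p)"
proof -
  note Gd = G[unfolded seed_def]
  have D: "D \<in> real_forms" using Gd by blast
  note cl = real_form_closed[OF D]
  have S: "G p \<in> S" "G (qcnj p) \<in> S" using Gd cl p by (auto simp: image_subset_iff)
  have "l (G p) + l (G p) = l (G p) + l (star (G p))" using S by simp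
  also have "\<dots> = l (G p) + l (G (qcnj p))" using Gd p by auto
  also have "\<dots> = l (G (p + qcnj p))" using Gd p cl S by (simp add: l_add)
  also have "p + qcnj p = (2 * QRe p) *\<^sub>R 1" by (simp add: quat_eq_iff)
  also have "l (G \<dots>) = l (of_real (2 * QRe p) *\<^sub>C e)" using Gd cl by metis
  also have "\<dots> = 2 * (l e * of_real (QRe p))" using Gd by (simp add: l_scale)
  finally show ?thesis by simp
qed

text \<open>Since l (e x) = l (e x e), the vanishing of \<open>l e\<close> would put
  \<open>e\<close> into the radical of the form.\<close>

lemma seed_form_nonzero:
  assumes G: "seed D e G"
  shows "l e \<noteq> 0"
proof
  assume l0: "l e = 0"
  note Gd = G[unfolded seed_def]
  have D: "D \<in> real_forms" and e: "e \<in> S" "e \<noteq> 0" "G 1 = e" using Gd by blast+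
  note cl = real_form_closed[OF D]
  have ee: "e * e = e" using Gd cl by (metis mult_1)
  have "e = 0"
  proof (rule l_nondegenerate[OF e(1)])
    fix x assume x: "x \<in> S"
    obtain p q where pq: "p \<in> D" "q \<in> D" "e * x * e = G p + \<i> *\<^sub>C G q" using Gd x by blast
    have S: "G p \<in> S" "G q \<in> S" using Gd pq by (auto simp: image_subset_iff)
    have "l (e * x) = l (e * (e * x))" using ee by (simp add: mult.assoc[symmetric])
    also have "\<dots> = l (e * x * e)" using e x by (subst l_commute) auto
    also have "\<dots> = 0" using S pq l0 by (simp add: l_add l_scale seed_form[OF G])
    finally show "l (e * x) = 0" .
  qed
  with e show False by simp
qed

text \<open>Multiplication by \<open>G r\<close> and application of \<open>l\<close> leave
  \<open>l e\<close> times Re (p r) + i Re (q r), so both real parts vanish for every r.\<close>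

lemma seed_inj:
  assumes G: "seed D e G" and p: "p \<in> D" and q: "q \<in> D" and eq: "G p + \<i> *\<^sub>C G q = 0"
  shows "p = 0 \<and> q = 0"
proof -
  note Gd = G[unfolded seed_def]
  have D: "D \<in> real_forms" using Gd by blast
  note cl = real_form_closed[OF D]
  have *: "QRe (p * r) = 0 \<and> QRe (q * r) = 0" if r: "r \<in> D" for r
  proof -
    have S: "G p \<in> S" "G q \<in> S" "G r \<in> S" "G (p * r) \<in> S" "G (q * r) \<in> S"
      using Gd p q r cl by (auto simp: image_subset_iff)
    have "G (p * r) + \<i> *\<^sub>C G (q * r) = (G p + \<i> *\<^sub>C G q) * G r"
      using Gd p q r by (simp add: distrib_right)
    then have "l (G (p * r) + \<i> *\<^sub>C G (q * r)) = 0" using eq by simp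
    then have "l e * (of_real (QRe (p * r)) + \<i> * of_real (QRe (q * r))) = 0"
      using S cl p q r by (simp add: l_add l_scale seed_form[OF G] algebra_simps del: times_quat.sel)
    then have "of_real (QRe (p * r)) + \<i> * of_real (QRe (q * r)) = (0 :: complex)"
      using seed_form_nonzero[OF G] by (metis mult_eq_0_iff)
    then show ?thesis by (simp add: complex_eq_iff del: times_quat.sel)
  qed
  show ?thesis using real_form_nondegenerate[OF D] p q * by blast
qed

text \<open>The ambient module is S e, a right module over e S e, with the hermitian form (x, y) |->
  \<open>star x * y\<close>.\<close>

definition orthonormal :: "'r \<Rightarrow> nat \<Rightarrow> (nat \<Rightarrow> 'r) \<Rightarrow> bool" where
  "orthonormal e n v \<longleftrightarrow> (\<forall>a<n. v a \<in> S \<and> v a * e = v a) \<and>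
     (\<forall>a<n. \<forall>b<n. star (v a) * v b = (if a = b then e else 0))"

text \<open>Gram-Schmidt over \<open>e S e = D \<otimes> \<complex>\<close>: the values \<open>v\<^sup>* v\<close> are self-adjoint elements of
  \<open>D \<otimes> \<complex>\<close>, hence scalars.  If they all vanished on the complement of a maximal orthonormal family,
  the sesquilinear form would be both skew and semilinear there, which forces it to vanish.\<close>

lemma ex_complete_orthonormal:
  assumes G: "seed D e G"
  shows "\<exists>n v. orthonormal e n v \<and> (\<forall>x\<in>S. (\<Sum>a<n. v a * star (v a)) * x * e = x * e)"
proof -
  note Gd = G[unfolded seed_def]
  have D: "D \<in> real_forms" and e: "e \<in> S" "e \<noteq> 0" and G1: "G 1 = e" using Gd by blast+
  note cl = real_form_closed[OF D]
  have GS: "G p \<in> S" if "p \<in> D" for p using Gd that by (auto simp: image_subset_iff)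
  have ee: "e * e = e" using Gd cl by (metis mult_1)
  have se: "star e = e" using Gd cl by (metis qcnj_simps(6))
  obtain N where N: "\<And>m v w. (\<forall>i<m. v i \<in> S \<and> w i \<in> S) \<Longrightarrow>
     (\<forall>i<m. \<forall>j<m. l (w i * v j) = 0 \<longleftrightarrow> i \<noteq> j) \<Longrightarrow> m \<le> (N :: nat)"
    using biorthogonal_bound by blast
  \<comment> \<open>Since \<open>l e\<close> is nonzero, an orthonormal family is biorthogonal to
    its own adjoints under \<open>l\<close>.\<close>
  have bd: "n \<le> N" if "orthonormal e n v" for n v
    by (rule N[of n v "\<lambda>a. star (v a)"])
      (use that seed_form_nonzero[OF G] in \<open>auto simp: orthonormal_def\<close>)
  have "\<exists>v. orthonormal e 0 v" by (simp add: orthonormal_def)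
  then obtain n where "\<exists>v. orthonormal e n v" and max: "\<And>m. \<exists>v. orthonormal e m v \<Longrightarrow> m \<le> n"
    using ex_has_greatest_nat[of "\<lambda>n. \<exists>v. orthonormal e n v" 0 "\<lambda>n. n" "Suc N"] bd
    by (metis le_imp_less_Suc)
  then obtain v where v: "orthonormal e n v" by blast
  have vS: "v a \<in> S" "v a * e = v a" "star (v a) * v b = (if a = b then e else 0)"
    if "a < n" "b < n" for a b using v that by (auto simp: orthonormal_def)
  have ev: "e * star (v a) = star (v a)" if "a < n" for a
    using star_mult[of "v a" e] vS(1,2)[OF that that] e se by simp
  define z where "z = (\<Sum>a<n. v a * star (v a))"
  have z: "z \<in> S" using vS by (auto simp: z_def)
  have sz: "star z = z"
    unfolding z_def using vS by (subst star_sum) (auto simp: star_mult)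
  have vz: "star (v a) * z = star (v a)" if a: "a < n" for a
  proof -
    have "star (v a) * z = (\<Sum>b<n. (star (v a) * v b) * star (v b))"
      by (simp add: z_def sum_distrib_left mult.assoc)
    also have "\<dots> = (\<Sum>b<n. if b = a then e * star (v a) else 0)"
      by (rule sum.cong) (use vS a in auto)
    finally show ?thesis using a ev by simp
  qed
  have zz: "z * z = z"
  proof -
    have "z * z = (\<Sum>a<n. v a * (star (v a) * z))"
      by (subst (1) z_def) (simp only: sum_distrib_right mult.assoc)
    also have "\<dots> = (\<Sum>a<n. v a * star (v a))" using vz by simp
    also have "\<dots> = z" by (simp only: z_def)
    finally show ?thesis .
  qed
  \<comment> \<open>As \<open>z\<close> is the orthogonal projection onto the span of the family,
    \<open>T\<close> is the orthogonal complement in S e.\<close>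
  define T where "T = {x \<in> S. x * e = x \<and> z * x = 0}"
  have corner: "\<exists>p\<in>D. \<exists>q\<in>D. star x * y = G p + \<i> *\<^sub>C G q" if "x \<in> T" "y \<in> T" for x y
  proof -
    have x: "x \<in> S" "x * e = x" and y: "y \<in> S" "y * e = y" using that by (auto simp: T_def)
    have "star x = e * star x" using star_mult[of x e] x e se by simp
    then have "star x * y = e * (star x * y) * e" using y by (metis mult.assoc)
    then show ?thesis using Gd x y by (metis mult_closed star_closed)
  qed
  have Dm: "p - q \<in> D" if "p \<in> D" "q \<in> D" for p q
    using cl(3)[OF that(1) cl(5)[OF that(2), of "-1"]] by simp
  have Gm: "G (p - q) = G p - G q" if "p \<in> D" "q \<in> D" for p q
  proof -
    have "G (p + (-1) *\<^sub>R q) = G p + G ((-1) *\<^sub>R q)" using Gd that cl(5) by blast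
    moreover have "G ((-1) *\<^sub>R q) = of_real (-1) *\<^sub>C G q" using Gd that by blast
    ultimately show ?thesis by simp
  qed
  have scal: "\<exists>k. star x * x = k *\<^sub>C e" if x: "x \<in> T" for x
  proof -
    obtain p q where pq: "p \<in> D" "q \<in> D" "star x * x = G p + \<i> *\<^sub>C G q" using corner x by blast
    have "star (star x * x) = star x * x" using x by (simp add: T_def star_mult)
    then have "G p + \<i> *\<^sub>C G q = G (qcnj p) + \<i> *\<^sub>C G (qcnj q)"
      using pq Gd GS by (simp add: star_add star_scale)
    moreover have "G (p - qcnj p) = G p - G (qcnj p)" "G (q - qcnj q) = G q - G (qcnj q)"
      by (intro Gm pq(1,2) cl(6))+
    ultimately have "G (p - qcnj p) + \<i> *\<^sub>C G (q - qcnj q) = 0"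
      by (simp only: scale_right_diff_distrib) (simp add: algebra_simps)
    then have "p - qcnj p = 0 \<and> q - qcnj q = 0"
      by (intro seed_inj[OF G] Dm cl(6) pq(1,2))
    then have "p = QRe p *\<^sub>R 1" "q = QRe q *\<^sub>R 1" by (auto simp: quat_eq_iff)
    then have "G p = of_real (QRe p) *\<^sub>C e" "G q = of_real (QRe q) *\<^sub>C e"
      using Gd cl(2) G1 by metis+
    then have "star x * x = (of_real (QRe p) + \<i> * of_real (QRe q)) *\<^sub>C e"
      using pq by (simp add: scale_left_distrib)
    then show ?thesis by blast
  qed
  have "x * e - z * x * e = 0" if x: "x \<in> S" for x
  proof (rule ccontr)
    define x1 where "x1 = x * e - z * x * e"
    assume "x * e - z * x * e \<noteq> 0"
    then have x10: "x1 \<noteq> 0" by (simp add: x1_def)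
    have T1: "y * e - z * y * e \<in> T" if "y \<in> S" for y
      using that e z ee zz by (auto simp: T_def left_diff_distrib right_diff_distrib mult.assoc)
        (simp add: mult.assoc[symmetric] zz)
    have xT: "x1 \<in> T" using T1 x by (simp add: x1_def)
    have "\<exists>y\<in>T. star y * y \<noteq> 0"
    proof (rule ccontr)
      assume "\<not> ?thesis"
      then have iso: "star y * y = 0" if "y \<in> T" for y using that by blast
      have addT: "x + y \<in> T" if "x \<in> T" "y \<in> T" for x y
        using that by (auto simp: T_def distrib_left distrib_right)
      have skew: "star x * y = - (star y * x)" if xy: "x \<in> T" "y \<in> T" for x y
      proof -
        have "star (x + y) * (x + y) = star x * x + star y * y + (star x * y + star y * x)"
          using xy by (simp add: T_def star_add distrib_left distrib_right add_ac)
        then have "star x * y + star y * x = 0" using iso xy addT by simp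
        then show ?thesis by (simp add: eq_neg_iff_add_eq_0)
      qed
      have z0: "star x * y = 0" if xy: "x \<in> T" "y \<in> T" for x y
      proof -
        have xyS: "x \<in> S" "y \<in> S" using xy by (auto simp: T_def)
        obtain p q where pq: "p \<in> D" "q \<in> D" "star x * y = G p + \<i> *\<^sub>C G q" using corner xy by blast
        have "star (star x * y) = star y * x" using xyS by (simp add: star_mult)
        then have sk: "star y * x = G (qcnj p) + \<i> *\<^sub>C G (qcnj q)"
          using pq Gd GS by (simp add: star_add star_scale)
        have "G (qcnj p + p) = G (qcnj p) + G p" "G (qcnj q + q) = G (qcnj q) + G q"
          using Gd pq cl by simp_all
        then have "G (qcnj p + p) + \<i> *\<^sub>C G (qcnj q + q) = star x * y + star y * x"
          unfolding pq(3) sk by (simp add: scale_right_distrib add_ac)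
        then have "G (qcnj p + p) + \<i> *\<^sub>C G (qcnj q + q) = 0"
          using skew[OF xy] by simp
        then have sp: "qcnj p + p = 0 \<and> qcnj q + q = 0"
          by (intro seed_inj[OF G] cl(3,6) pq(1,2))
        \<comment> \<open>The complement is stable under right multiplication by \<open>G r\<close>.
          Putting y G r for y in the skew identity gives p r + conj(r) conj(p) = 0, and conj(p) = -p
          turns this into semilinearity; the same holds for q.\<close>
        have comm: "p * r = qcnj r * p \<and> q * r = qcnj r * q" if r: "r \<in> D" for r
        proof -
          have yr: "y * G r \<in> T"
          proof -
            have "G r * e = G r" using Gd r cl G1 by (metis mult.right_neutral)
            then show ?thesis using xy r GS by (auto simp: T_def mult.assoc) (simp add: mult.assoc[symmetric])
          qed
          have "star x * (y * G r) = - (star (y * G r) * x)" using skew xy yr by blast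
          then have "(star x * y) * G r = - (G (qcnj r) * (star y * x))"
            using xyS GS[OF r] Gd r by (simp add: star_mult mult.assoc)
          then have *: "(G p + \<i> *\<^sub>C G q) * G r + G (qcnj r) * (G (qcnj p) + \<i> *\<^sub>C G (qcnj q)) = 0"
            unfolding pq(3) sk by simp
          have "G (p * r + qcnj r * qcnj p) = G p * G r + G (qcnj r) * G (qcnj p)"
            "G (q * r + qcnj r * qcnj q) = G q * G r + G (qcnj r) * G (qcnj q)"
            using Gd pq r cl by simp_all
          then have "G (p * r + qcnj r * qcnj p) + \<i> *\<^sub>C G (q * r + qcnj r * qcnj q) = 0"
            using * by (simp add: distrib_left distrib_right scale_right_distrib add_ac)
          then have "p * r + qcnj r * qcnj p = 0 \<and> q * r + qcnj r * qcnj q = 0"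
            by (intro seed_inj[OF G] cl(3,4,6) pq(1,2) r)
          moreover have "qcnj p = - p" "qcnj q = - q" using sp by (simp_all add: eq_neg_iff_add_eq_0)
          ultimately show ?thesis by simp
        qed
        have "p = 0" by (rule skew_semilinear_zero[OF D pq(1)])
          (use sp comm in \<open>auto simp: eq_neg_iff_add_eq_0\<close>)
        moreover have "q = 0" by (rule skew_semilinear_zero[OF D pq(2)])
          (use sp comm in \<open>auto simp: eq_neg_iff_add_eq_0\<close>)
        moreover have "G 0 = 0" using Gd cl by (metis of_real_0 scaleR_zero_left scale_zero_left)
        ultimately show ?thesis using pq by simp
      qed
      have xS: "x1 \<in> S" "x1 * e = x1" "z * x1 = 0" using xT by (auto simp: T_def)
      have sx: "star x1 * z = 0" "e * star x1 = star x1"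
        using star_mult[of z x1] star_mult[of x1 e] xS z sz e se by simp_all
      \<comment> \<open>Every b e differs from an element of the complement by z b e, which
        \<open>star x1\<close> kills. Hence \<open>star x1 * b * e\<close> vanishes for all b, and
        semiprimeness applies.\<close>
      have "star x1 = 0"
      proof (rule semiprime)
        fix b assume b: "b \<in> S"
        have "star x1 * (b * e - z * b * e) = 0" using z0 xT T1 b by blast
        then have "star x1 * b * e = 0"
          using sx by (simp add: right_diff_distrib mult.assoc[symmetric])
        then show "star x1 * b * star x1 = 0" using sx by (metis mult.assoc mult_zero_left)
      qed (use xS in auto)
      then show False using x10 xS by (metis star_star star_zero)
    qed
    then obtain y where y: "y \<in> T" "star y * y \<noteq> 0" by blast
    obtain k where k: "star y * y = k *\<^sub>C e" using scal y by blast
    have k0: "k \<noteq> 0" using k y by auto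
    \<comment> \<open>A complex square root normalises the vector whatever the nonzero scalar k
      is.\<close>
    define w where "w = (1 / csqrt k) *\<^sub>C y"
    have wT: "w \<in> S" "w * e = w" "z * w = 0" using y by (auto simp: w_def T_def)
    have "csqrt k * csqrt k = k" by (metis power2_csqrt power2_eq_square)
    then have ww: "star w * w = e" using y k k0 by (simp add: w_def star_scale T_def field_simps)
    have vw: "star (v a) * w = 0" if "a < n" for a
      using vz[OF that] wT by (metis mult.assoc mult_zero_right)
    have wv: "star w * v a = 0" if "a < n" for a
      using star_mult[of "star (v a)" w] vw[OF that] vS(1)[OF that that] wT by simp
    have "orthonormal e (Suc n) (v(n := w))"
      using vS wT ww vw wv by (auto simp: orthonormal_def less_Suc_eq)
    then show False using max by fastforce
  qed
  then show ?thesis using v unfolding z_def by auto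
qed

text \<open>Completeness of the family says that z = sum of v_a star v_a is a left identity on S e,
  hence z x z = x z for all x. Applying \<open>star\<close> gives z x z = z x, so z is central. The
  ideal S z is then spanned by the products v_a (star v_a x v_b) star v_b, whose middle factors lie
  in the corner.\<close>

lemma ex_block:
  assumes c: "c \<in> S" "c \<noteq> 0" "c * c = c" "\<And>x. x \<in> S \<Longrightarrow> c * x = x * c" "star c = c"
  shows "\<exists>D n \<mu> \<Gamma>. block scale S unit l star D n \<mu> \<Gamma> \<and> c * (\<Sum>a<n. \<Gamma> a a 1) = (\<Sum>a<n. \<Gamma> a a 1)"
proof -
  obtain D e G where G: "seed D e G" and ce: "c * e = e" using ex_seed[OF c] by blast
  note Gd = G[unfolded seed_def]
  have D: "D \<in> real_forms" and e: "e \<in> S" "e \<noteq> 0" and G1: "G 1 = e" using Gd by blast+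
  note cl = real_form_closed[OF D]
  have GS: "G p \<in> S" if "p \<in> D" for p using Gd that by (auto simp: image_subset_iff)
  have ee: "e * e = e" using Gd cl by (metis mult_1)
  have se: "star e = e" using Gd cl by (metis qcnj_simps(6))
  have eG: "e * G p = G p" if "p \<in> D" for p using Gd that cl G1 by (metis mult_1)
  obtain n v where v: "orthonormal e n v"
    and comp: "\<And>x. x \<in> S \<Longrightarrow> (\<Sum>a<n. v a * star (v a)) * x * e = x * e"
    using ex_complete_orthonormal[OF G] by blast
  have vS: "v a \<in> S" "v a * e = v a" if "a < n" for a using v that by (auto simp: orthonormal_def)
  have vv: "star (v a) * v b = (if a = b then e else 0)"
    if "a < n" "b < n" for a b using v that by (auto simp: orthonormal_def)
  have ev: "e * star (v a) = star (v a)" if "a < n" for a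
    using star_mult[of "v a" e] vS[OF that] e se by simp
  define z where "z = (\<Sum>a<n. v a * star (v a))"
  have z: "z \<in> S" using vS by (auto simp: z_def)
  have sz: "star z = z"
    unfolding z_def using vS by (subst star_sum) (auto simp: star_mult)
  have zv: "z * x * v a = x * v a" if "a < n" "x \<in> S" for a x
    using comp[of "x * v a"] vS that by (simp add: z_def[symmetric] mult.assoc)
  have zxz: "z * x * z = x * z" if x: "x \<in> S" for x
  proof -
    have "z * x * z = (\<Sum>a<n. z * x * v a * star (v a))"
      by (subst (2) z_def) (simp add: sum_distrib_left mult.assoc)
    also have "\<dots> = x * z"
      using x by (simp add: zv) (simp add: z_def sum_distrib_left mult.assoc)
    finally show ?thesis .
  qed
  have central: "z * x = x * z" if x: "x \<in> S" for x
  proof -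
    have "star (z * star x * z) = star (star x * z)" using zxz x by simp
    then have "z * x * z = z * x" using x z sz by (simp add: star_mult mult.assoc)
    then show ?thesis using zxz x by simp
  qed
  define \<Gamma> where "\<Gamma> a b p = v a * G p * star (v b)" for a b p
  have zG: "(\<Sum>a<n. \<Gamma> a a 1) = z" unfolding z_def \<Gamma>_def using vS G1 by simp
  have z0: "z \<noteq> 0"
  proof
    assume "z = 0"
    then have "e * e = 0" using comp[OF e(1)] by (simp add: z_def)
    then show False using ee e by simp
  qed
  \<comment> \<open>The constant \<open>\<mu>\<close> is \<open>l e\<close>: cyclicity of
    \<open>l\<close> moves \<open>star (v b)\<close> in front of \<open>v a\<close>, where
    orthonormality leaves l (G p) for a = b and 0 otherwise.\<close>
  have "block scale S unit l star D n (l e) \<Gamma>"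
  proof (unfold_locales, goal_cases)
    case 2
    have "n \<noteq> 0"
    proof
      assume "n = 0"
      then have "z = 0" by (simp add: z_def)
      with z0 show False by blast
    qed
    then show ?case by simp
  next
    case 5
    then show ?case using Gd by (simp add: \<Gamma>_def distrib_left distrib_right)
  next
    case (6 a b p r)
    then have "G (r *\<^sub>R p) = of_real r *\<^sub>C G p" using Gd by blast
    then show ?case by (simp add: \<Gamma>_def)
  next
    case (7 a b c d p q)
    have "\<Gamma> a b p * \<Gamma> c d q = v a * G p * (star (v b) * v c) * G q * star (v d)"
      by (simp add: \<Gamma>_def mult.assoc)
    then show ?case using 7 Gd by (simp add: vv \<Gamma>_def mult.assoc eG mult_eq_assoc[OF eG])
  next
    case (8 a b p)
    then show ?case using vS GS Gd by (simp add: \<Gamma>_def star_mult mult.assoc)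
  next
    case (9 a b p)
    have "l (\<Gamma> a b p) = l (G p * star (v b) * v a)"
      using 9 vS GS by (simp add: \<Gamma>_def mult.assoc) (subst l_commute, auto simp: mult.assoc)
    also have "\<dots> = l (G p * (star (v b) * v a))" by (simp add: mult.assoc)
    also have "\<dots> = (if a = b then l (G p) else 0)"
    proof -
      have "G p * e = G p" using Gd 9(3) cl G1 by (metis mult.right_neutral)
      then show ?thesis using 9 by (simp add: vv)
    qed
    finally show ?case using 9 by (simp add: seed_form[OF G])
  next
    case (11 x)
    have "\<forall>a b. \<exists>m k. a < n \<longrightarrow> b < n \<longrightarrow> m \<in> D \<and> k \<in> D \<and> star (v a) * x * v b = G m + \<i> *\<^sub>C G k"
    proof (intro allI)
      fix a b
      show "\<exists>m k. a < n \<longrightarrow> b < n \<longrightarrow> m \<in> D \<and> k \<in> D \<and> star (v a) * x * v b = G m + \<i> *\<^sub>C G k"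
      proof (cases "a < n \<and> b < n")
        case True
        then have "star (v a) * x * v b = e * (star (v a) * x * v b) * e"
          using ev[of a] vS(2)[of b] by (metis mult.assoc)
        moreover have "star (v a) * x * v b \<in> S" using True vS 11 by auto
        ultimately have "\<exists>p\<in>D. \<exists>q\<in>D. star (v a) * x * v b = G p + \<i> *\<^sub>C G q" using Gd by metis
        then show ?thesis by blast
      qed auto
    qed
    then obtain M N where MN: "\<And>a b. a < n \<Longrightarrow> b < n \<Longrightarrow>
        M a b \<in> D \<and> N a b \<in> D \<and> star (v a) * x * v b = G (M a b) + \<i> *\<^sub>C G (N a b)"
      by metis
    have "x * z = z * x * z" using zxz 11 by simp
    also have "\<dots> = (\<Sum>a<n. \<Sum>b<n. v a * (star (v a) * x * v b) * star (v b))"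
      unfolding z_def by (simp add: sum_distrib_left sum_distrib_right mult.assoc)
        (rule sum.swap)
    also have "\<dots> = (\<Sum>a<n. \<Sum>b<n. \<Gamma> a b (M a b) + \<i> *\<^sub>C \<Gamma> a b (N a b))"
      by (intro sum.cong refl) (simp add: MN \<Gamma>_def distrib_left distrib_right)
    finally show ?case unfolding zG using MN by blast
  qed (use D seed_form_nonzero[OF G] vS GS central zG in \<open>auto simp: \<Gamma>_def\<close>)
  moreover have "c * z = z"
  proof -
    have "c * v a = v a" if "a < n" for a
      using vS[OF that] c(4)[of "v a"] c(1) ce by (metis mult.assoc)
    then show ?thesis by (simp add: z_def sum_distrib_left mult.assoc[symmetric])
  qed
  ultimately show ?thesis using zG by metis
qed

end

section \<open>Decomposition into blocks\<close>

definition qbasis :: "quat set \<Rightarrow> quat set" where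
  "qbasis D = {1, qi, qj, qk} \<inter> D"

lemma quat_units_distinct [simp]:
  "qi \<noteq> 1" "qj \<noteq> 1" "qk \<noteq> 1" "qi \<noteq> qj" "qi \<noteq> qk" "qj \<noteq> qk"
  "1 \<noteq> qi" "1 \<noteq> qj" "1 \<noteq> qk" "qj \<noteq> qi" "qk \<noteq> qi" "qk \<noteq> qj"
  by (simp_all add: quat_eq_iff)

lemma qbasis_eq:
  "qbasis \<real> = {1}" "qbasis quat_complexes = {1, qi}" "qbasis UNIV = {1, qi, qj, qk}"
  by (auto simp: qbasis_def quat_Reals_iff quat_complexes_def)

lemma real_forms_casesE:
  assumes "D \<in> real_forms"
  obtains "D = \<real>" "qbasis D = {1}" | "D = quat_complexes" "qbasis D = {1, qi}"
    | "D = UNIV" "qbasis D = {1, qi, qj, qk}"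
  using assms qbasis_eq by (auto simp: real_forms_def)

lemma finite_qbasis [simp]: "finite (qbasis D)"
  by (simp add: qbasis_def)

lemma qbasis_mem: "q \<in> qbasis D \<Longrightarrow> q \<in> D"
  by (simp add: qbasis_def)

text \<open>The units 1, i, j, k are orthonormal for Re (p conj(q)), so q and \<open>qcnj q\<close>
  run through dual bases for Re (p q).\<close>

lemma qbasis_expansion:
  assumes "D \<in> real_forms" "p \<in> D"
  shows "(\<Sum>q\<in>qbasis D. QRe (p * q) *\<^sub>R qcnj q) = p"
  using assms(1)
  by (rule real_forms_casesE) (use assms(2) in \<open>auto simp: quat_eq_iff quat_Reals_iff quat_complexes_def\<close>)

lemma dim_real_form:
  assumes "D \<in> real_forms"
  shows "Real_Vector_Spaces.dim D = card (qbasis D)"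
proof (rule real_vector.dim_unique)
  show "qbasis D \<subseteq> D" by (simp add: qbasis_def)
  show "D \<subseteq> Real_Vector_Spaces.span (qbasis D)"
  proof
    fix p assume p: "p \<in> D"
    have "qcnj q \<in> Real_Vector_Spaces.span (qbasis D)" if q: "q \<in> qbasis D" for q
    proof -
      have "qcnj q = q \<or> qcnj q = - q" using q by (auto simp: qbasis_def quat_eq_iff)
      then show ?thesis
        using real_vector.span_base[OF q] real_vector.span_neg by metis
    qed
    then have "(\<Sum>q\<in>qbasis D. QRe (p * q) *\<^sub>R qcnj q) \<in> Real_Vector_Spaces.span (qbasis D)"
      by (intro real_vector.span_sum real_vector.span_scale)
    then show "p \<in> Real_Vector_Spaces.span (qbasis D)"
      by (simp only: qbasis_expansion[OF assms p])
  qed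
  show "Real_Vector_Spaces.independent (qbasis D)"
  proof (rule real_vector.independent_if_scalars_zero)
    fix f q assume s: "(\<Sum>x\<in>qbasis D. f x *\<^sub>R x) = 0" and q: "q \<in> qbasis D"
    show "f q = 0"
      using assms by (rule real_forms_casesE) (use s[unfolded quat_eq_iff] q in auto)
  qed simp
qed simp

text \<open>The unit 1 contributes 1 and each of the d - 1 imaginary units contributes -1.\<close>

lemma qbasis_square_sum:
  assumes "D \<in> real_forms"
  shows "(\<Sum>q\<in>qbasis D. q * q) = (2 - real (card (qbasis D))) *\<^sub>R 1"
  using assms by (rule real_forms_casesE) (auto simp: quat_eq_iff)

text \<open>Each basis element has norm 1 and commutes with p, so all d terms equal p. This is the
  source of the factor d in the formula for \<phi> \<phi>*.\<close>

lemma qbasis_sandwich_sum: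
  assumes "D \<in> real_forms" "p \<in> D" "\<And>q. q \<in> D \<Longrightarrow> p * q = q * p"
  shows "(\<Sum>q\<in>qbasis D. qcnj q * p * q) = real (card (qbasis D)) *\<^sub>R p"
proof -
  have "qcnj q * p * q = p" if q: "q \<in> qbasis D" for q
  proof -
    have "qcnj q * q = 1" using q by (auto simp: qbasis_def quat_eq_iff)
    moreover have "p * q = q * p" using assms(3) qbasis_mem[OF q] by blast
    ultimately show ?thesis by (simp add: mult.assoc) (simp add: mult.assoc[symmetric])
  qed
  then show ?thesis by (simp add: scaleR_conv_of_real)
qed

definition block_unit :: "nat \<Rightarrow> (nat \<Rightarrow> nat \<Rightarrow> quat \<Rightarrow> 'r::comm_monoid_add) \<Rightarrow> 'r" where
  "block_unit n \<Gamma> = (\<Sum>a<n. \<Gamma> a a 1)"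

section \<open>Arithmetic of one block: injectivity, dual bases and the matrix model\<close>

context block
begin

abbreviation "z \<equiv> block_unit n \<Gamma>"

lemmas D_closed = real_form_closed[OF D]

lemma D_diff: "p \<in> D \<Longrightarrow> q \<in> D \<Longrightarrow> p - q \<in> D"
  using D_closed(3)[of p "(-1) *\<^sub>R q"] D_closed(5)[of q "-1"] by simp

lemma G_zero: "a < n \<Longrightarrow> b < n \<Longrightarrow> \<Gamma> a b 0 = 0"
  using G_scale[of a b 0 0] D_closed(1) by simp

lemma G_diff: "a < n \<Longrightarrow> b < n \<Longrightarrow> p \<in> D \<Longrightarrow> q \<in> D \<Longrightarrow> \<Gamma> a b (p - q) = \<Gamma> a b p - \<Gamma> a b q"
  using G_add[of a b "p - q" q] D_diff by simp

lemma D_sum: "(\<And>i. i \<in> I \<Longrightarrow> f i \<in> D) \<Longrightarrow> sum f I \<in> D"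
  by (induct I rule: infinite_finite_induct) (use D_closed in auto)

lemma G_sum:
  assumes "a < n" "b < n" "\<And>i. i \<in> I \<Longrightarrow> f i \<in> D"
  shows "\<Gamma> a b (sum f I) = (\<Sum>i\<in>I. \<Gamma> a b (f i))"
  using assms(3)
proof (induct I rule: infinite_finite_induct)
  case (insert i I)
  have "sum f I \<in> D" by (rule D_sum) (use insert in auto)
  then have "\<Gamma> a b (f i + sum f I) = \<Gamma> a b (f i) + \<Gamma> a b (sum f I)"
    using insert assms(1,2) by (intro G_add) auto
  then show ?case using insert by simp
qed (use assms G_zero in auto)

lemma z_closed [simp]: "z \<in> S"
  by (auto simp: block_unit_def D_closed G_closed)

lemma z_G: "a < n \<Longrightarrow> b < n \<Longrightarrow> p \<in> D \<Longrightarrow> z * \<Gamma> a b p = \<Gamma> a b p"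
  by (simp add: block_unit_def sum_distrib_right G_mult D_closed)

lemma z_z: "z * z = z"
proof -
  have "z * z = z * (\<Sum>a<n. \<Gamma> a a 1)" by (simp only: block_unit_def)
  also have "\<dots> = (\<Sum>a<n. \<Gamma> a a 1)" by (simp add: sum_distrib_left z_G D_closed)
  finally show ?thesis by (simp only: block_unit_def)
qed

lemma star_z: "star z = z"
  unfolding block_unit_def by (subst star_sum) (auto simp: G_closed G_star D_closed)

text \<open>The value is n \<mu>. Being nonzero, it makes orthogonal block units biorthogonal to
  themselves, which bounds the number of blocks.\<close>

lemma l_z_nonzero: "l z \<noteq> 0"
  unfolding block_unit_def using n mu by (subst l_sum) (auto simp: G_closed G_form D_closed)

lemma G_inj:
  assumes ab: "a < n" "b < n" and D4: "p \<in> D" "q \<in> D" "p' \<in> D" "q' \<in> D"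
    and eq: "\<Gamma> a b p + \<i> *\<^sub>C \<Gamma> a b q = \<Gamma> a b p' + \<i> *\<^sub>C \<Gamma> a b q'"
  shows "p = p' \<and> q = q'"
proof -
  define r s where "r = p - p'" and "s = q - q'"
  have rs: "r \<in> D" "s \<in> D" using D4 by (auto simp: r_def s_def D_diff)
  have 0: "\<Gamma> a b r + \<i> *\<^sub>C \<Gamma> a b s = 0"
    using eq ab D4 by (simp add: r_def s_def G_diff scale_right_diff_distrib algebra_simps)
  have *: "QRe (r * t) = 0 \<and> QRe (s * t) = 0" if t: "t \<in> D" for t
  proof -
    have "(\<Gamma> a b r + \<i> *\<^sub>C \<Gamma> a b s) * \<Gamma> b a t = \<Gamma> a a (r * t) + \<i> *\<^sub>C \<Gamma> a a (s * t)"
      using ab rs t by (simp add: distrib_right G_mult)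
    then have "l (\<Gamma> a a (r * t) + \<i> *\<^sub>C \<Gamma> a a (s * t)) = 0" using 0 by simp
    then have "\<mu> * (of_real (QRe (r * t)) + \<i> * of_real (QRe (s * t))) = 0"
      using ab rs t D_closed
      by (simp add: l_add l_scale G_closed G_form algebra_simps del: times_quat.sel)
    then have "of_real (QRe (r * t)) + \<i> * of_real (QRe (s * t)) = (0 :: complex)"
      using mu by (metis mult_eq_0_iff)
    then show ?thesis by (simp add: complex_eq_iff del: times_quat.sel)
  qed
  then have "r = 0 \<and> s = 0" using real_form_nondegenerate[OF D] rs by blast
  then show ?thesis by (simp add: r_def s_def)
qed

text \<open>The elements \<open>\<Gamma> a b q\<close> and \<open>\<Gamma> b a (qcnj q) / \<mu>\<close> are dual bases for \<open>l\<close>.\<close>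

lemma block_expansion:
  assumes x: "x \<in> S"
  shows "z * x = (\<Sum>a<n. \<Sum>b<n. \<Sum>q\<in>qbasis D. l (x * \<Gamma> a b q) *\<^sub>C (1 / \<mu>) *\<^sub>C \<Gamma> b a (qcnj q))"
proof -
  obtain M N where MN: "\<And>a b. a < n \<Longrightarrow> b < n \<Longrightarrow> M a b \<in> D \<and> N a b \<in> D"
    and xz: "x * z = (\<Sum>a<n. \<Sum>b<n. \<Gamma> a b (M a b) + \<i> *\<^sub>C \<Gamma> a b (N a b))"
    using z_span[OF x] unfolding block_unit_def by blast
  \<comment> \<open>Pairing with the unit at (a, b) reads the transposed entry (b, a) of x z, as for
    a trace form.\<close>
  have lx: "l (x * \<Gamma> a b q) = \<mu> * (of_real (QRe (M b a * q)) + \<i> * of_real (QRe (N b a * q)))"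
    if ab: "a < n" "b < n" and q: "q \<in> D" for a b q
  proof -
    have "x * \<Gamma> a b q = (x * z) * \<Gamma> a b q" using z_G[OF ab q] by (simp add: mult.assoc)
    also have "\<dots> = (\<Sum>c<n. \<Sum>d<n. \<Gamma> c d (M c d) * \<Gamma> a b q + \<i> *\<^sub>C (\<Gamma> c d (N c d) * \<Gamma> a b q))"
      unfolding xz by (simp add: sum_distrib_right distrib_right)
    also have "\<dots> = (\<Sum>c<n. \<Sum>d<n. if d = a then \<Gamma> c b (M c a * q) + \<i> *\<^sub>C \<Gamma> c b (N c a * q) else 0)"
      by (intro sum.cong refl) (use ab q MN in \<open>auto simp: G_mult\<close>)
    also have "\<dots> = (\<Sum>c<n. \<Gamma> c b (M c a * q) + \<i> *\<^sub>C \<Gamma> c b (N c a * q))"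
      using ab by simp
    finally have "l (x * \<Gamma> a b q) = (\<Sum>c<n. l (\<Gamma> c b (M c a * q) + \<i> *\<^sub>C \<Gamma> c b (N c a * q)))"
      using ab q MN D_closed by (subst l_sum[symmetric]) (auto simp: G_closed)
    also have "\<dots> = (\<Sum>c<n. if c = b then \<mu> * (of_real (QRe (M b a * q)) + \<i> * of_real (QRe (N b a * q))) else 0)"
      by (intro sum.cong refl)
        (use ab q MN D_closed in \<open>auto simp: l_add l_scale G_closed G_form algebra_simps simp del: times_quat.sel\<close>)
    finally show ?thesis using ab by simp
  qed
  have G_exp: "(\<Sum>q\<in>qbasis D. of_real (QRe (m * q)) *\<^sub>C \<Gamma> b a (qcnj q)) = \<Gamma> b a m"
    if ab: "a < n" "b < n" and m: "m \<in> D" for a b m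
  proof -
    have "\<Gamma> b a m = \<Gamma> b a (\<Sum>q\<in>qbasis D. QRe (m * q) *\<^sub>R qcnj q)"
      by (simp only: qbasis_expansion[OF D m])
    also have "\<dots> = (\<Sum>q\<in>qbasis D. of_real (QRe (m * q)) *\<^sub>C \<Gamma> b a (qcnj q))"
      using ab qbasis_mem[of _ D] D_closed
      by (subst G_sum) (auto simp: G_scale simp del: times_quat.sel)
    finally show ?thesis by simp
  qed
  have "(\<Sum>q\<in>qbasis D. l (x * \<Gamma> a b q) *\<^sub>C (1 / \<mu>) *\<^sub>C \<Gamma> b a (qcnj q)) =
      \<Gamma> b a (M b a) + \<i> *\<^sub>C \<Gamma> b a (N b a)" if ab: "a < n" "b < n" for a b
  proof -
    have "(\<Sum>q\<in>qbasis D. l (x * \<Gamma> a b q) *\<^sub>C (1 / \<mu>) *\<^sub>C \<Gamma> b a (qcnj q)) =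
      (\<Sum>q\<in>qbasis D. of_real (QRe (M b a * q)) *\<^sub>C \<Gamma> b a (qcnj q) +
         \<i> *\<^sub>C of_real (QRe (N b a * q)) *\<^sub>C \<Gamma> b a (qcnj q))"
      by (intro sum.cong refl)
        (use ab mu qbasis_mem[of _ D] in \<open>auto simp: lx scale_left_distrib simp del: times_quat.sel\<close>)
    also have "\<dots> = (\<Sum>q\<in>qbasis D. of_real (QRe (M b a * q)) *\<^sub>C \<Gamma> b a (qcnj q)) +
        \<i> *\<^sub>C (\<Sum>q\<in>qbasis D. of_real (QRe (N b a * q)) *\<^sub>C \<Gamma> b a (qcnj q))"
      by (simp only: sum.distrib scale_sum_right)
    finally show ?thesis using ab MN by (simp only: G_exp)
  qed
  then have "(\<Sum>a<n. \<Sum>b<n. \<Sum>q\<in>qbasis D. l (x * \<Gamma> a b q) *\<^sub>C (1 / \<mu>) *\<^sub>C \<Gamma> b a (qcnj q)) =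
      (\<Sum>a<n. \<Sum>b<n. \<Gamma> b a (M b a) + \<i> *\<^sub>C \<Gamma> b a (N b a))" by simp
  also have "\<dots> = x * z" unfolding xz by (rule sum.swap)
  also have "\<dots> = z * x" using z_central[OF x] by (simp add: block_unit_def)
  finally show ?thesis by simp
qed

text \<open>Only real matrices over \<open>D\<close> are encoded; a general element of the block is
  \<open>gm M + \<i> *\<^sub>C gm N\<close>, which matches the pairs used for
  complexification.\<close>

definition gm :: "quat mat \<Rightarrow> 'r" where
  "gm M = (\<Sum>a<n. \<Sum>b<n. \<Gamma> a b (M $$ (a, b)))"

abbreviation "matD \<equiv> carrier (mat_alg D n)"

lemma matD_iff: "M \<in> matD \<longleftrightarrow> M \<in> carrier_mat n n \<and> (\<forall>a<n. \<forall>b<n. M $$ (a, b) \<in> D)"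
  by (auto simp: mat_alg_def elements_mat_def) (fastforce simp: subset_iff)

lemma matD_closed:
  "0\<^sub>m n n \<in> matD" "1\<^sub>m n \<in> matD"
  "M \<in> matD \<Longrightarrow> N \<in> matD \<Longrightarrow> M + N \<in> matD" "M \<in> matD \<Longrightarrow> N \<in> matD \<Longrightarrow> M * N \<in> matD"
  "M \<in> matD \<Longrightarrow> map_mat ((*\<^sub>R) r) M \<in> matD"
  "M \<in> matD \<Longrightarrow> transpose_mat (map_mat qcnj M) \<in> matD"
  using D_closed by (auto simp: matD_iff scalar_prod_def intro!: D_sum)

lemma gm_closed: "M \<in> matD \<Longrightarrow> gm M \<in> S"
  by (auto simp: gm_def matD_iff intro!: sum_closed G_closed)

lemma gm_zero: "gm (0\<^sub>m n n) = 0"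
  by (simp add: gm_def G_zero)

lemma gm_one: "gm (1\<^sub>m n) = z"
proof -
  have "gm (1\<^sub>m n) = (\<Sum>a<n. \<Sum>b<n. if b = a then \<Gamma> a a 1 else 0)"
    unfolding gm_def by (intro sum.cong refl) (auto simp: G_zero)
  then show ?thesis by (simp add: block_unit_def)
qed

lemma gm_add: "M \<in> matD \<Longrightarrow> N \<in> matD \<Longrightarrow> gm (M + N) = gm M + gm N"
  by (auto simp: gm_def matD_iff G_add sum.distrib)

lemma gm_scale: "M \<in> matD \<Longrightarrow> gm (map_mat ((*\<^sub>R) r) M) = of_real r *\<^sub>C gm M"
  by (auto simp: gm_def matD_iff G_scale scale_sum_right)

lemma gm_mult:
  assumes M: "M \<in> matD" and N: "N \<in> matD"
  shows "gm M * gm N = gm (M * N)"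
proof -
  have D2: "M $$ (a, b) \<in> D" "N $$ (a, b) \<in> D" if "a < n" "b < n" for a b
    using M N that by (auto simp: matD_iff)
  have "gm M * gm N = (\<Sum>a<n. \<Sum>b<n. \<Sum>c<n. \<Sum>d<n. \<Gamma> a b (M $$ (a, b)) * \<Gamma> c d (N $$ (c, d)))"
    unfolding gm_def by (simp only: sum_distrib_right) (simp only: sum_distrib_left)
  also have "\<dots> = (\<Sum>a<n. \<Sum>b<n. \<Sum>c<n. if c = b then \<Sum>d<n. \<Gamma> a d (M $$ (a, b) * N $$ (b, d)) else 0)"
    by (intro sum.cong refl) (auto simp: G_mult D2)
  also have "\<dots> = (\<Sum>a<n. \<Sum>b<n. \<Sum>d<n. \<Gamma> a d (M $$ (a, b) * N $$ (b, d)))" by simp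
  also have "\<dots> = (\<Sum>a<n. \<Sum>d<n. \<Sum>b<n. \<Gamma> a d (M $$ (a, b) * N $$ (b, d)))"
    by (intro sum.cong refl sum.swap)
  also have "\<dots> = (\<Sum>a<n. \<Sum>d<n. \<Gamma> a d ((M * N) $$ (a, d)))"
  proof (intro sum.cong refl)
    fix a d assume "a \<in> {..<n}" "d \<in> {..<n}"
    then have ad: "a < n" "d < n" by auto
    have "(M * N) $$ (a, d) = (\<Sum>b<n. M $$ (a, b) * N $$ (b, d))"
      using M N ad by (auto simp: matD_iff scalar_prod_def lessThan_atLeast0)
    then show "(\<Sum>b<n. \<Gamma> a d (M $$ (a, b) * N $$ (b, d))) = \<Gamma> a d ((M * N) $$ (a, d))"
      using ad D2 D_closed by (simp only:) (subst G_sum, auto)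
  qed
  finally show ?thesis by (simp add: gm_def)
qed

lemma gm_star: "M \<in> matD \<Longrightarrow> star (gm M) = gm (transpose_mat (map_mat qcnj M))"
proof -
  assume M: "M \<in> matD"
  then have D1: "M $$ (a, b) \<in> D" if "a < n" "b < n" for a b
    using that by (auto simp: matD_iff)
  have "star (gm M) = (\<Sum>a<n. \<Sum>b<n. \<Gamma> b a (qcnj (M $$ (a, b))))"
  proof -
    have "star (gm M) = (\<Sum>a<n. star (\<Sum>b<n. \<Gamma> a b (M $$ (a, b))))"
      unfolding gm_def by (rule star_sum) (use D1 in \<open>auto intro!: sum_closed G_closed\<close>)
    also have "\<dots> = (\<Sum>a<n. \<Sum>b<n. \<Gamma> b a (qcnj (M $$ (a, b))))"
      by (intro sum.cong refl, subst star_sum) (use D1 in \<open>auto simp: G_closed G_star\<close>)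
    finally show ?thesis .
  qed
  also have "\<dots> = (\<Sum>b<n. \<Sum>a<n. \<Gamma> b a (qcnj (M $$ (a, b))))" by (rule sum.swap)
  also have "\<dots> = gm (transpose_mat (map_mat qcnj M))"
    unfolding gm_def using M by (intro sum.cong refl) (auto simp: matD_iff)
  finally show ?thesis .
qed

lemma gm_form: "M \<in> matD \<Longrightarrow> l (gm M) = \<mu> * of_real (QRe (mat_trace M))"
proof -
  assume M: "M \<in> matD"
  then have D1: "M $$ (a, b) \<in> D" if "a < n" "b < n" for a b
    using that by (auto simp: matD_iff)
  have "QRe (sum f I) = (\<Sum>i\<in>I. QRe (f i))" for f :: "nat \<Rightarrow> quat" and I
    by (induct I rule: infinite_finite_induct) auto
  note QRe_sum = this
  have "l (gm M) = (\<Sum>a<n. l (\<Sum>b<n. \<Gamma> a b (M $$ (a, b))))"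
    unfolding gm_def by (rule l_sum) (use D1 in \<open>auto intro!: sum_closed G_closed\<close>)
  also have "\<dots> = (\<Sum>a<n. \<mu> * of_real (QRe (M $$ (a, a))))"
    by (intro sum.cong refl, subst l_sum) (use D1 in \<open>auto simp: G_closed G_form\<close>)
  finally show ?thesis
    using M unfolding matD_iff by (auto simp: mat_trace_def sum_distrib_left QRe_sum)
qed

lemma G_gm_G:
  assumes ab: "a < n" "b < n" and M: "M \<in> matD"
  shows "\<Gamma> a a 1 * gm M * \<Gamma> b b 1 = \<Gamma> a b (M $$ (a, b))"
proof -
  have D1: "M $$ (a, b) \<in> D" if "a < n" "b < n" for a b
    using that M by (auto simp: matD_iff)
  have "\<Gamma> a a 1 * gm M * \<Gamma> b b 1 =
      (\<Sum>c<n. \<Sum>d<n. if d = b then if c = a then \<Gamma> a b (M $$ (a, b)) else 0 else 0)"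
    unfolding gm_def sum_distrib_left sum_distrib_right
    by (intro sum.cong refl) (use ab D1 D_closed in \<open>auto simp: G_mult\<close>)
  then show ?thesis using ab by simp
qed

lemma gm_inj:
  assumes M: "M \<in> matD" "N \<in> matD" "M' \<in> matD" "N' \<in> matD"
    and eq: "gm M + \<i> *\<^sub>C gm N = gm M' + \<i> *\<^sub>C gm N'"
  shows "M = M' \<and> N = N'"
proof -
  have "M $$ (a, b) = M' $$ (a, b) \<and> N $$ (a, b) = N' $$ (a, b)" if ab: "a < n" "b < n" for a b
  proof -
    have "\<Gamma> a a 1 * (gm M + \<i> *\<^sub>C gm N) * \<Gamma> b b 1 = \<Gamma> a a 1 * (gm M' + \<i> *\<^sub>C gm N') * \<Gamma> b b 1"
      using eq by simp
    then have "\<Gamma> a b (M $$ (a, b)) + \<i> *\<^sub>C \<Gamma> a b (N $$ (a, b)) =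
        \<Gamma> a b (M' $$ (a, b)) + \<i> *\<^sub>C \<Gamma> a b (N' $$ (a, b))"
      using M ab by (simp add: distrib_left distrib_right G_gm_G)
    then show ?thesis by (rule G_inj[OF ab, rotated -1]) (use M ab in \<open>auto simp: matD_iff\<close>)
  qed
  then show ?thesis using M by (intro conjI eq_matI) (auto simp: matD_iff)
qed

lemma gm_span:
  assumes "x \<in> S"
  shows "\<exists>M\<in>matD. \<exists>N\<in>matD. x * z = gm M + \<i> *\<^sub>C gm N"
proof -
  obtain M N where MN: "\<And>a b. a < n \<Longrightarrow> b < n \<Longrightarrow> M a b \<in> D \<and> N a b \<in> D"
    and xz: "x * z = (\<Sum>a<n. \<Sum>b<n. \<Gamma> a b (M a b) + \<i> *\<^sub>C \<Gamma> a b (N a b))"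
    using z_span[OF assms] unfolding block_unit_def by blast
  have "x * z = gm (mat n n (\<lambda>(a, b). M a b)) + \<i> *\<^sub>C gm (mat n n (\<lambda>(a, b). N a b))"
    by (simp add: xz gm_def sum.distrib scale_sum_right)
  moreover have "mat n n (\<lambda>(a, b). M a b) \<in> matD" "mat n n (\<lambda>(a, b). N a b) \<in> matD"
    using MN by (auto simp: matD_iff)
  ultimately show ?thesis by blast
qed

lemma gm_z: "M \<in> matD \<Longrightarrow> gm M * z = gm M" "M \<in> matD \<Longrightarrow> z * gm M = gm M"
proof -
  assume M: "M \<in> matD"
  then have "M * 1\<^sub>m n = M" "1\<^sub>m n * M = M" by (auto simp: matD_iff)
  then show "gm M * z = gm M" "z * gm M = gm M"
    using gm_mult[OF M matD_closed(2)] gm_mult[OF matD_closed(2) M] by (simp_all add: gm_one)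
qed

end

section \<open>Exhausting the algebra by mutually orthogonal blocks\<close>

context involutive_frobenius
begin

text \<open>For a family of orthogonal blocks of maximal size, the unit minus all block units is a
  self-adjoint central idempotent c orthogonal to every block. If c were nonzero,
  \<open>ex_block\<close> would produce a further block below c. The zero algebra gives k =
  0.\<close>

lemma ex_block_decomposition:
  "\<exists>(k :: nat) D n \<mu> \<Gamma>. (\<forall>i<k. block scale S unit l star (D i) (n i) (\<mu> i) (\<Gamma> i)) \<and>
     (\<forall>i<k. \<forall>j<k. i \<noteq> j \<longrightarrow> block_unit (n i) (\<Gamma> i) * block_unit (n j) (\<Gamma> j) = 0) \<and>
     (\<Sum>i<k. block_unit (n i) (\<Gamma> i)) = unit"
proof -
  define P where "P k D n \<mu> \<Gamma> \<longleftrightarrow>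
     (\<forall>i<k. block scale S unit l star (D i) (n i) (\<mu> i) (\<Gamma> i)) \<and>
     (\<forall>i<k. \<forall>j<k. i \<noteq> j \<longrightarrow> block_unit (n i) (\<Gamma> i) * block_unit (n j) (\<Gamma> j) = 0)"
    for k :: nat and D n \<mu> \<Gamma>
  obtain N where N: "\<And>m v w. (\<forall>i<m. v i \<in> S \<and> w i \<in> S) \<Longrightarrow>
     (\<forall>i<m. \<forall>j<m. l (w i * v j) = 0 \<longleftrightarrow> i \<noteq> j) \<Longrightarrow> m \<le> (N :: nat)"
    using biorthogonal_bound by blast
  have bd: "k \<le> N" if P: "P k D n \<mu> \<Gamma>" for k D n \<mu> \<Gamma>
  proof (rule N[of k "\<lambda>i. block_unit (n i) (\<Gamma> i)" "\<lambda>i. block_unit (n i) (\<Gamma> i)"])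
    have B: "block scale S unit l star (D i) (n i) (\<mu> i) (\<Gamma> i)" if "i < k" for i
      using P that by (simp add: P_def)
    show "\<forall>i<k. block_unit (n i) (\<Gamma> i) \<in> S \<and> block_unit (n i) (\<Gamma> i) \<in> S"
      using block.z_closed[OF B] by blast
    show "\<forall>i<k. \<forall>j<k. l (block_unit (n i) (\<Gamma> i) * block_unit (n j) (\<Gamma> j)) = 0 \<longleftrightarrow> i \<noteq> j"
      using block.l_z_nonzero[OF B] block.z_z[OF B] P by (auto simp: P_def)
  qed
  have "\<exists>D n \<mu> \<Gamma>. P 0 D n \<mu> \<Gamma>" by (simp add: P_def)
  then obtain k where "\<exists>D n \<mu> \<Gamma>. P k D n \<mu> \<Gamma>" and max: "\<And>m. \<exists>D n \<mu> \<Gamma>. P m D n \<mu> \<Gamma> \<Longrightarrow> m \<le> k"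
    using ex_has_greatest_nat[of "\<lambda>k. \<exists>D n \<mu> \<Gamma>. P k D n \<mu> \<Gamma>" 0 "\<lambda>n. n" "Suc N"] bd
    by (metis le_imp_less_Suc)
  then obtain D n \<mu> \<Gamma> where P: "P k D n \<mu> \<Gamma>" by blast
  have B: "block scale S unit l star (D i) (n i) (\<mu> i) (\<Gamma> i)" if "i < k" for i
    using P that by (simp add: P_def)
  define Z where "Z i = block_unit (n i) (\<Gamma> i)" for i
  have Z: "Z i \<in> S" "Z i * Z i = Z i" "star (Z i) = Z i" if "i < k" for i
    using block.z_closed[OF B[OF that]] block.z_z[OF B[OF that]] block.star_z[OF B[OF that]]
    by (simp_all add: Z_def)
  have Zc: "Z i * x = x * Z i" if "i < k" "x \<in> S" for i x
    using block.z_central[OF B[OF that(1)] that(2)] by (simp add: Z_def block_unit_def)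
  have ZZ: "Z i * Z j = 0" if "i < k" "j < k" "i \<noteq> j" for i j
    using P that by (simp add: P_def Z_def)
  define c where "c = unit - (\<Sum>i<k. Z i)"
  have sumZ: "(\<Sum>i<k. Z i) \<in> S" using Z by auto
  have cS: "c \<in> S" using sumZ by (simp add: c_def)
  have cZ: "c * Z j = 0" "Z j * c = 0" if j: "j < k" for j
  proof -
    have "(\<Sum>i<k. Z i) * Z j = (\<Sum>i<k. if i = j then Z j else 0)"
      unfolding sum_distrib_right by (rule sum.cong) (use Z ZZ j in auto)
    then show "c * Z j = 0" using j Z by (simp add: c_def left_diff_distrib)
    then show "Z j * c = 0" using Zc[OF j cS] by simp
  qed
  have cc: "c * c = c"
  proof -
    have "c * (\<Sum>i<k. Z i) = 0" by (simp add: sum_distrib_left cZ)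
    then have "c * (unit - (\<Sum>i<k. Z i)) = c" using cS by (simp add: right_diff_distrib)
    then show ?thesis by (simp only: c_def[symmetric])
  qed
  have ccen: "c * x = x * c" if "x \<in> S" for x
    using that Zc by (simp add: c_def left_diff_distrib right_diff_distrib sum_distrib_left sum_distrib_right)
  have sc: "star c = c"
  proof -
    have "star (\<Sum>i<k. Z i) = (\<Sum>i<k. Z i)" by (subst star_sum) (use Z in auto)
    then show ?thesis using sumZ by (simp add: c_def star_diff star_unit)
  qed
  have "c = 0"
  proof (rule ccontr)
    assume c0: "c \<noteq> 0"
    obtain D' n' \<mu>' \<Gamma>' where B': "block scale S unit l star D' n' \<mu>' \<Gamma>'"
      and cz: "c * block_unit n' \<Gamma>' = block_unit n' \<Gamma>'"
      using ex_block[OF cS c0 cc ccen sc] unfolding block_unit_def by blast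
    have z': "block_unit n' \<Gamma>' \<in> S" by (rule block.z_closed[OF B'])
    have "Z j * block_unit n' \<Gamma>' = 0" if "j < k" for j
      using cZ[OF that] cz by (metis mult.assoc mult_zero_left)
    moreover have "block_unit n' \<Gamma>' * Z j = 0" if "j < k" for j
      using calculation[OF that] Zc[OF that z'] by simp
    ultimately have "P (Suc k) (D(k := D')) (n(k := n')) (\<mu>(k := \<mu>')) (\<Gamma>(k := \<Gamma>'))"
      using P B' by (auto simp: P_def Z_def less_Suc_eq)
    then show False using max by fastforce
  qed
  then have "(\<Sum>i<k. block_unit (n i) (\<Gamma> i)) = unit" by (simp add: c_def Z_def)
  with P show ?thesis unfolding P_def by blast
qed

end

section \<open>Sums of complexified real algebras\<close>

locale summands = involutive_frobenius scale S unit l star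
  for scale :: "complex \<Rightarrow> 'r::ring \<Rightarrow> 'r" (infixr "*\<^sub>C" 75) and S unit l star +
  fixes k :: nat and R :: "nat \<Rightarrow> (real, 'x) module" and h :: "nat \<Rightarrow> 'x \<Rightarrow> 'r"
    and T :: "nat \<Rightarrow> 'x \<Rightarrow> complex" and cj :: "nat \<Rightarrow> 'x \<Rightarrow> 'x"
  assumes R_zero: "i < k \<Longrightarrow> \<zero>\<^bsub>R i\<^esub> \<in> carrier (R i)"
    and R_one: "i < k \<Longrightarrow> \<one>\<^bsub>R i\<^esub> \<in> carrier (R i)"
    and R_add: "i < k \<Longrightarrow> x \<in> carrier (R i) \<Longrightarrow> y \<in> carrier (R i) \<Longrightarrow> x \<oplus>\<^bsub>R i\<^esub> y \<in> carrier (R i)"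
    and R_mult: "i < k \<Longrightarrow> x \<in> carrier (R i) \<Longrightarrow> y \<in> carrier (R i) \<Longrightarrow> x \<otimes>\<^bsub>R i\<^esub> y \<in> carrier (R i)"
    and R_smult: "i < k \<Longrightarrow> x \<in> carrier (R i) \<Longrightarrow> r \<odot>\<^bsub>R i\<^esub> x \<in> carrier (R i)"
    and R_cj: "i < k \<Longrightarrow> x \<in> carrier (R i) \<Longrightarrow> cj i x \<in> carrier (R i)"
    and R_r_one: "i < k \<Longrightarrow> x \<in> carrier (R i) \<Longrightarrow> x \<otimes>\<^bsub>R i\<^esub> \<one>\<^bsub>R i\<^esub> = x"
    and h_closed: "i < k \<Longrightarrow> x \<in> carrier (R i) \<Longrightarrow> h i x \<in> S"
    and h_zero: "i < k \<Longrightarrow> h i \<zero>\<^bsub>R i\<^esub> = 0"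
    and h_add: "i < k \<Longrightarrow> x \<in> carrier (R i) \<Longrightarrow> y \<in> carrier (R i) \<Longrightarrow> h i (x \<oplus>\<^bsub>R i\<^esub> y) = h i x + h i y"
    and h_smult: "i < k \<Longrightarrow> x \<in> carrier (R i) \<Longrightarrow> h i (r \<odot>\<^bsub>R i\<^esub> x) = of_real r *\<^sub>C h i x"
    and h_mult: "i < k \<Longrightarrow> x \<in> carrier (R i) \<Longrightarrow> y \<in> carrier (R i) \<Longrightarrow> h i (x \<otimes>\<^bsub>R i\<^esub> y) = h i x * h i y"
    and h_orth: "i < k \<Longrightarrow> j < k \<Longrightarrow> i \<noteq> j \<Longrightarrow> x \<in> carrier (R i) \<Longrightarrow> y \<in> carrier (R j) \<Longrightarrow> h i x * h j y = 0"
    and h_star: "i < k \<Longrightarrow> x \<in> carrier (R i) \<Longrightarrow> star (h i x) = h i (cj i x)"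
    and h_form: "i < k \<Longrightarrow> x \<in> carrier (R i) \<Longrightarrow> l (h i x) = T i x"
    and h_inj: "i < k \<Longrightarrow> x \<in> carrier (R i) \<Longrightarrow> y \<in> carrier (R i) \<Longrightarrow> x' \<in> carrier (R i) \<Longrightarrow> y' \<in> carrier (R i) \<Longrightarrow>
      h i x + \<i> *\<^sub>C h i y = h i x' + \<i> *\<^sub>C h i y' \<Longrightarrow> x = x' \<and> y = y'"
begin

abbreviation "CR i \<equiv> complexify (R i)"
abbreviation "CS \<equiv> alg_sum {..<k} (\<lambda>i. complexify (R i))"

definition hc :: "nat \<Rightarrow> 'x \<times> 'x \<Rightarrow> 'r" where
  "hc i = (\<lambda>(x, y). h i x + \<i> *\<^sub>C h i y)"

lemmas R_closed = R_zero R_one R_add R_mult R_smult R_cj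

lemma CR_closed:
  assumes "i < k"
  shows "\<zero>\<^bsub>CR i\<^esub> \<in> carrier (CR i)" "\<one>\<^bsub>CR i\<^esub> \<in> carrier (CR i)"
    "x \<in> carrier (CR i) \<Longrightarrow> y \<in> carrier (CR i) \<Longrightarrow> x \<oplus>\<^bsub>CR i\<^esub> y \<in> carrier (CR i)"
    "x \<in> carrier (CR i) \<Longrightarrow> y \<in> carrier (CR i) \<Longrightarrow> x \<otimes>\<^bsub>CR i\<^esub> y \<in> carrier (CR i)"
    "x \<in> carrier (CR i) \<Longrightarrow> c \<odot>\<^bsub>CR i\<^esub> x \<in> carrier (CR i)"
    "x \<in> carrier (CR i) \<Longrightarrow> extend_map (cj i) x \<in> carrier (CR i)"
  using assms by (auto simp: complexify_def extend_map_def R_closed)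

lemma hc_closed: "i < k \<Longrightarrow> x \<in> carrier (CR i) \<Longrightarrow> hc i x \<in> S"
  by (auto simp: complexify_def hc_def h_closed)

lemma hc_one: "i < k \<Longrightarrow> hc i \<one>\<^bsub>CR i\<^esub> = h i \<one>\<^bsub>R i\<^esub>"
  by (simp add: complexify_def hc_def h_zero)

lemma hc_add: "i < k \<Longrightarrow> x \<in> carrier (CR i) \<Longrightarrow> y \<in> carrier (CR i) \<Longrightarrow> hc i (x \<oplus>\<^bsub>CR i\<^esub> y) = hc i x + hc i y"
  by (auto simp: complexify_def hc_def h_add scale_right_distrib)

lemma hc_mult: "i < k \<Longrightarrow> x \<in> carrier (CR i) \<Longrightarrow> y \<in> carrier (CR i) \<Longrightarrow> hc i (x \<otimes>\<^bsub>CR i\<^esub> y) = hc i x * hc i y"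
  by (auto simp: complexify_def hc_def h_add h_mult h_smult R_closed scale_right_distrib distrib_left distrib_right)

lemma hc_smult:
  assumes i: "i < k" and x: "x \<in> carrier (CR i)"
  shows "hc i (c \<odot>\<^bsub>CR i\<^esub> x) = c *\<^sub>C hc i x"
proof -
  obtain y z where yz: "x = (y, z)" "y \<in> carrier (R i)" "z \<in> carrier (R i)"
    using x by (auto simp: complexify_def)
  have "c *\<^sub>C hc i x = (of_real (Re c) + \<i> * of_real (Im c)) *\<^sub>C hc i x"
    by (simp add: complex_eq[symmetric])
  also have "\<dots> = of_real (Re c) *\<^sub>C h i y + of_real (- Im c) *\<^sub>C h i z +
      (\<i> *\<^sub>C of_real (Re c) *\<^sub>C h i z + \<i> *\<^sub>C of_real (Im c) *\<^sub>C h i y)"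
  proof -
    have "\<i> * of_real (Im c) * \<i> = (of_real (- Im c) :: complex)"
      "of_real (Re c) * \<i> = \<i> * of_real (Re c)" by (simp_all add: complex_eq_iff)
    then show ?thesis
      by (simp only: yz hc_def prod.case distrib_right scale_left_distrib scale_right_distrib scale_scale add_ac)
  qed
  also have "\<dots> = hc i (c \<odot>\<^bsub>CR i\<^esub> x)"
    using i yz by (simp add: complexify_def hc_def h_add h_smult R_closed scale_right_distrib)
  finally show ?thesis by simp
qed

lemma hc_star: "i < k \<Longrightarrow> x \<in> carrier (CR i) \<Longrightarrow> star (hc i x) = hc i (extend_map (cj i) x)"
  by (auto simp: complexify_def hc_def extend_map_def star_add star_scale h_closed h_star)

lemma hc_form: "i < k \<Longrightarrow> x \<in> carrier (CR i) \<Longrightarrow> l (hc i x) = extend_form (T i) x"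
  by (auto simp: complexify_def hc_def extend_form_def l_add l_scale h_closed h_form)

lemma hc_orth: "i < k \<Longrightarrow> j < k \<Longrightarrow> i \<noteq> j \<Longrightarrow> x \<in> carrier (CR i) \<Longrightarrow> y \<in> carrier (CR j) \<Longrightarrow> hc i x * hc j y = 0"
  by (auto simp: complexify_def hc_def distrib_left distrib_right h_orth)

lemma hc_inj: "i < k \<Longrightarrow> x \<in> carrier (CR i) \<Longrightarrow> y \<in> carrier (CR i) \<Longrightarrow> hc i x = hc i y \<Longrightarrow> x = y"
  using h_inj by (auto simp: complexify_def hc_def)

definition H :: "(nat \<Rightarrow> 'x \<times> 'x) \<Rightarrow> 'r" where
  "H xs = (\<Sum>i<k. hc i (xs i))"

lemma CS_component: "xs \<in> carrier CS \<Longrightarrow> i < k \<Longrightarrow> xs i \<in> carrier (CR i)"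
  by (auto simp: alg_sum_def)

lemma CS_closed:
  "\<zero>\<^bsub>CS\<^esub> \<in> carrier CS" "\<one>\<^bsub>CS\<^esub> \<in> carrier CS"
  "xs \<in> carrier CS \<Longrightarrow> ys \<in> carrier CS \<Longrightarrow> xs \<oplus>\<^bsub>CS\<^esub> ys \<in> carrier CS"
  "xs \<in> carrier CS \<Longrightarrow> ys \<in> carrier CS \<Longrightarrow> xs \<otimes>\<^bsub>CS\<^esub> ys \<in> carrier CS"
  "xs \<in> carrier CS \<Longrightarrow> c \<odot>\<^bsub>CS\<^esub> xs \<in> carrier CS"
  "xs \<in> carrier CS \<Longrightarrow> (\<lambda>i\<in>{..<k}. extend_map (cj i) (xs i)) \<in> carrier CS"
  by (auto simp: alg_sum_def CR_closed dest!: PiE_mem)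

lemma H_closed: "xs \<in> carrier CS \<Longrightarrow> H xs \<in> S"
  by (auto simp: H_def CS_component intro!: sum_closed hc_closed)

lemma H_one: "H \<one>\<^bsub>CS\<^esub> = (\<Sum>i<k. h i \<one>\<^bsub>R i\<^esub>)"
  by (auto simp: H_def alg_sum_def hc_one)

lemma H_add: "xs \<in> carrier CS \<Longrightarrow> ys \<in> carrier CS \<Longrightarrow> H (xs \<oplus>\<^bsub>CS\<^esub> ys) = H xs + H ys"
  unfolding H_def sum.distrib[symmetric]
  by (intro sum.cong refl) (auto simp: alg_sum_def hc_add dest!: PiE_mem)

lemma H_smult: "xs \<in> carrier CS \<Longrightarrow> H (c \<odot>\<^bsub>CS\<^esub> xs) = c *\<^sub>C H xs"
  unfolding H_def scale_sum_right
  by (intro sum.cong refl) (auto simp: alg_sum_def hc_smult dest!: PiE_mem)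

lemma H_mult:
  assumes xs: "xs \<in> carrier CS" and ys: "ys \<in> carrier CS"
  shows "H (xs \<otimes>\<^bsub>CS\<^esub> ys) = H xs * H ys"
proof -
  have "H xs * H ys = (\<Sum>i<k. \<Sum>j<k. hc i (xs i) * hc j (ys j))"
    unfolding H_def by (simp only: sum_distrib_right) (simp only: sum_distrib_left)
  also have "\<dots> = (\<Sum>i<k. \<Sum>j<k. if j = i then hc i (xs i \<otimes>\<^bsub>CR i\<^esub> ys i) else 0)"
    by (intro sum.cong refl) (use CS_component[OF xs] CS_component[OF ys] in \<open>auto simp: hc_orth hc_mult\<close>)
  also have "\<dots> = H (xs \<otimes>\<^bsub>CS\<^esub> ys)" by (simp add: H_def alg_sum_def)
  finally show ?thesis by simp
qed

text \<open>By orthogonality, the image of the i-th unit cuts out the i-th summand; injectivity of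
  \<open>H\<close> is thereby reduced to one summand.\<close>

lemma H_component:
  assumes xs: "xs \<in> carrier CS" and i: "i < k"
  shows "H xs * h i \<one>\<^bsub>R i\<^esub> = hc i (xs i)"
proof -
  have "H xs * h i \<one>\<^bsub>R i\<^esub> = (\<Sum>j<k. hc j (xs j) * hc i \<one>\<^bsub>CR i\<^esub>)"
    using i by (simp add: H_def hc_one sum_distrib_right)
  also have "\<dots> = (\<Sum>j<k. if j = i then hc i (xs i) * hc i \<one>\<^bsub>CR i\<^esub> else 0)"
    by (intro sum.cong refl) (use CS_component[OF xs] CR_closed i in \<open>auto simp: hc_orth\<close>)
  also have "\<dots> = hc i (xs i) * h i \<one>\<^bsub>R i\<^esub>" using i by (simp add: hc_one)
  also have "\<dots> = hc i (xs i)"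
    using CS_component[OF xs i] i
    by (auto simp: complexify_def hc_def distrib_right h_mult[symmetric] R_r_one R_one)
  finally show ?thesis .
qed

lemma H_inj:
  assumes xs: "xs \<in> carrier CS" and ys: "ys \<in> carrier CS" and eq: "H xs = H ys"
  shows "xs = ys"
proof -
  have *: "xs i = ys i" if i: "i < k" for i
  proof (rule hc_inj[OF i CS_component[OF xs i] CS_component[OF ys i]])
    show "hc i (xs i) = hc i (ys i)" using H_component xs ys i eq by metis
  qed
  show ?thesis
    by (rule PiE_ext[of _ "{..<k}" "\<lambda>i. carrier (CR i)"]) (use xs ys * in \<open>auto simp: alg_sum_def\<close>)
qed

lemma H_star: "xs \<in> carrier CS \<Longrightarrow> star (H xs) = H (\<lambda>i\<in>{..<k}. extend_map (cj i) (xs i))"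
  unfolding H_def by (subst star_sum) (auto simp: CS_component hc_closed hc_star)

lemma H_form: "xs \<in> carrier CS \<Longrightarrow> l (H xs) = (\<Sum>i<k. extend_form (T i) (xs i))"
  unfolding H_def by (subst l_sum) (auto simp: CS_component hc_closed hc_form)

end

section \<open>The Cardy condition on a block\<close>

lemma center_alg_carrier:
  "carrier (center_alg D) = {p \<in> D. \<forall>q\<in>D. p * q = q * p}"
  by (simp add: center_alg_def division_alg_def ring_center_def)

lemma center_alg_ops [simp]:
  "\<zero>\<^bsub>center_alg D\<^esub> = 0" "\<one>\<^bsub>center_alg D\<^esub> = 1" "p \<oplus>\<^bsub>center_alg D\<^esub> q = p + q"
  "p \<otimes>\<^bsub>center_alg D\<^esub> q = p * q" "r \<odot>\<^bsub>center_alg D\<^esub> p = r *\<^sub>R p"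
  by (simp_all add: center_alg_def division_alg_def)

lemma mat_alg_ops [simp]:
  "\<zero>\<^bsub>mat_alg D n\<^esub> = 0\<^sub>m n n" "\<one>\<^bsub>mat_alg D n\<^esub> = 1\<^sub>m n" "M \<oplus>\<^bsub>mat_alg D n\<^esub> N = M + N"
  "M \<otimes>\<^bsub>mat_alg D n\<^esub> N = M * N" "r \<odot>\<^bsub>mat_alg D n\<^esub> M = map_mat ((*\<^sub>R) r) M"
  by (simp_all add: mat_alg_def)

lemma center_alg_closed:
  assumes "D \<in> real_forms"
  shows "0 \<in> carrier (center_alg D)" "1 \<in> carrier (center_alg D)"
    "p \<in> carrier (center_alg D) \<Longrightarrow> q \<in> carrier (center_alg D) \<Longrightarrow> p + q \<in> carrier (center_alg D)"
    "p \<in> carrier (center_alg D) \<Longrightarrow> q \<in> carrier (center_alg D) \<Longrightarrow> p * q \<in> carrier (center_alg D)"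
    "p \<in> carrier (center_alg D) \<Longrightarrow> r *\<^sub>R p \<in> carrier (center_alg D)"
    "p \<in> carrier (center_alg D) \<Longrightarrow> qcnj p \<in> carrier (center_alg D)"
proof -
  note cl = real_form_closed[OF assms]
  show "qcnj p \<in> carrier (center_alg D)" if "p \<in> carrier (center_alg D)"
  proof -
    have "qcnj p * q = q * qcnj p" if q: "q \<in> D" for q
    proof -
      have "p * qcnj q = qcnj q * p" using \<open>p \<in> carrier _\<close> q cl by (auto simp: center_alg_carrier)
      then have "qcnj (p * qcnj q) = qcnj (qcnj q * p)" by simp
      then show ?thesis by (simp only: qcnj_simps)
    qed
    then show ?thesis using that cl by (auto simp: center_alg_carrier)
  qed
  show "p * q \<in> carrier (center_alg D)" if "p \<in> carrier (center_alg D)" "q \<in> carrier (center_alg D)"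
  proof -
    have "p * q * r = r * (p * q)" if "r \<in> D" for r
    proof -
      have "p * r = r * p" "q * r = r * q"
        using \<open>p \<in> carrier _\<close> \<open>q \<in> carrier _\<close> that by (auto simp: center_alg_carrier)
      then show ?thesis by (metis mult.assoc)
    qed
    moreover have "p * q \<in> D"
      using \<open>p \<in> carrier _\<close> \<open>q \<in> carrier _\<close> by (intro cl(4)) (simp_all only: center_alg_carrier mem_Collect_eq)
    ultimately show ?thesis unfolding center_alg_carrier by blast
  qed
qed (use real_form_closed[OF assms] in \<open>auto simp: center_alg_carrier distrib_left distrib_right\<close>)

text \<open>Here \<open>pd\<close> is the map dual to \<open>phi\<close>, and \<open>K\<close> the element \<open>K\<^sup>\<star>\<close> of \<open>B\<close>.  The Cardy condition
  is stated through finite-rank presentations of the operator \<open>b \<mapsto> b' b b''\<close>, which makes the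
  trace independent of bases; likewise the Casimir element behind \<open>K\<^sup>\<star>\<close>.\<close>

locale cardy_frobenius_data =
  A: involutive_frobenius scale SA unitA lA starA + B: involutive_frobenius scale SB unitB lB starB
  for scale :: "complex \<Rightarrow> 'r::ring \<Rightarrow> 'r" (infixr "*\<^sub>C" 75)
    and SA unitA lA starA SB unitB lB starB +
  fixes phi pd :: "'r \<Rightarrow> 'r" and U K :: 'r
  assumes phi_closed: "a \<in> SA \<Longrightarrow> phi a \<in> SB"
    and phi_add: "a \<in> SA \<Longrightarrow> a' \<in> SA \<Longrightarrow> phi (a + a') = phi a + phi a'"
    and phi_scale: "a \<in> SA \<Longrightarrow> phi (c *\<^sub>C a) = c *\<^sub>C phi a"
    and phi_mult: "a \<in> SA \<Longrightarrow> a' \<in> SA \<Longrightarrow> phi (a * a') = phi a * phi a'"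
    and phi_unit: "phi unitA = unitB"
    and phi_central: "a \<in> SA \<Longrightarrow> b \<in> SB \<Longrightarrow> phi a * b = b * phi a"
    and phi_star: "a \<in> SA \<Longrightarrow> phi (starA a) = starB (phi a)"
    and A_comm: "a \<in> SA \<Longrightarrow> a' \<in> SA \<Longrightarrow> a * a' = a' * a"
    and pd_closed: "b \<in> SB \<Longrightarrow> pd b \<in> SA"
    and pd_dual: "b \<in> SB \<Longrightarrow> a \<in> SA \<Longrightarrow> lA (pd b * a) = lB (b * phi a)"
    and cardy: "b' \<in> SB \<Longrightarrow> b'' \<in> SB \<Longrightarrow> (\<And>i. i < (N::nat) \<Longrightarrow> w i \<in> SB \<and> y i \<in> SB) \<Longrightarrow>
      (\<And>b. b \<in> SB \<Longrightarrow> b' * b * b'' = (\<Sum>i<N. lB (b * w i) *\<^sub>C y i)) \<Longrightarrow>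
      lA (pd b' * pd b'') = (\<Sum>i<N. lB (y i * w i))"
    and casimir: "z \<in> SB \<Longrightarrow> (\<And>i. i < (N::nat) \<Longrightarrow> w i \<in> SB \<and> y i \<in> SB) \<Longrightarrow>
      (\<And>b. b \<in> SB \<Longrightarrow> z * b = (\<Sum>i<N. lB (b * w i) *\<^sub>C y i)) \<Longrightarrow>
      K * starB z = (\<Sum>i<N. w i * starB (y i))"
    and U_closed: "U \<in> SA"
    and phi_U: "phi U = K"
    and K_closed: "K \<in> SB"
begin

text \<open>The assumption \<open>cardy\<close> uses the index sets {..<N}, because a locale
  assumption fixes its types. Blocks index their dual bases by tuples of positions and quaternion
  units, so a version for arbitrary finite index sets is derived.\<close>

lemma cardy_finite:
  assumes I: "finite I" and b: "b' \<in> SB" "b'' \<in> SB"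
    and wy: "\<And>i. i \<in> I \<Longrightarrow> w i \<in> SB \<and> y i \<in> SB"
    and eq: "\<And>b. b \<in> SB \<Longrightarrow> b' * b * b'' = (\<Sum>i\<in>I. lB (b * w i) *\<^sub>C y i)"
  shows "lA (pd b' * pd b'') = (\<Sum>i\<in>I. lB (y i * w i))"
proof -
  obtain f where f: "bij_betw f {..<card I} I"
    using ex_bij_betw_nat_finite[OF I] by (auto simp: lessThan_atLeast0)
  have fI: "f j \<in> I" if "j < card I" for j using f that by (auto simp: bij_betw_def)
  have "lA (pd b' * pd b'') = (\<Sum>j<card I. lB (y (f j) * w (f j)))"
    by (rule cardy[OF b])
      (use fI wy eq in \<open>auto simp: sum.reindex_bij_betw[OF f, of "\<lambda>i. lB (b * w i) *\<^sub>C y i" for b]\<close>)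
  then show ?thesis by (simp add: sum.reindex_bij_betw[OF f, of "\<lambda>i. lB (y i * w i)"])
qed

lemma casimir_finite:
  assumes I: "finite I" and z: "z \<in> SB"
    and wy: "\<And>i. i \<in> I \<Longrightarrow> w i \<in> SB \<and> y i \<in> SB"
    and eq: "\<And>b. b \<in> SB \<Longrightarrow> z * b = (\<Sum>i\<in>I. lB (b * w i) *\<^sub>C y i)"
  shows "K * starB z = (\<Sum>i\<in>I. w i * starB (y i))"
proof -
  obtain f where f: "bij_betw f {..<card I} I"
    using ex_bij_betw_nat_finite[OF I] by (auto simp: lessThan_atLeast0)
  have fI: "f j \<in> I" if "j < card I" for j using f that by (auto simp: bij_betw_def)
  have "K * starB z = (\<Sum>j<card I. w (f j) * starB (y (f j)))"
    by (rule casimir[OF z])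
      (use fI wy eq in \<open>auto simp: sum.reindex_bij_betw[OF f, of "\<lambda>i. lB (b * w i) *\<^sub>C y i" for b]\<close>)
  then show ?thesis by (simp add: sum.reindex_bij_betw[OF f, of "\<lambda>i. w i * starB (y i)"])
qed

lemma pd_eqI:
  assumes "b \<in> SB" "x \<in> SA" "\<And>a. a \<in> SA \<Longrightarrow> lA (x * a) = lB (b * phi a)"
  shows "pd b = x"
proof -
  have "pd b - x = 0"
    by (rule A.l_nondegenerate)
      (use assms pd_closed in \<open>auto simp: left_diff_distrib A.l_diff pd_dual\<close>)
  then show ?thesis by simp
qed

lemma pd_add: "b \<in> SB \<Longrightarrow> b' \<in> SB \<Longrightarrow> pd (b + b') = pd b + pd b'"
  by (rule pd_eqI) (auto simp: pd_closed distrib_right A.l_add B.l_add pd_dual phi_closed)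

lemma pd_scale: "b \<in> SB \<Longrightarrow> pd (c *\<^sub>C b) = c *\<^sub>C pd b"
  by (rule pd_eqI) (auto simp: pd_closed A.l_scale B.l_scale pd_dual phi_closed)

lemma pd_zero: "pd 0 = 0"
  using pd_scale[of 0 0] by simp

text \<open>B is an A-module through \<open>phi\<close>, with central action, and the adjoint of
  \<open>phi\<close> is A-linear for it.\<close>

lemma pd_phi: "a \<in> SA \<Longrightarrow> b \<in> SB \<Longrightarrow> pd (phi a * b) = a * pd b"
proof (rule pd_eqI)
  fix a' assume a: "a \<in> SA" "b \<in> SB" "a' \<in> SA"
  have "a * pd b * a' = pd b * (a * a')" using a A_comm pd_closed by (metis mult.assoc)
  then have "lA (a * pd b * a') = lB (b * (phi a * phi a'))"
    using a by (simp add: pd_dual phi_mult)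
  also have "b * (phi a * phi a') = phi a * b * phi a'"
    using a phi_central by (metis mult.assoc)
  finally show "lA (a * pd b * a') = lB (phi a * b * phi a')" .
qed (auto simp: pd_closed phi_closed)

text \<open>Both forms are \<open>star\<close>-invariant and \<open>phi\<close> respects
  \<open>star\<close>, so its adjoint does too.\<close>

lemma pd_star: "b \<in> SB \<Longrightarrow> pd (starB b) = starA (pd b)"
proof (rule pd_eqI)
  fix a assume a: "b \<in> SB" "a \<in> SA"
  have "lA (starA (pd b) * a) = lA (starA (starA a * pd b))"
    using a pd_closed by (simp add: A.star_mult)
  also have "\<dots> = lA (pd b * starA a)" using a pd_closed A_comm by simp
  also have "\<dots> = lB (b * starB (phi a))" using a by (simp add: pd_dual phi_star)
  also have "\<dots> = lB (starB (b * starB (phi a)))" using a phi_closed by simp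
  also have "\<dots> = lB (starB b * phi a)"
    using a phi_closed by (simp add: B.star_mult B.l_commute)
  finally show "lA (starA (pd b) * a) = lB (starB b * phi a)" .
qed (auto simp: pd_closed)

end

section \<open>One block of B and the copy of its centre in A\<close>

locale cardy_block = cardy_frobenius_data scale SA unitA lA starA SB unitB lB starB phi pd U K +
  Q: block scale SB unitB lB starB D n \<mu> \<Gamma>
  for scale :: "complex \<Rightarrow> 'r::ring \<Rightarrow> 'r" (infixr "*\<^sub>C" 75)
    and SA unitA lA starA SB unitB lB starB phi pd U K D n \<mu> \<Gamma>
begin

abbreviation "d \<equiv> card (qbasis D)"
abbreviation "ZD \<equiv> carrier (center_alg D)"

text \<open>The factor \<mu> / d inverts the constant of \<open>phi_pd\<close>, so that
  \<open>phi (\<alpha> p)\<close> is the scalar matrix p. The index 0 exists because n is at least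
  1.\<close>

definition \<alpha> :: "quat \<Rightarrow> 'r" where
  "\<alpha> p = (\<mu> / of_nat d) *\<^sub>C pd (\<Gamma> 0 0 p)"

definition Gd :: "quat \<Rightarrow> 'r" where
  "Gd p = (\<Sum>a<n. \<Gamma> a a p)"

lemma n0: "0 < n" using Q.n by simp

lemma d_pos: "d > 0"
proof -
  have "1 \<in> qbasis D" using Q.D_closed by (simp add: qbasis_def)
  then show ?thesis by (auto simp: card_gt_0_iff)
qed

lemma qbasis_nonempty: "qbasis D \<noteq> {}"
  using d_pos by auto

lemma ZD_D: "p \<in> ZD \<Longrightarrow> p \<in> D"
  by (simp add: center_alg_carrier)

lemmas ZD_closed = center_alg_closed[OF Q.D]

lemma Gd_closed: "p \<in> D \<Longrightarrow> Gd p \<in> SB"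
  by (auto simp: Gd_def Q.G_closed)

lemma \<alpha>_closed: "p \<in> D \<Longrightarrow> \<alpha> p \<in> SA"
  by (auto simp: \<alpha>_def n0 Q.G_closed pd_closed)

lemma Gd_G: "p \<in> D \<Longrightarrow> q \<in> D \<Longrightarrow> Gd p * \<Gamma> 0 0 q = \<Gamma> 0 0 (p * q)"
  using n0 by (simp add: Gd_def sum_distrib_right Q.G_mult)

text \<open>Write g = \<Gamma>_00(p). For every b', duality and the Cardy condition give l_B (b' phi
  (pd g)) = (pd b', pd g)_A = Tr (b |-> b' b g). In the dual bases of the block this trace is 1 /
  \<mu> times the sum of l_B (b' \<Gamma>_aa(conj(q) p q)) over a and q, and for central p the sum
  over q is d p. Non-degeneracy then removes b'.\<close>

lemma phi_pd:
  assumes p: "p \<in> ZD"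
  shows "phi (pd (\<Gamma> 0 0 p)) = (of_nat d / \<mu>) *\<^sub>C Gd p"
proof -
  have pD: "p \<in> D" using ZD_D p .
  define g where "g = \<Gamma> 0 0 p"
  have g: "g \<in> SB" using n0 pD by (simp add: g_def Q.G_closed)
  have "phi (pd g) - (of_nat d / \<mu>) *\<^sub>C Gd p = 0"
  proof (rule B.l_nondegenerate)
    show "phi (pd g) - (of_nat d / \<mu>) *\<^sub>C Gd p \<in> SB"
      using g pD by (auto simp: phi_closed pd_closed Gd_closed)
    fix b' assume b': "b' \<in> SB"
    \<comment> \<open>A finite-rank presentation of b |-> b' b g, as the Cardy assumption requires:
      the functionals are l_B (b w_i), the vectors are y_i.\<close>
    define w where "w i = \<Gamma> 0 (fst i) (snd i)" for i :: "nat \<times> quat"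
    define y where "y i = (1 / \<mu>) *\<^sub>C (b' * \<Gamma> (fst i) 0 (qcnj (snd i) * p))" for i :: "nat \<times> quat"
    define I where "I = {..<n} \<times> qbasis D"
    have wy: "w i \<in> SB \<and> y i \<in> SB" if "i \<in> I" for i
      using that n0 b' pD qbasis_mem[of _ D] Q.D_closed by (auto simp: I_def w_def y_def Q.G_closed)
    have D1: "qcnj q * p * q \<in> D" if "q \<in> qbasis D" for q
      by (intro Q.D_closed(4,6) qbasis_mem[OF that] pD)
    \<comment> \<open>Since z g = g and z is central, b may be replaced by z b and expanded in dual
      bases; right multiplication by g leaves only the first index c = 0.\<close>
    have bg: "b * g = (\<Sum>a<n. \<Sum>q\<in>qbasis D. lB (b * \<Gamma> 0 a q) *\<^sub>C (1 / \<mu>) *\<^sub>C \<Gamma> a 0 (qcnj q * p))"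
      if b: "b \<in> SB" for b
    proof -
      have "b * g = b * (Q.z * g)" using Q.z_G[OF n0 n0 pD] by (simp add: g_def)
      also have "\<dots> = (Q.z * b) * g"
        using Q.z_central[OF b] by (simp add: block_unit_def[symmetric] mult.assoc)
      also have "\<dots> = (\<Sum>c<n. \<Sum>a<n. \<Sum>q\<in>qbasis D. lB (b * \<Gamma> c a q) *\<^sub>C (1 / \<mu>) *\<^sub>C (\<Gamma> a c (qcnj q) * g))"
        unfolding Q.block_expansion[OF b] by (simp add: sum_distrib_right)
      also have "\<dots> = (\<Sum>c<n. if c = 0 then \<Sum>a<n. \<Sum>q\<in>qbasis D.
          lB (b * \<Gamma> 0 a q) *\<^sub>C (1 / \<mu>) *\<^sub>C \<Gamma> a 0 (qcnj q * p) else 0)"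
        by (intro sum.cong refl)
          (use n0 pD qbasis_mem[of _ D] Q.D_closed in \<open>auto simp: g_def Q.G_mult\<close>)
      also have "\<dots> = (\<Sum>a<n. \<Sum>q\<in>qbasis D. lB (b * \<Gamma> 0 a q) *\<^sub>C (1 / \<mu>) *\<^sub>C \<Gamma> a 0 (qcnj q * p))"
        using n0 by simp
      finally show ?thesis .
    qed
    have "b' * b * g = (\<Sum>i\<in>I. lB (b * w i) *\<^sub>C y i)" if b: "b \<in> SB" for b
    proof -
      have "b' * b * g = (\<Sum>a<n. \<Sum>q\<in>qbasis D. lB (b * \<Gamma> 0 a q) *\<^sub>C (1 / \<mu>) *\<^sub>C (b' * \<Gamma> a 0 (qcnj q * p)))"
        unfolding mult.assoc bg[OF b] by (simp add: sum_distrib_left)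
      then show ?thesis
        by (simp add: I_def w_def y_def sum.cartesian_product case_prod_beta)
    qed
    then have "lA (pd b' * pd g) = (\<Sum>i\<in>I. lB (y i * w i))"
      by (intro cardy_finite) (use wy b' g in \<open>auto simp: I_def\<close>)
    also have "\<dots> = (\<Sum>a<n. \<Sum>q\<in>qbasis D. (1 / \<mu>) * lB (b' * \<Gamma> a a (qcnj q * p * q)))"
      unfolding I_def sum.cartesian_product
      by (intro sum.cong refl)
        (use n0 b' pD qbasis_mem[of _ D] Q.D_closed in
          \<open>auto simp: w_def y_def mult.assoc Q.G_mult B.l_scale Q.G_closed\<close>)
    also have "\<dots> = (\<Sum>a<n. (1 / \<mu>) * lB (b' * \<Gamma> a a (\<Sum>q\<in>qbasis D. qcnj q * p * q)))"
    proof (rule sum.cong[OF refl])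
      fix a assume "a \<in> {..<n}"
      then have a: "a < n" by simp
      have "b' * \<Gamma> a a (\<Sum>q\<in>qbasis D. qcnj q * p * q) = (\<Sum>q\<in>qbasis D. b' * \<Gamma> a a (qcnj q * p * q))"
        by (simp only: Q.G_sum[OF a a D1] sum_distrib_left)
      also have "lB \<dots> = (\<Sum>q\<in>qbasis D. lB (b' * \<Gamma> a a (qcnj q * p * q)))"
        by (rule B.l_sum) (intro B.mult_closed b' Q.G_closed a D1)
      finally show "(\<Sum>q\<in>qbasis D. (1 / \<mu>) * lB (b' * \<Gamma> a a (qcnj q * p * q))) =
          (1 / \<mu>) * lB (b' * \<Gamma> a a (\<Sum>q\<in>qbasis D. qcnj q * p * q))"
        by (simp only: sum_distrib_left)
    qed
    also have "\<dots> = (1 / \<mu>) * (\<Sum>a<n. lB (b' * \<Gamma> a a (\<Sum>q\<in>qbasis D. qcnj q * p * q)))"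
      by (rule sum_distrib_left[symmetric])
    also have "(\<Sum>a<n. lB (b' * \<Gamma> a a (\<Sum>q\<in>qbasis D. qcnj q * p * q))) =
        lB (b' * (\<Sum>a<n. \<Gamma> a a (\<Sum>q\<in>qbasis D. qcnj q * p * q)))"
      unfolding sum_distrib_left
      by (rule B.l_sum[symmetric]) (simp add: b' Q.G_closed Q.D_sum[OF D1])
    also have "(\<Sum>q\<in>qbasis D. qcnj q * p * q) = real d *\<^sub>R p"
      by (rule qbasis_sandwich_sum[OF Q.D pD]) (use p in \<open>auto simp: center_alg_carrier\<close>)
    also have "(\<Sum>a<n. \<Gamma> a a (real d *\<^sub>R p)) = of_nat d *\<^sub>C Gd p"
      using pD by (simp add: Gd_def Q.G_scale A.scale_sum_right)
    finally have "lA (pd b' * pd g) = (of_nat d / \<mu>) * lB (b' * Gd p)"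
      using b' pD by (simp add: B.l_scale Gd_closed)
    moreover have "lA (pd b' * pd g) = lB (b' * phi (pd g))"
      using b' g by (simp add: pd_dual pd_closed)
    ultimately have "lB (b' * phi (pd g)) = lB (b' * (of_nat d / \<mu>) *\<^sub>C Gd p)"
      using b' pD by (simp add: B.l_scale Gd_closed)
    then have "lB (b' * (phi (pd g) - (of_nat d / \<mu>) *\<^sub>C Gd p)) = 0"
      using b' g pD by (simp add: right_diff_distrib B.l_diff phi_closed pd_closed Gd_closed)
    moreover have "lB ((phi (pd g) - (of_nat d / \<mu>) *\<^sub>C Gd p) * b') =
        lB (b' * (phi (pd g) - (of_nat d / \<mu>) *\<^sub>C Gd p))"
      by (rule B.l_commute) (use b' g pD in \<open>auto simp: phi_closed pd_closed Gd_closed\<close>)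
    ultimately show "lB ((phi (pd g) - (of_nat d / \<mu>) *\<^sub>C Gd p) * b') = 0" by simp
  qed
  then show ?thesis by (simp add: g_def)
qed

lemma phi_\<alpha>: "p \<in> ZD \<Longrightarrow> phi (\<alpha> p) = Gd p"
  using qbasis_nonempty Q.mu n0 ZD_D[of p] by (simp add: \<alpha>_def phi_scale pd_closed Q.G_closed phi_pd)

text \<open>A product with \<open>\<alpha> p\<close> depends only on \<open>phi a\<close>. This one
  identity gives multiplicativity, orthogonality of different blocks, vanishing on the kernel and
  the action of \<open>U\<close>.\<close>

lemma \<alpha>_left_mult: "a \<in> SA \<Longrightarrow> p \<in> D \<Longrightarrow> a * \<alpha> p = (\<mu> / of_nat d) *\<^sub>C pd (phi a * \<Gamma> 0 0 p)"
  using n0 by (simp add: \<alpha>_def pd_phi Q.G_closed)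

lemma \<alpha>_mult: "p \<in> ZD \<Longrightarrow> q \<in> ZD \<Longrightarrow> \<alpha> p * \<alpha> q = \<alpha> (p * q)"
  using \<alpha>_left_mult[of "\<alpha> p" q] by (simp add: \<alpha>_closed ZD_D phi_\<alpha> Gd_G) (simp add: \<alpha>_def)

lemma \<alpha>_zero: "\<alpha> 0 = 0"
  using n0 by (simp add: \<alpha>_def Q.G_zero pd_zero)

lemma \<alpha>_add: "p \<in> D \<Longrightarrow> q \<in> D \<Longrightarrow> \<alpha> (p + q) = \<alpha> p + \<alpha> q"
  using n0 by (simp add: \<alpha>_def Q.G_add Q.G_closed pd_add A.scale_right_distrib)

lemma \<alpha>_scale: "p \<in> D \<Longrightarrow> \<alpha> (r *\<^sub>R p) = of_real r *\<^sub>C \<alpha> p"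
  using n0 by (simp add: \<alpha>_def Q.G_scale Q.G_closed pd_scale mult.commute)

lemma \<alpha>_star: "p \<in> D \<Longrightarrow> starA (\<alpha> p) = \<alpha> (qcnj p)"
  using n0 by (simp add: \<alpha>_def A.star_scale pd_closed Q.G_closed pd_star[symmetric] Q.G_star)

text \<open>Writing \<alpha>(p) = \<alpha>(1) \<alpha>(p) and applying duality to the first factor
  gives (\<mu> / d) l_B (\<Gamma>_00(1) Gd(p)) = (\<mu> / d) \<mu> Re p.\<close>

lemma \<alpha>_form:
  assumes p: "p \<in> ZD"
  shows "lA (\<alpha> p) = \<mu>\<^sup>2 * of_real (QRe p) / of_nat d"
proof -
  have pD: "p \<in> D" using ZD_D p .
  have G: "\<Gamma> 0 0 1 \<in> SB" "\<Gamma> 0 0 p \<in> SB" using n0 pD Q.D_closed by (auto simp: Q.G_closed)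
  have "lA (\<alpha> p) = lA (\<alpha> 1 * \<alpha> p)" using p ZD_closed by (simp add: \<alpha>_mult)
  also have "\<dots> = (\<mu> / of_nat d) * lA (pd (\<Gamma> 0 0 1) * \<alpha> p)"
    using G pD by (simp add: \<alpha>_def A.l_scale pd_closed)
  also have "lA (pd (\<Gamma> 0 0 1) * \<alpha> p) = lB (\<Gamma> 0 0 1 * Gd p)"
    using G p pD by (simp add: pd_dual \<alpha>_closed phi_\<alpha>)
  also have "\<dots> = lB (Gd p * \<Gamma> 0 0 1)" using G pD by (intro B.l_commute) (auto simp: Gd_closed)
  also have "\<dots> = \<mu> * of_real (QRe p)" using pD Q.D_closed n0 by (simp add: Gd_G Q.G_form)
  finally show ?thesis by (simp add: power2_eq_square)
qed

lemma \<alpha>_ker: "a \<in> SA \<Longrightarrow> phi a = 0 \<Longrightarrow> p \<in> D \<Longrightarrow> a * \<alpha> p = 0"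
  using \<alpha>_left_mult[of a p] by (simp add: pd_zero)

lemma \<alpha>_inj:
  assumes "p \<in> ZD" "q \<in> ZD" "p' \<in> ZD" "q' \<in> ZD"
    and eq: "\<alpha> p + \<i> *\<^sub>C \<alpha> q = \<alpha> p' + \<i> *\<^sub>C \<alpha> q'"
  shows "p = p' \<and> q = q'"
proof -
  have pa: "phi (\<alpha> p + \<i> *\<^sub>C \<alpha> q) * \<Gamma> 0 0 1 = \<Gamma> 0 0 p + \<i> *\<^sub>C \<Gamma> 0 0 q" if "p \<in> ZD" "q \<in> ZD" for p q
    using that Q.D_closed by (simp add: phi_add phi_scale \<alpha>_closed ZD_D phi_\<alpha> distrib_right Gd_G)
  have "\<Gamma> 0 0 p + \<i> *\<^sub>C \<Gamma> 0 0 q = \<Gamma> 0 0 p' + \<i> *\<^sub>C \<Gamma> 0 0 q'"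
    using eq pa assms by metis
  then show ?thesis by (rule Q.G_inj[OF n0 n0, rotated -1]) (use assms ZD_D in auto)
qed

text \<open>With the dual bases \<Gamma>_ab(q) and \<Gamma>_ba(conj q) / \<mu>, the element is 1 /
  \<mu> times the sum of \<Gamma>_ab(q) \<Gamma>_ab(q), because \<open>star\<close> turns the second
  factor back into the first. Only a = b survives, so no factor n appears and each diagonal place
  receives the sum of q q.\<close>

lemma Casimir_block: "K * Q.z = ((2 - of_nat d) / \<mu>) *\<^sub>C Q.z"
proof -
  define w where "w i = \<Gamma> (fst i) (fst (snd i)) (snd (snd i))" for i :: "nat \<times> nat \<times> quat"
  define y where "y i = (1 / \<mu>) *\<^sub>C \<Gamma> (fst (snd i)) (fst i) (qcnj (snd (snd i)))" for i :: "nat \<times> nat \<times> quat"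
  define I where "I = {..<n} \<times> {..<n} \<times> qbasis D"
  have "K * starB Q.z = (\<Sum>i\<in>I. w i * starB (y i))"
  proof (rule casimir_finite)
    show "finite I" by (simp add: I_def)
    show "w i \<in> SB \<and> y i \<in> SB" if "i \<in> I" for i
      using that qbasis_mem[of _ D] Q.D_closed by (auto simp: I_def w_def y_def Q.G_closed)
    show "Q.z * b = (\<Sum>i\<in>I. lB (b * w i) *\<^sub>C y i)" if "b \<in> SB" for b
      unfolding Q.block_expansion[OF that]
      by (simp add: I_def w_def y_def sum.cartesian_product case_prod_beta)
  qed simp
  also have "\<dots> = (\<Sum>a<n. \<Sum>b<n. \<Sum>q\<in>qbasis D. \<Gamma> a b q * starB ((1 / \<mu>) *\<^sub>C \<Gamma> b a (qcnj q)))"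
    by (simp add: I_def w_def y_def sum.cartesian_product case_prod_beta)
  also have "\<dots> = (\<Sum>a<n. \<Sum>b<n. \<Sum>q\<in>qbasis D. if b = a then (1 / \<mu>) *\<^sub>C \<Gamma> a a (q * q) else 0)"
    by (intro sum.cong refl)
      (use qbasis_mem[of _ D] Q.D_closed in \<open>auto simp: B.star_scale Q.G_closed Q.G_star Q.G_mult\<close>)
  also have "\<dots> = (\<Sum>a<n. \<Sum>b<n. if b = a then (1 / \<mu>) *\<^sub>C (\<Sum>q\<in>qbasis D. \<Gamma> a a (q * q)) else 0)"
    by (intro sum.cong refl) (auto simp: A.scale_sum_right)
  also have "\<dots> = (\<Sum>a<n. (1 / \<mu>) *\<^sub>C (\<Sum>q\<in>qbasis D. \<Gamma> a a (q * q)))" by simp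
  also have "\<dots> = (\<Sum>a<n. ((2 - of_nat d) / \<mu>) *\<^sub>C \<Gamma> a a 1)"
  proof (intro sum.cong refl)
    fix a assume "a \<in> {..<n}"
    then have a: "a < n" by simp
    have "(\<Sum>q\<in>qbasis D. \<Gamma> a a (q * q)) = \<Gamma> a a (\<Sum>q\<in>qbasis D. q * q)"
      using a qbasis_mem[of _ D] Q.D_closed by (subst Q.G_sum) auto
    also have "\<dots> = of_real (2 - real d) *\<^sub>C \<Gamma> a a 1"
      using a Q.D_closed unfolding qbasis_square_sum[OF Q.D] by (subst Q.G_scale) auto
    finally show "(1 / \<mu>) *\<^sub>C (\<Sum>q\<in>qbasis D. \<Gamma> a a (q * q)) = ((2 - of_nat d) / \<mu>) *\<^sub>C \<Gamma> a a 1"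
      by simp
  qed
  also have "\<dots> = ((2 - of_nat d) / \<mu>) *\<^sub>C Q.z" by (simp add: block_unit_def A.scale_sum_right)
  finally show ?thesis by (simp add: Q.star_z)
qed

lemma \<alpha>_U: "\<alpha> 1 * U = ((2 - of_nat d) / \<mu>) *\<^sub>C \<alpha> 1"
proof -
  have D1: "1 \<in> D" using Q.D_closed by simp
  have G: "\<Gamma> 0 0 1 \<in> SB" using n0 D1 by (simp add: Q.G_closed)
  have "K * \<Gamma> 0 0 1 = (K * Q.z) * \<Gamma> 0 0 1"
    using Q.z_G[OF n0 n0 D1] by (simp add: mult.assoc)
  also have "\<dots> = ((2 - of_nat d) / \<mu>) *\<^sub>C \<Gamma> 0 0 1"
    unfolding Casimir_block using Q.z_G[OF n0 n0 D1] by simp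
  finally have KG: "K * \<Gamma> 0 0 1 = ((2 - of_nat d) / \<mu>) *\<^sub>C \<Gamma> 0 0 1" .
  have "\<alpha> 1 * U = U * \<alpha> 1" using A_comm U_closed \<alpha>_closed D1 by simp
  also have "\<dots> = (\<mu> / of_nat d) *\<^sub>C pd (K * \<Gamma> 0 0 1)"
    using \<alpha>_left_mult[OF U_closed D1] phi_U by simp
  also have "\<dots> = ((2 - of_nat d) / \<mu>) *\<^sub>C \<alpha> 1"
    unfolding KG using G by (simp add: pd_scale \<alpha>_def mult.commute)
  finally show ?thesis .
qed

text \<open>A central element of the block commutes with the matrix units, so it is scalar with entries
  in the centre of \<open>D \<otimes> \<complex>\<close>.\<close>

lemma central_span:
  assumes a: "a \<in> SA"
  shows "\<exists>p\<in>ZD. \<exists>q\<in>ZD. phi a * Q.z = Gd p + \<i> *\<^sub>C Gd q"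
proof -
  define c where "c = phi a"
  have c: "c \<in> SB" "\<And>b. b \<in> SB \<Longrightarrow> c * b = b * c"
    using a by (auto simp: c_def phi_closed phi_central)
  obtain M N where MN: "M \<in> Q.matD" "N \<in> Q.matD" "c * Q.z = Q.gm M + \<i> *\<^sub>C Q.gm N"
    using Q.gm_span[OF c(1)] by blast
  define p q where "p = M $$ (0, 0)" and "q = N $$ (0, 0)"
  have pq: "p \<in> D" "q \<in> D" using MN n0 by (auto simp: p_def q_def Q.matD_iff)
  have D1: "1 \<in> D" using Q.D_closed by simp
  have G: "\<Gamma> a b r \<in> SB" if "a < n" "b < n" "r \<in> D" for a b r using Q.G_closed that .
  have cG: "c * \<Gamma> 0 0 1 = \<Gamma> 0 0 p + \<i> *\<^sub>C \<Gamma> 0 0 q"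
  proof -
    have "\<Gamma> 0 0 1 * (c * Q.z) * \<Gamma> 0 0 1 = \<Gamma> 0 0 p + \<i> *\<^sub>C \<Gamma> 0 0 q"
      unfolding MN(3) using MN n0 by (simp add: distrib_left distrib_right Q.G_gm_G p_def q_def)
    moreover have "\<Gamma> 0 0 1 * (c * Q.z) * \<Gamma> 0 0 1 = c * (\<Gamma> 0 0 1 * (Q.z * \<Gamma> 0 0 1))"
      using c(2)[OF G[OF n0 n0 D1]] by (metis mult.assoc)
    ultimately show ?thesis using Q.z_G[OF n0 n0 D1] Q.G_mult[OF n0 n0 n0 n0 D1 D1] by simp
  qed
  have cz: "c * Q.z = Gd p + \<i> *\<^sub>C Gd q"
  proof -
    \<comment> \<open>Conjugation by the units at (a, 0) and (0, a) carries the computation from the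
      corner 0 to the corner a, since c is central.\<close>
    have "c * \<Gamma> a a 1 = \<Gamma> a a p + \<i> *\<^sub>C \<Gamma> a a q" if a: "a < n" for a
    proof -
      have "c * \<Gamma> a a 1 = c * (\<Gamma> a 0 1 * \<Gamma> 0 a 1)"
        using a n0 D1 by (simp add: Q.G_mult)
      also have "\<dots> = \<Gamma> a 0 1 * c * (\<Gamma> 0 0 1 * \<Gamma> 0 a 1)"
      proof -
        have "c * (\<Gamma> a 0 1 * \<Gamma> 0 a 1) = \<Gamma> a 0 1 * c * \<Gamma> 0 a 1"
          using c(2)[OF G[OF a n0 D1]] by (simp add: mult.assoc[symmetric])
        then show ?thesis using Q.G_mult[OF n0 n0 n0 a D1 D1] by simp
      qed
      also have "\<dots> = \<Gamma> a 0 1 * (c * \<Gamma> 0 0 1) * \<Gamma> 0 a 1" by (simp add: mult.assoc)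
      also have "\<dots> = \<Gamma> a a p + \<i> *\<^sub>C \<Gamma> a a q"
        unfolding cG using a n0 D1 pq by (simp add: distrib_left distrib_right Q.G_mult)
      finally show ?thesis .
    qed
    then have "c * Q.z = (\<Sum>a<n. \<Gamma> a a p + \<i> *\<^sub>C \<Gamma> a a q)"
      by (simp add: block_unit_def sum_distrib_left)
    then show ?thesis by (simp add: Gd_def sum.distrib A.scale_sum_right)
  qed
  have "p * r = r * p \<and> q * r = r * q" if r: "r \<in> D" for r
  proof (rule Q.G_inj[OF n0 n0])
    have "(c * \<Gamma> 0 0 1) * \<Gamma> 0 0 r = \<Gamma> 0 0 r * (c * \<Gamma> 0 0 1)"
    proof -
      have "(c * \<Gamma> 0 0 1) * \<Gamma> 0 0 r = c * (\<Gamma> 0 0 r * \<Gamma> 0 0 1)"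
        using n0 r D1 by (simp add: mult.assoc Q.G_mult)
      also have "\<dots> = (c * \<Gamma> 0 0 r) * \<Gamma> 0 0 1" by (simp add: mult.assoc)
      also have "\<dots> = \<Gamma> 0 0 r * (c * \<Gamma> 0 0 1)"
        using c(2)[OF G[OF n0 n0 r]] by (simp add: mult.assoc)
      finally show ?thesis .
    qed
    then show "\<Gamma> 0 0 (p * r) + \<i> *\<^sub>C \<Gamma> 0 0 (q * r) = \<Gamma> 0 0 (r * p) + \<i> *\<^sub>C \<Gamma> 0 0 (r * q)"
      unfolding cG using n0 pq r by (simp add: distrib_left distrib_right Q.G_mult)
  qed (use pq r Q.D_closed in auto)
  then have "p \<in> ZD" "q \<in> ZD" using pq by (auto simp: center_alg_carrier)
  then show ?thesis using cz unfolding c_def by blast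
qed

lemma gm_scalar: "p \<in> ZD \<Longrightarrow> p \<cdot>\<^sub>m 1\<^sub>m n \<in> Q.matD \<and> Q.gm (p \<cdot>\<^sub>m 1\<^sub>m n) = Gd p"
proof
  assume p: "p \<in> ZD"
  then show "p \<cdot>\<^sub>m 1\<^sub>m n \<in> Q.matD"
    using ZD_D[OF p] Q.D_closed by (auto simp: Q.matD_iff)
  have "Q.gm (p \<cdot>\<^sub>m 1\<^sub>m n) = (\<Sum>a<n. \<Sum>b<n. if b = a then \<Gamma> a a p else 0)"
    unfolding Q.gm_def by (intro sum.cong refl) (auto simp: Q.G_zero)
  then show "Q.gm (p \<cdot>\<^sub>m 1\<^sub>m n) = Gd p" by (simp add: Gd_def)
qed

end

section \<open>All blocks together: the sum of the centres in A and the splitting off of the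
  kernel\<close>

locale cardy_blocks = cardy_frobenius_data scale SA unitA lA starA SB unitB lB starB phi pd U K
  for scale :: "complex \<Rightarrow> 'r::ring \<Rightarrow> 'r" (infixr "*\<^sub>C" 75)
    and SA unitA lA starA SB unitB lB starB phi pd U K +
  fixes k :: nat and D :: "nat \<Rightarrow> quat set" and n :: "nat \<Rightarrow> nat" and \<mu> :: "nat \<Rightarrow> complex"
    and \<Gamma> :: "nat \<Rightarrow> nat \<Rightarrow> nat \<Rightarrow> quat \<Rightarrow> 'r"
  assumes blocks: "i < k \<Longrightarrow> block scale SB unitB lB starB (D i) (n i) (\<mu> i) (\<Gamma> i)"
    and orth: "i < k \<Longrightarrow> j < k \<Longrightarrow> i \<noteq> j \<Longrightarrow> block_unit (n i) (\<Gamma> i) * block_unit (n j) (\<Gamma> j) = 0"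
    and total: "(\<Sum>i<k. block_unit (n i) (\<Gamma> i)) = unitB"
begin

lemma is_cardy_block: "i < k \<Longrightarrow> cardy_block scale SA unitA lA starA SB unitB lB starB phi pd U K (D i) (n i) (\<mu> i) (\<Gamma> i)"
  using blocks cardy_frobenius_data_axioms by (simp add: cardy_block_def)

definition al :: "nat \<Rightarrow> quat \<Rightarrow> 'r" where
  "al i = cardy_block.\<alpha> scale pd (D i) (\<mu> i) (\<Gamma> i)"

definition gg :: "nat \<Rightarrow> quat mat \<Rightarrow> 'r" where
  "gg i = block.gm (n i) (\<Gamma> i)"

definition dd :: "nat \<Rightarrow> nat" where
  "dd i = card (qbasis (D i))"

lemma gg_orth:
  assumes i: "i < k" "j < k" "i \<noteq> j" and M: "M \<in> carrier (mat_alg (D i) (n i))" "N \<in> carrier (mat_alg (D j) (n j))"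
  shows "gg i M * gg j N = 0"
proof -
  have "gg i M = gg i M * block_unit (n i) (\<Gamma> i)" "gg j N = block_unit (n j) (\<Gamma> j) * gg j N"
    using block.gm_z[OF blocks] i M by (simp_all add: gg_def)
  then have "gg i M * gg j N = gg i M * (block_unit (n i) (\<Gamma> i) * block_unit (n j) (\<Gamma> j)) * gg j N"
    by (metis mult.assoc)
  then show ?thesis using orth i by simp
qed

lemma phi_al:
  assumes i: "i < k" and p: "p \<in> carrier (center_alg (D i))"
  shows "phi (al i p) = gg i (p \<cdot>\<^sub>m 1\<^sub>m (n i))" "p \<cdot>\<^sub>m 1\<^sub>m (n i) \<in> carrier (mat_alg (D i) (n i))"
  using cardy_block.phi_\<alpha>[OF is_cardy_block[OF i] p] cardy_block.gm_scalar[OF is_cardy_block[OF i] p]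
  by (simp_all add: al_def gg_def)

text \<open>The image of the first factor under \<open>phi\<close> lies in block i and kills the
  matrix units of block j, so \<open>\<alpha>_left_mult\<close> reduces the product to
  \<open>pd 0\<close>.\<close>

lemma al_orth:
  assumes i: "i < k" "j < k" "i \<noteq> j" and p: "p \<in> carrier (center_alg (D i))" "q \<in> carrier (center_alg (D j))"
  shows "al i p * al j q = 0"
proof -
  interpret X: cardy_block scale SA unitA lA starA SB unitB lB starB phi pd U K "D i" "n i" "\<mu> i" "\<Gamma> i"
    by (rule is_cardy_block[OF i(1)])
  interpret Y: cardy_block scale SA unitA lA starA SB unitB lB starB phi pd U K "D j" "n j" "\<mu> j" "\<Gamma> j"
    by (rule is_cardy_block[OF i(2)])
  have q: "q \<in> D j" using Y.ZD_D p by blast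
  have g: "Y.Q.z * \<Gamma> j 0 0 q = \<Gamma> j 0 0 q" using Y.Q.z_G Y.n0 q by blast
  have "phi (al i p) * Y.Q.z = 0"
  proof -
    have "phi (al i p) = phi (al i p) * X.Q.z"
      using phi_al[OF i(1) p(1)] X.Q.gm_z by (simp add: gg_def)
    then show ?thesis using orth[OF i] by (metis mult.assoc mult_zero_right)
  qed
  then have 0: "phi (al i p) * \<Gamma> j 0 0 q = 0" using g by (metis mult.assoc mult_zero_left)
  have a: "al i p \<in> SA" unfolding al_def using X.\<alpha>_closed X.ZD_D p by blast
  show ?thesis using Y.\<alpha>_left_mult[OF a q] 0 pd_zero by (simp add: al_def)
qed

sublocale PA: summands scale SA unitA lA starA k "\<lambda>i. center_alg (D i)" al
  "\<lambda>i p. (\<mu> i)\<^sup>2 * of_real (QRe p) / of_nat (dd i)" "\<lambda>i. qcnj"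
proof (unfold_locales, goal_cases)
  case (13 i j x y)
  then show ?case by (rule al_orth)
next
  case (16 i x y x' y')
  then show ?case using cardy_block.\<alpha>_inj[OF is_cardy_block] unfolding al_def by blast
qed (use center_alg_closed block.D[OF blocks] in
  \<open>simp_all add: al_def dd_def cardy_block.ZD_D[OF is_cardy_block] cardy_block.\<alpha>_closed[OF is_cardy_block]
    cardy_block.\<alpha>_zero[OF is_cardy_block] cardy_block.\<alpha>_add[OF is_cardy_block] cardy_block.\<alpha>_scale[OF is_cardy_block]
    cardy_block.\<alpha>_mult[OF is_cardy_block] cardy_block.\<alpha>_star[OF is_cardy_block] cardy_block.\<alpha>_form[OF is_cardy_block]\<close>)

sublocale PB: summands scale SB unitB lB starB k "\<lambda>i. mat_alg (D i) (n i)" gg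
  "\<lambda>i M. \<mu> i * of_real (QRe (mat_trace M))" "\<lambda>i M. transpose_mat (map_mat qcnj M)"
proof (unfold_locales, goal_cases)
  case (7 i x)
  then show ?case using block.matD_iff[OF blocks] by auto
next
  case (13 i j x y)
  then show ?case by (rule gg_orth)
next
  case (16 i x y x' y')
  then show ?case using block.gm_inj[OF blocks] unfolding gg_def by blast
qed (use block.matD_closed[OF blocks] in
  \<open>simp_all add: gg_def block.gm_closed[OF blocks] block.gm_zero[OF blocks] block.gm_add[OF blocks]
    block.gm_scale[OF blocks] block.gm_mult[OF blocks] block.gm_star[OF blocks] block.gm_form[OF blocks]\<close>)

lemma phi_sum: "(\<And>i. i \<in> I \<Longrightarrow> f i \<in> SA) \<Longrightarrow> phi (sum f I) = (\<Sum>i\<in>I. phi (f i))"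
proof (induct I rule: infinite_finite_induct)
  case (insert i I)
  have "phi (f i + sum f I) = phi (f i) + phi (sum f I)"
    by (rule phi_add) (use insert in auto)
  then show ?case using insert by simp
qed (use phi_scale[of 0 0] in auto)

lemma phi_zero: "phi 0 = 0"
  using phi_scale[of 0 0] by simp

lemma phi_HA:
  assumes xs: "xs \<in> carrier PA.CS"
  shows "phi (PA.H xs) = PB.H (\<lambda>i\<in>{..<k}. extend_map (\<lambda>a. a \<cdot>\<^sub>m 1\<^sub>m (n i)) (xs i))"
    "(\<lambda>i\<in>{..<k}. extend_map (\<lambda>a. a \<cdot>\<^sub>m 1\<^sub>m (n i)) (xs i)) \<in> carrier PB.CS"
proof -
  have xsi: "xs i \<in> carrier (center_alg (D i)) \<times> carrier (center_alg (D i))" if "i < k" for i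
    using PA.CS_component[OF xs that] by (simp add: complexify_def)
  have "phi (PA.H xs) = (\<Sum>i<k. phi (PA.hc i (xs i)))"
    unfolding PA.H_def by (rule phi_sum) (use PA.hc_closed PA.CS_component[OF xs] in auto)
  also have "\<dots> = (\<Sum>i<k. PB.hc i (extend_map (\<lambda>a. a \<cdot>\<^sub>m 1\<^sub>m (n i)) (xs i)))"
  proof (intro sum.cong refl)
    fix i assume "i \<in> {..<k}"
    then have i: "i < k" by simp
    obtain p q where pq: "xs i = (p, q)" "p \<in> carrier (center_alg (D i))" "q \<in> carrier (center_alg (D i))"
      using xsi[OF i] by auto
    then show "phi (PA.hc i (xs i)) = PB.hc i (extend_map (\<lambda>a. a \<cdot>\<^sub>m 1\<^sub>m (n i)) (xs i))"
      using i PA.h_closed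
      by (simp add: PA.hc_def PB.hc_def extend_map_def phi_add phi_scale phi_al)
  qed
  finally show "phi (PA.H xs) = PB.H (\<lambda>i\<in>{..<k}. extend_map (\<lambda>a. a \<cdot>\<^sub>m 1\<^sub>m (n i)) (xs i))"
    by (simp add: PB.H_def)
  show "(\<lambda>i\<in>{..<k}. extend_map (\<lambda>a. a \<cdot>\<^sub>m 1\<^sub>m (n i)) (xs i)) \<in> carrier PB.CS"
  proof -
    have "extend_map (\<lambda>a. a \<cdot>\<^sub>m 1\<^sub>m (n i)) (xs i) \<in> carrier (complexify (mat_alg (D i) (n i)))"
      if "i < k" for i
      using xsi[OF that] phi_al(2)[OF that] by (auto simp: complexify_def extend_map_def)
    then show ?thesis by (simp add: alg_sum_def)
  qed
qed

lemma HB_surj: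
  assumes b: "b \<in> SB"
  shows "\<exists>xs\<in>carrier PB.CS. PB.H xs = b"
proof -
  have "\<forall>i. \<exists>x. i < k \<longrightarrow> x \<in> carrier (PB.CR i) \<and> b * block_unit (n i) (\<Gamma> i) = PB.hc i x"
  proof
    fix i
    show "\<exists>x. i < k \<longrightarrow> x \<in> carrier (PB.CR i) \<and> b * block_unit (n i) (\<Gamma> i) = PB.hc i x"
    proof (cases "i < k")
      case True
      then obtain M N where "M \<in> carrier (mat_alg (D i) (n i))" "N \<in> carrier (mat_alg (D i) (n i))"
        "b * block_unit (n i) (\<Gamma> i) = gg i M + \<i> *\<^sub>C gg i N"
        using block.gm_span[OF blocks b] unfolding gg_def by blast
      then show ?thesis by (intro exI[of _ "(M, N)"]) (simp add: complexify_def PB.hc_def)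
    qed auto
  qed
  then obtain x where x: "\<And>i. i < k \<Longrightarrow> x i \<in> carrier (PB.CR i)"
    "\<And>i. i < k \<Longrightarrow> b * block_unit (n i) (\<Gamma> i) = PB.hc i (x i)" by metis
  have "PB.H (restrict x {..<k}) = (\<Sum>i<k. b * block_unit (n i) (\<Gamma> i))"
    using x by (simp add: PB.H_def)
  also have "\<dots> = b" using b total by (simp add: sum_distrib_left[symmetric])
  finally have "PB.H (restrict x {..<k}) = b" .
  moreover have "restrict x {..<k} \<in> carrier PB.CS" using x by (simp add: alg_sum_def)
  ultimately show ?thesis by blast
qed

lemma HB_one: "PB.H \<one>\<^bsub>PB.CS\<^esub> = unitB"
  unfolding PB.H_one using total block.gm_one[OF blocks] by (simp add: gg_def)

definition kerA :: "'r set" where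
  "kerA = {a \<in> SA. phi a = 0}"

text \<open>The unit of the kernel: \<open>phi\<close> maps \<open>PA.H\<close> of the unit to
  \<open>unitB\<close>, and the image of \<open>PA.H\<close> annihilates the kernel.\<close>

definition \<kappa> :: 'r where
  "\<kappa> = unitA - PA.H \<one>\<^bsub>PA.CS\<^esub>"

lemma ker_al: "a \<in> kerA \<Longrightarrow> i < k \<Longrightarrow> p \<in> carrier (center_alg (D i)) \<Longrightarrow> a * al i p = 0"
  using cardy_block.\<alpha>_ker[OF is_cardy_block, of i a p] cardy_block.ZD_D[OF is_cardy_block, of i p]
  by (simp add: kerA_def al_def)

lemma ker_H:
  assumes a: "a \<in> kerA" and xs: "xs \<in> carrier PA.CS"
  shows "a * PA.H xs = 0" "PA.H xs * a = 0"
proof -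
  have "a * PA.hc i (xs i) = 0" if i: "i < k" for i
    using PA.CS_component[OF xs i] ker_al[OF a i]
    by (auto simp: complexify_def PA.hc_def distrib_left)
  then show "a * PA.H xs = 0" by (simp add: PA.H_def sum_distrib_left)
  then show "PA.H xs * a = 0" using A_comm[of a "PA.H xs"] a PA.H_closed[OF xs] by (simp add: kerA_def)
qed

lemma phi_HA_one: "phi (PA.H \<one>\<^bsub>PA.CS\<^esub>) = unitB"
proof -
  have "al i 1 \<in> SA" if "i < k" for i using PA.h_closed[OF that] PA.R_one[OF that] by simp
  then have "phi (PA.H \<one>\<^bsub>PA.CS\<^esub>) = (\<Sum>i<k. phi (al i 1))"
    unfolding PA.H_one by (subst phi_sum) auto
  also have "\<dots> = (\<Sum>i<k. block_unit (n i) (\<Gamma> i))"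
  proof (intro sum.cong refl)
    fix i assume "i \<in> {..<k}"
    then have i: "i < k" by simp
    have "1 \<cdot>\<^sub>m 1\<^sub>m (n i) = (1\<^sub>m (n i) :: quat mat)" by (rule eq_matI) auto
    then show "phi (al i 1) = block_unit (n i) (\<Gamma> i)"
      using phi_al(1)[OF i, of 1] PA.R_one[OF i] block.gm_one[OF blocks[OF i]] by (simp add: gg_def)
  qed
  finally show ?thesis using total by simp
qed

lemma \<kappa>_ker: "\<kappa> \<in> kerA"
proof -
  have "PA.H \<one>\<^bsub>PA.CS\<^esub> \<in> SA" using PA.H_closed PA.CS_closed by blast
  then show ?thesis
    using phi_add[of unitA "- PA.H \<one>\<^bsub>PA.CS\<^esub>"] phi_scale[of "PA.H \<one>\<^bsub>PA.CS\<^esub>" "-1"]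
    by (simp add: kerA_def \<kappa>_def phi_HA_one phi_unit)
qed

lemma \<kappa>_unit: "a \<in> kerA \<Longrightarrow> \<kappa> * a = a" "a \<in> kerA \<Longrightarrow> a * \<kappa> = a"
proof -
  assume a: "a \<in> kerA"
  then have "a \<in> SA" by (simp add: kerA_def)
  then show "\<kappa> * a = a" "a * \<kappa> = a"
    using ker_H[OF a PA.CS_closed(2)] by (simp_all add: \<kappa>_def left_diff_distrib right_diff_distrib)
qed

text \<open>In each block \<open>phi a\<close> is a complexified scalar matrix with entry in the
  centre of D, by \<open>central_span\<close>, hence the image of a combination of
  \<open>al\<close>. The sum over all blocks has the same image under \<open>phi\<close> as a, and
  the difference lies in the kernel.\<close>

lemma HA_decomposition:
  assumes a: "a \<in> SA"
  shows "\<exists>xs\<in>carrier PA.CS. \<exists>x\<in>kerA. PA.H xs + x = a"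
proof -
  have "\<forall>i. \<exists>x. i < k \<longrightarrow> x \<in> carrier (PA.CR i) \<and> phi (PA.hc i x) = phi a * block_unit (n i) (\<Gamma> i)"
  proof
    fix i
    show "\<exists>x. i < k \<longrightarrow> x \<in> carrier (PA.CR i) \<and> phi (PA.hc i x) = phi a * block_unit (n i) (\<Gamma> i)"
    proof (cases "i < k")
      case True
      obtain p q where pq: "p \<in> carrier (center_alg (D i))" "q \<in> carrier (center_alg (D i))"
        and eq: "phi a * block_unit (n i) (\<Gamma> i) = cardy_block.Gd (n i) (\<Gamma> i) p + \<i> *\<^sub>C cardy_block.Gd (n i) (\<Gamma> i) q"
        using cardy_block.central_span[OF is_cardy_block[OF True] a] by blast
      have "phi (PA.hc i (p, q)) = phi (al i p) + \<i> *\<^sub>C phi (al i q)"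
        using PA.h_closed[OF True] pq by (simp add: PA.hc_def phi_add phi_scale)
      also have "\<dots> = phi a * block_unit (n i) (\<Gamma> i)"
        using cardy_block.phi_\<alpha>[OF is_cardy_block[OF True]] pq by (simp add: eq al_def)
      finally show ?thesis using pq by (intro exI[of _ "(p, q)"]) (simp add: complexify_def)
    qed auto
  qed
  then obtain x where x: "\<And>i. i < k \<Longrightarrow> x i \<in> carrier (PA.CR i)"
    "\<And>i. i < k \<Longrightarrow> phi (PA.hc i (x i)) = phi a * block_unit (n i) (\<Gamma> i)" by metis
  define xs where "xs = restrict x {..<k}"
  have xs: "xs \<in> carrier PA.CS" using x by (simp add: alg_sum_def xs_def)
  have "phi (PA.H xs) = (\<Sum>i<k. phi (PA.hc i (xs i)))"
    unfolding PA.H_def by (rule phi_sum) (use PA.hc_closed PA.CS_component[OF xs] in auto)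
  also have "\<dots> = (\<Sum>i<k. phi a * block_unit (n i) (\<Gamma> i))"
    using x by (simp add: xs_def)
  also have "\<dots> = phi a" using total phi_closed[OF a] by (simp add: sum_distrib_left[symmetric])
  finally have "phi (PA.H xs) = phi a" .
  then have "a - PA.H xs \<in> kerA"
    using a PA.H_closed[OF xs] phi_add[of a "- PA.H xs"] phi_scale[of "PA.H xs" "-1"]
    by (simp add: kerA_def)
  moreover have "PA.H xs + (a - PA.H xs) = a" by simp
  ultimately show ?thesis using xs by blast
qed

text \<open>Multiplication by \<open>\<kappa>\<close> is the identity on the kernel and zero on the
  image of \<open>PA.H\<close>.\<close>

lemma HA_decomposition_unique:
  assumes xs: "xs \<in> carrier PA.CS" "ys \<in> carrier PA.CS" and x: "x \<in> kerA" "y \<in> kerA"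
    and eq: "PA.H xs + x = PA.H ys + y"
  shows "xs = ys \<and> x = y"
proof -
  have "\<kappa> * (PA.H xs + x) = x" "\<kappa> * (PA.H ys + y) = y"
    using ker_H[OF \<kappa>_ker] xs x \<kappa>_unit by (simp_all add: distrib_left)
  then have "x = y" using eq by simp
  then show ?thesis using eq PA.H_inj[OF xs] by simp
qed

lemma HA_mult:
  assumes xs: "xs \<in> carrier PA.CS" "ys \<in> carrier PA.CS" and x: "x \<in> kerA" "y \<in> kerA"
  shows "PA.H (xs \<otimes>\<^bsub>PA.CS\<^esub> ys) + x * y = (PA.H xs + x) * (PA.H ys + y)"
  using ker_H xs x by (simp add: PA.H_mult distrib_left distrib_right)

text \<open>The unit of A is the sum of the \<open>al i 1\<close> and \<open>\<kappa>\<close>.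
  Multiplying it by \<open>U\<close> shows the components: scalars (2 - d) / \<mu> on the blocks,
  and \<open>\<kappa> * U\<close> on the kernel.\<close>

lemma HA_U:
  "PA.H (\<lambda>i\<in>{..<k}. ((2 - of_nat (dd i)) / \<mu> i) \<odot>\<^bsub>PA.CR i\<^esub> \<one>\<^bsub>PA.CR i\<^esub>) + \<kappa> * U = U"
proof -
  have "PA.hc i (((2 - of_nat (dd i)) / \<mu> i) \<odot>\<^bsub>PA.CR i\<^esub> \<one>\<^bsub>PA.CR i\<^esub>) = al i 1 * U" if i: "i < k" for i
    using PA.hc_smult[OF i PA.CR_closed(2)[OF i]] cardy_block.\<alpha>_U[OF is_cardy_block[OF i]] i
    by (simp add: PA.hc_one al_def dd_def)
  then have "PA.H (\<lambda>i\<in>{..<k}. ((2 - of_nat (dd i)) / \<mu> i) \<odot>\<^bsub>PA.CR i\<^esub> \<one>\<^bsub>PA.CR i\<^esub>) = PA.H \<one>\<^bsub>PA.CS\<^esub> * U"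
    by (simp add: PA.H_one sum_distrib_right) (simp add: PA.H_def)
  then show ?thesis using U_closed by (simp add: \<kappa>_def left_diff_distrib)
qed

lemma ker_closed:
  "0 \<in> kerA" "x \<in> kerA \<Longrightarrow> y \<in> kerA \<Longrightarrow> x + y \<in> kerA" "x \<in> kerA \<Longrightarrow> c *\<^sub>C x \<in> kerA"
  "x \<in> kerA \<Longrightarrow> starA x \<in> kerA" "x \<in> kerA \<Longrightarrow> a \<in> SA \<Longrightarrow> x * a \<in> kerA"
  by (auto simp: kerA_def phi_zero phi_add phi_scale phi_star phi_mult)

end

lemma (in cardy_frobenius_data) ex_cardy_blocks:
  "\<exists>k D n \<mu> \<Gamma>. cardy_blocks scale SA unitA lA starA SB unitB lB starB phi pd U K k D n \<mu> \<Gamma>"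
proof -
  obtain k :: nat and D n \<mu> \<Gamma> where
    "\<forall>i<k. block scale SB unitB lB starB (D i) (n i) (\<mu> i) (\<Gamma> i)"
    "\<forall>i<k. \<forall>j<k. i \<noteq> j \<longrightarrow> block_unit (n i) (\<Gamma> i) * block_unit (n j) (\<Gamma> j) = 0"
    "(\<Sum>i<k. block_unit (n i) (\<Gamma> i)) = unitB"
    using B.ex_block_decomposition by blast
  then have "cardy_blocks_axioms scale SB unitB lB starB k D n \<mu> \<Gamma>"
    unfolding cardy_blocks_axioms_def by (intro conjI allI impI) auto
  with cardy_frobenius_data_axioms
  have "cardy_blocks scale SA unitA lA starA SB unitB lB starB phi pd U K k D n \<mu> \<Gamma>"
    by (rule cardy_blocks.intro)
  then show ?thesis by (intro exI)
qed

section \<open>The regular representation\<close>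

text \<open>Every finite-dimensional algebra embeds, through its regular representation in coordinates,
  into the linear operators on complex sequences; this moves computations into a type of class
  \<^class>\<open>ring\<close>.\<close>

typedef lin_op = "{f :: (nat \<Rightarrow> complex) \<Rightarrow> nat \<Rightarrow> complex.
    \<forall>c x y. f (\<lambda>i. c * x i + y i) = (\<lambda>i. c * f x i + f y i)}"
  morphisms app Lin
  by (rule exI[of _ "\<lambda>x. x"]) simp

setup_lifting type_definition_lin_op

lemma app_linear: "app f (\<lambda>i. c * x i + y i) = (\<lambda>i. c * app f x i + app f y i)"
  using app[of f] by blast

lemma app_add: "app f (\<lambda>i. x i + y i) = (\<lambda>i. app f x i + app f y i)"
  using app_linear[of f 1 x y] by simp

lemma app_scale: "app f (\<lambda>i. c * x i) = (\<lambda>i. c * app f x i)"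
proof -
  have "app f (\<lambda>i. 0) = (\<lambda>i. 0)"
    using app_add[of f "\<lambda>i. 0" "\<lambda>i. 0"] by (auto simp: fun_eq_iff)
  then show ?thesis using app_linear[of f c x "\<lambda>i. 0"] by simp
qed

instantiation lin_op :: ring
begin

lift_definition zero_lin_op :: lin_op is "\<lambda>x i. 0" by simp
lift_definition plus_lin_op :: "lin_op \<Rightarrow> lin_op \<Rightarrow> lin_op" is "\<lambda>f g x i. f x i + g x i"
  by (auto simp: algebra_simps)
lift_definition uminus_lin_op :: "lin_op \<Rightarrow> lin_op" is "\<lambda>f x i. - f x i"
  by (auto simp: algebra_simps)
lift_definition minus_lin_op :: "lin_op \<Rightarrow> lin_op \<Rightarrow> lin_op" is "\<lambda>f g x i. f x i - g x i"
  by (auto simp: algebra_simps)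
lift_definition times_lin_op :: "lin_op \<Rightarrow> lin_op \<Rightarrow> lin_op" is "\<lambda>f g x. f (g x)"
  by auto

lemmas app_ops [simp] = zero_lin_op.rep_eq plus_lin_op.rep_eq uminus_lin_op.rep_eq
  minus_lin_op.rep_eq times_lin_op.rep_eq

lemma lin_op_eqI: "(\<And>x i. app f x i = app g x i) \<Longrightarrow> f = g"
  by (simp add: app_inject[symmetric] fun_eq_iff)

instance
  by standard (auto intro!: lin_op_eqI simp: app_add algebra_simps)

end

lift_definition scale_op :: "complex \<Rightarrow> lin_op \<Rightarrow> lin_op" is "\<lambda>c f x i. c * f x i"
  by (auto simp: algebra_simps)

interpretation op: complex_algebra scale_op
  by unfold_locales (auto intro!: lin_op_eqI simp: scale_op.rep_eq app_scale algebra_simps)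

lemma app_sum: "app (sum f I) x i = (\<Sum>k\<in>I. app (f k) x i)"
  by (induct I rule: infinite_finite_induct) auto

section \<open>Coordinates in the chosen basis, traces, and what semisimplicity yields\<close>

locale fd_alg =
  fixes C :: "(complex, 'a) module" (structure)
  assumes fd: "fd_algebra C"
begin

sublocale R: ring C using fd by (simp add: fd_algebra_def)

sublocale V: vectorspace class_ring C using fd by (simp add: fd_algebra_def)

lemma smult_closed [simp, intro]: "x \<in> carrier C \<Longrightarrow> c \<odot> x \<in> carrier C"
  using V.smult_closed[of c x] by simp

lemma add_smult: "x \<in> carrier C \<Longrightarrow> (c + d) \<odot> x = c \<odot> x \<oplus> d \<odot> x"
  using V.smult_l_distr[of c d x] by simp

lemma smult_smult: "x \<in> carrier C \<Longrightarrow> (c * d) \<odot> x = c \<odot> (d \<odot> x)"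
  using V.smult_assoc1[of c d x] by simp

lemma mult_smult: "x \<in> carrier C \<Longrightarrow> y \<in> carrier C \<Longrightarrow> x \<otimes> (c \<odot> y) = c \<odot> (x \<otimes> y)"
  "x \<in> carrier C \<Longrightarrow> y \<in> carrier C \<Longrightarrow> (c \<odot> x) \<otimes> y = c \<odot> (x \<otimes> y)"
  using fd by (auto simp: fd_algebra_def)

lemma finsum_hom:
  fixes h :: "'a \<Rightarrow> 'g::ab_group_add"
  assumes "finite I" "\<And>i. i \<in> I \<Longrightarrow> f i \<in> carrier C"
    and h: "\<And>x y. x \<in> carrier C \<Longrightarrow> y \<in> carrier C \<Longrightarrow> h (x \<oplus> y) = h x + h y"
  shows "h (\<Oplus>i\<in>I. f i) = (\<Sum>i\<in>I. h (f i))"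
  using assms(1,2)
proof (induct I rule: finite_induct)
  case empty
  have "h (\<zero> \<oplus> \<zero>) = h \<zero> + h \<zero>" by (rule h) auto
  then show ?case by simp
next
  case (insert i I)
  then show ?case by (subst R.finsum_insert) (auto simp: h)
qed

abbreviation "\<gamma> \<equiv> some_basis C"
abbreviation "N \<equiv> length (some_basis C)"

lemma basis: "distinct \<gamma>" "V.basis (set \<gamma>)"
proof -
  have "V.fin_dim" using fd by (simp add: fd_algebra_def)
  then obtain B where B: "finite B" "V.basis B" using V.finite_basis_exists by blast
  obtain g where "set g = B" "distinct g" using finite_distinct_list[OF B(1)] by blast
  then have "\<exists>g. distinct g \<and> V.basis (set g)" using B by blast
  from someI_ex[OF this] show "distinct \<gamma>" "V.basis (set \<gamma>)" by (auto simp: some_basis_def)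
qed

lemma basis_closed: "i < N \<Longrightarrow> \<gamma> ! i \<in> carrier C"
  using basis(2) nth_mem by (auto simp: V.basis_def)

definition cf :: "(nat \<Rightarrow> complex) \<Rightarrow> 'a" where
  "cf v = (\<Oplus>i\<in>{..<N}. v i \<odot> (\<gamma> ! i))"

lemma cf_closed [simp, intro]: "cf v \<in> carrier C"
  unfolding cf_def by (rule R.finsum_closed) (auto simp: basis_closed)

lemma cf_cong: "(\<And>i. i < N \<Longrightarrow> v i = w i) \<Longrightarrow> cf v = cf w"
  unfolding cf_def by (rule R.finsum_cong') (auto simp: basis_closed)

lemma cf_lincomb: "cf (\<lambda>i. a (\<gamma> ! i)) = V.lincomb a (set \<gamma>)"
proof -
  have s: "set \<gamma> = (!) \<gamma> ` {..<N}" by (auto simp: in_set_conv_nth)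
  have "V.lincomb a (set \<gamma>) = (\<Oplus>v\<in>(!) \<gamma> ` {..<N}. a v \<odot> v)"
    unfolding V.lincomb_def s ..
  also have "\<dots> = cf (\<lambda>i. a (\<gamma> ! i))"
    unfolding cf_def
    by (rule R.finsum_reindex) (use basis(1) in \<open>auto simp: basis_closed inj_on_def nth_eq_iff_index_eq\<close>)
  finally show ?thesis by simp
qed

lemma ex1_coefficients: "x \<in> carrier C \<Longrightarrow> \<exists>!a. a \<in> set \<gamma> \<rightarrow>\<^sub>E UNIV \<and> V.lincomb a (set \<gamma>) = x"
  using basis(2) V.basis_criterion[of "set \<gamma>"] by (auto simp: V.basis_def)

lemma cf_inj:
  assumes eq: "cf v = cf w" and i: "i < N"
  shows "v i = w i"
proof -
  \<comment> \<open>Coefficients in \<open>V.lincomb\<close> are indexed by basis vectors, those of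
    \<open>cf\<close> by positions; \<open>ix\<close> translates back.\<close>
  define ix where "ix b = (THE i. i < N \<and> \<gamma> ! i = b)" for b
  have ix: "ix (\<gamma> ! i) = i" if "i < N" for i
    unfolding ix_def using that basis(1) by (intro the_equality) (auto simp: nth_eq_iff_index_eq)
  define r where "r v = restrict (\<lambda>b. v (ix b)) (set \<gamma>)" for v :: "nat \<Rightarrow> complex"
  have r: "V.lincomb (r v) (set \<gamma>) = cf v" "r v \<in> set \<gamma> \<rightarrow>\<^sub>E UNIV" for v
  proof -
    have "cf v = cf (\<lambda>i. r v (\<gamma> ! i))" by (rule cf_cong) (simp add: r_def ix)
    then show "V.lincomb (r v) (set \<gamma>) = cf v" by (simp only: cf_lincomb)
    show "r v \<in> set \<gamma> \<rightarrow>\<^sub>E UNIV" by (auto simp: r_def)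
  qed
  have "r v = r w" using ex1_coefficients[OF cf_closed[of v]] r eq by metis
  then have "r v (\<gamma> ! i) = r w (\<gamma> ! i)" by simp
  then show ?thesis using i ix by (simp add: r_def)
qed

text \<open>Fixing the values from \<open>N\<close> on to 0 makes the sequence unique, so that
  \<open>co\<close> is additive and homogeneous as a function.\<close>

definition co :: "'a \<Rightarrow> nat \<Rightarrow> complex" where
  "co x = (SOME v. cf v = x \<and> (\<forall>i\<ge>N. v i = 0))"

lemma co: "x \<in> carrier C \<Longrightarrow> cf (co x) = x" "x \<in> carrier C \<Longrightarrow> i \<ge> N \<Longrightarrow> co x i = 0"
proof -
  assume x: "x \<in> carrier C"
  obtain a where "V.lincomb a (set \<gamma>) = x" using ex1_coefficients[OF x] by blast
  then have "cf (\<lambda>i. a (\<gamma> ! i)) = x" by (simp add: cf_lincomb)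
  moreover have "cf (\<lambda>i. if i < N then a (\<gamma> ! i) else 0) = cf (\<lambda>i. a (\<gamma> ! i))" by (rule cf_cong) simp
  ultimately have "\<exists>v. cf v = x \<and> (\<forall>i\<ge>N. v i = 0)"
    by (intro exI[of _ "\<lambda>i. if i < N then a (\<gamma> ! i) else 0"]) auto
  from someI_ex[OF this] show "cf (co x) = x" "i \<ge> N \<Longrightarrow> co x i = 0" by (auto simp: co_def)
qed

lemma co_eqI: "x \<in> carrier C \<Longrightarrow> cf v = x \<Longrightarrow> (\<And>i. i \<ge> N \<Longrightarrow> v i = 0) \<Longrightarrow> co x = v"
proof
  fix i assume "x \<in> carrier C" "cf v = x" "\<And>i. i \<ge> N \<Longrightarrow> v i = 0"
  then show "co x i = v i" using cf_inj[of "co x" v i] co[of x] by (cases "i < N") auto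
qed

lemma cf_add: "cf (\<lambda>i. v i + w i) = cf v \<oplus> cf w"
proof -
  have "cf (\<lambda>i. v i + w i) = (\<Oplus>i\<in>{..<N}. v i \<odot> (\<gamma> ! i) \<oplus> w i \<odot> (\<gamma> ! i))"
    unfolding cf_def by (rule R.finsum_cong') (auto simp: basis_closed add_smult)
  also have "\<dots> = cf v \<oplus> cf w"
    unfolding cf_def by (rule R.finsum_addf) (auto simp: basis_closed)
  finally show ?thesis .
qed

lemma cf_scale: "cf (\<lambda>i. c * v i) = c \<odot> cf v"
  unfolding cf_def
  by (subst V.finsum_smult) (auto simp: basis_closed smult_smult intro!: R.finsum_cong')

lemma co_add: "x \<in> carrier C \<Longrightarrow> y \<in> carrier C \<Longrightarrow> co (x \<oplus> y) = (\<lambda>i. co x i + co y i)"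
  by (rule co_eqI) (auto simp: cf_add co)

lemma co_smult: "x \<in> carrier C \<Longrightarrow> co (c \<odot> x) = (\<lambda>i. c * co x i)"
  by (rule co_eqI) (auto simp: cf_scale co)

lemma linear_via_coordinates:
  fixes h :: "'a \<Rightarrow> complex"
  assumes x: "x \<in> carrier C"
    and add: "\<And>x y. x \<in> carrier C \<Longrightarrow> y \<in> carrier C \<Longrightarrow> h (x \<oplus> y) = h x + h y"
    and smult: "\<And>c x. x \<in> carrier C \<Longrightarrow> h (c \<odot> x) = c * h x"
  shows "h x = (\<Sum>i<N. co x i * h (\<gamma> ! i))"
proof -
  have "h x = h (\<Oplus>i\<in>{..<N}. co x i \<odot> (\<gamma> ! i))" using co(1)[OF x] by (simp add: cf_def)
  also have "\<dots> = (\<Sum>i<N. h (co x i \<odot> (\<gamma> ! i)))"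
    by (rule finsum_hom) (auto simp: basis_closed add)
  finally show ?thesis by (simp add: smult basis_closed)
qed

text \<open>Left multiplication in coordinates. Coordinates from \<open>N\<close> on are discarded,
  so \<open>\<rho> \<one>\<close> is the projection onto the first \<open>N\<close> coordinates and
  not the identity operator.\<close>

definition \<rho> :: "'a \<Rightarrow> lin_op" where
  "\<rho> b = Lin (\<lambda>v. co (b \<otimes> cf v))"

lemma app_\<rho>: "b \<in> carrier C \<Longrightarrow> app (\<rho> b) v = co (b \<otimes> cf v)"
  unfolding \<rho>_def
  by (subst Lin_inverse) (auto simp: cf_add cf_scale R.r_distr mult_smult co_add co_smult)

lemma \<rho>_add: "x \<in> carrier C \<Longrightarrow> y \<in> carrier C \<Longrightarrow> \<rho> (x \<oplus> y) = \<rho> x + \<rho> y"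
  by (rule lin_op_eqI) (simp add: app_\<rho> R.l_distr co_add)

lemma \<rho>_smult: "x \<in> carrier C \<Longrightarrow> \<rho> (c \<odot> x) = scale_op c (\<rho> x)"
  by (rule lin_op_eqI) (simp add: app_\<rho> mult_smult co_smult scale_op.rep_eq)

lemma \<rho>_mult: "x \<in> carrier C \<Longrightarrow> y \<in> carrier C \<Longrightarrow> \<rho> (x \<otimes> y) = \<rho> x * \<rho> y"
  by (rule lin_op_eqI) (simp add: app_\<rho> co R.m_assoc)

lemma \<rho>_zero: "\<rho> \<zero> = 0"
  using \<rho>_add[of "\<zero>" "\<zero>"] by simp

lemma inj_\<rho>: "inj_on \<rho> (carrier C)"
proof
  fix x y assume xy: "x \<in> carrier C" "y \<in> carrier C" "\<rho> x = \<rho> y"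
  have "co x = app (\<rho> x) (co \<one>)" "co y = app (\<rho> y) (co \<one>)"
    using xy(1,2) by (simp_all add: app_\<rho> co)
  then have "co x = co y" by (simp only: xy(3))
  then show "x = y" using co(1) xy by metis
qed

definition \<tau> :: "lin_op \<Rightarrow> 'a" where
  "\<tau> = inv_into (carrier C) \<rho>"

abbreviation "SC \<equiv> \<rho> ` carrier C"

lemma \<tau>_\<rho> [simp]: "x \<in> carrier C \<Longrightarrow> \<tau> (\<rho> x) = x"
  by (simp add: \<tau>_def inj_\<rho>)

lemma \<rho>_\<tau> [simp]: "x \<in> SC \<Longrightarrow> \<rho> (\<tau> x) = x"
  by (simp add: \<tau>_def f_inv_into_f)

lemma \<tau>_closed [simp, intro]: "x \<in> SC \<Longrightarrow> \<tau> x \<in> carrier C"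
  by (simp add: \<tau>_def inv_into_into)

lemma \<tau>_mult: "x \<in> SC \<Longrightarrow> y \<in> SC \<Longrightarrow> \<tau> (x * y) = \<tau> x \<otimes> \<tau> y"
  by (metis \<rho>_\<tau> \<rho>_mult \<tau>_\<rho> \<tau>_closed R.m_closed)

lemma \<tau>_zero: "\<tau> 0 = \<zero>"
  by (metis \<rho>_zero \<tau>_\<rho> R.zero_closed)

lemma SC_closed:
  "0 \<in> SC" "x \<in> SC \<Longrightarrow> y \<in> SC \<Longrightarrow> x + y \<in> SC" "x \<in> SC \<Longrightarrow> scale_op c x \<in> SC"
  "x \<in> SC \<Longrightarrow> y \<in> SC \<Longrightarrow> x * y \<in> SC" "\<rho> \<one> \<in> SC"
  by (auto simp: \<rho>_zero[symmetric] \<rho>_add[symmetric] \<rho>_smult[symmetric] \<rho>_mult[symmetric])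

lemma \<rho>_finsum:
  "finite I \<Longrightarrow> (\<And>i. i \<in> I \<Longrightarrow> f i \<in> carrier C) \<Longrightarrow> \<rho> (\<Oplus>i\<in>I. f i) = (\<Sum>i\<in>I. \<rho> (f i))"
  by (rule finsum_hom) (auto simp: \<rho>_add)

lemma \<rho>_expansion: "x \<in> carrier C \<Longrightarrow> \<rho> x = (\<Sum>i<N. scale_op (co x i) (\<rho> (\<gamma> ! i)))"
proof -
  assume x: "x \<in> carrier C"
  have "\<rho> x = \<rho> (\<Oplus>i\<in>{..<N}. co x i \<odot> (\<gamma> ! i))" using co(1)[OF x] by (simp add: cf_def)
  also have "\<dots> = (\<Sum>i<N. \<rho> (co x i \<odot> (\<gamma> ! i)))" by (rule \<rho>_finsum) (auto simp: basis_closed)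
  finally show ?thesis by (simp add: \<rho>_smult basis_closed)
qed

lemma SC_span: "SC \<subseteq> op.span ((\<lambda>i. \<rho> (\<gamma> ! i)) ` {..<N})"
proof (rule image_subsetI)
  fix x assume "x \<in> carrier C"
  then show "\<rho> x \<in> op.span ((\<lambda>i. \<rho> (\<gamma> ! i)) ` {..<N})"
    by (simp only: \<rho>_expansion) (rule op.span_sum, rule op.span_scale, rule op.span_base, rule imageI)
qed

text \<open>An operator written as the sum of f_k(b) y_k has trace equal to the sum of f_k(y_k). The
  matrix chosen by \<open>SOME\<close> exists because the coordinates of the images of the basis
  provide one, and \<open>cf_inj\<close> forces its entries.\<close>

lemma lin_trace_eq:
  assumes T: "\<And>b. b \<in> carrier C \<Longrightarrow> T b \<in> carrier C"
    and y: "\<And>k. k < m \<Longrightarrow> y k \<in> SC"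
    and f_add: "\<And>k x z. k < m \<Longrightarrow> x \<in> carrier C \<Longrightarrow> z \<in> carrier C \<Longrightarrow> f k (x \<oplus> z) = f k x + f k z"
    and f_smult: "\<And>k c x. k < m \<Longrightarrow> x \<in> carrier C \<Longrightarrow> f k (c \<odot> x) = c * f k x"
    and eq: "\<And>b. b \<in> carrier C \<Longrightarrow> \<rho> (T b) = (\<Sum>k<m. scale_op (f k b) (y k))"
  shows "lin_trace C T = (\<Sum>k<m. f k (\<tau> (y k)))"
proof -
  define P where "P M \<longleftrightarrow> M \<in> carrier_mat N N \<and>
     (\<forall>j<N. T (\<gamma> ! j) = (\<Oplus>i\<in>{..<N}. M $$ (i, j) \<odot> (\<gamma> ! i)))" for M :: "complex mat"
  define M where "M = (SOME M. P M)"
  have cfe: "(\<Oplus>i\<in>{..<N}. M $$ (i, j) \<odot> (\<gamma> ! i)) = cf (\<lambda>i. M $$ (i, j))" for M :: "complex mat" and j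
    by (simp add: cf_def)
  have "P (mat N N (\<lambda>(i, j). co (T (\<gamma> ! j)) i))"
    unfolding P_def cfe
  proof (intro conjI allI impI)
    fix j assume j: "j < N"
    have "cf (\<lambda>i. mat N N (\<lambda>(i, j). co (T (\<gamma> ! j)) i) $$ (i, j)) = cf (co (T (\<gamma> ! j)))"
      by (rule cf_cong) (simp add: j)
    then show "T (\<gamma> ! j) = cf (\<lambda>i. mat N N (\<lambda>(i, j). co (T (\<gamma> ! j)) i) $$ (i, j))"
      using co(1) T basis_closed[OF j] by simp
  qed simp
  then have "P M" unfolding M_def by (rule someI)
  then have M: "M \<in> carrier_mat N N" "\<And>j. j < N \<Longrightarrow> T (\<gamma> ! j) = cf (\<lambda>i. M $$ (i, j))"
    unfolding P_def cfe by blast+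
  have M_eq: "M $$ (i, j) = co (T (\<gamma> ! j)) i" if ij: "i < N" "j < N" for i j
  proof -
    have "cf (\<lambda>i. M $$ (i, j)) = cf (co (T (\<gamma> ! j)))"
      using M(2)[OF ij(2)] co(1)[OF T[OF basis_closed[OF ij(2)]]] by simp
    from cf_inj[OF this ij(1)] show ?thesis .
  qed
  have diag: "co (T (\<gamma> ! i)) i = (\<Sum>k<m. f k (\<gamma> ! i) * co (\<tau> (y k)) i)" if i: "i < N" for i
  proof -
    have co_app: "co x i = app (\<rho> x) (co \<one>) i" if "x \<in> carrier C" for x
      using that by (simp add: app_\<rho> co)
    have "co (T (\<gamma> ! i)) i = (\<Sum>k<m. app (scale_op (f k (\<gamma> ! i)) (y k)) (co \<one>) i)"
      using co_app[OF T[OF basis_closed[OF i]]] eq[OF basis_closed[OF i]] by (simp add: app_sum)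
    also have "\<dots> = (\<Sum>k<m. f k (\<gamma> ! i) * co (\<tau> (y k)) i)"
      by (intro sum.cong refl) (use y co_app in \<open>simp add: scale_op.rep_eq\<close>)
    finally show ?thesis .
  qed
  have "lin_trace C T = mat_trace M"
    unfolding lin_trace_def Let_def M_def P_def ..
  also have "\<dots> = (\<Sum>i<N. co (T (\<gamma> ! i)) i)" using M(1) by (simp add: mat_trace_def M_eq)
  also have "\<dots> = (\<Sum>i<N. \<Sum>k<m. f k (\<gamma> ! i) * co (\<tau> (y k)) i)" by (simp add: diag)
  also have "\<dots> = (\<Sum>k<m. \<Sum>i<N. co (\<tau> (y k)) i * f k (\<gamma> ! i))"
    by (subst sum.swap) (simp add: mult.commute)
  also have "\<dots> = (\<Sum>k<m. f k (\<tau> (y k)))"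
    by (intro sum.cong refl linear_via_coordinates[symmetric]) (use y f_add f_smult in auto)
  finally show ?thesis .
qed

text \<open>Let x C x = 0 and let L be a maximal left ideal not containing x. Then L + C x is
  everything, so 1 = a + t with a in L, t = y x and t t = 0. Hence t = t a lies in L, and so does 1.
  Thus x lies in the radical.\<close>

lemma semiprime_of_semisimple:
  assumes ss: "semisimple_alg C" and x: "x \<in> carrier C"
    and nil: "\<And>y. y \<in> carrier C \<Longrightarrow> x \<otimes> y \<otimes> x = \<zero>"
  shows "x = \<zero>"
proof -
  have "x \<in> L" if L: "maximal_left_ideal L C" for L
  proof (rule ccontr)
    assume xL: "x \<notin> L"
    have li: "left_ideal L C" and ne: "L \<noteq> carrier C"
      and max: "\<And>J. left_ideal J C \<Longrightarrow> L \<subseteq> J \<Longrightarrow> J = L \<or> J = carrier C"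
      using L by (auto simp: maximal_left_ideal_def)
    interpret L: additive_subgroup L C using li by (simp add: left_ideal_def)
    have LC: "a \<in> carrier C" if "a \<in> L" for a using L.a_Hcarr that .
    have mL: "y \<otimes> a \<in> L" if "y \<in> carrier C" "a \<in> L" for y a using li that by (simp add: left_ideal_def)
    define J where "J = {a \<oplus> y \<otimes> x | a y. a \<in> L \<and> y \<in> carrier C}"
    have "left_ideal J C"
      unfolding left_ideal_def
    proof (intro conjI ballI)
      show "additive_subgroup J C"
      proof (intro additive_subgroup.intro R.add.subgroupI)
        show "J \<subseteq> carrier C" using LC x by (auto simp: J_def)
        show "J \<noteq> {}" using L.zero_closed R.zero_closed unfolding J_def by blast
      next
        fix a assume "a \<in> J"
        then obtain b y where bw: "a = b \<oplus> y \<otimes> x" "b \<in> L" "y \<in> carrier C" by (auto simp: J_def)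
        then have "\<ominus> a = (\<ominus> b) \<oplus> (\<ominus> y) \<otimes> x"
          using LC x by (simp add: R.minus_add R.l_minus)
        then show "\<ominus> a \<in> J" using bw L.a_inv_closed by (auto simp: J_def)
      next
        fix a a' assume "a \<in> J" "a' \<in> J"
        then obtain b y b' y' where bw: "a = b \<oplus> y \<otimes> x" "b \<in> L" "y \<in> carrier C"
          "a' = b' \<oplus> y' \<otimes> x" "b' \<in> L" "y' \<in> carrier C" by (auto simp: J_def)
        then have "a \<oplus> a' = (b \<oplus> b') \<oplus> (y \<oplus> y') \<otimes> x"
          using LC x by (simp add: R.l_distr R.a_ac)
        moreover have "b \<oplus> b' \<in> L" using bw L.a_closed by blast
        ultimately show "a \<oplus> a' \<in> J" using bw by (auto simp: J_def)
      qed
    next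
      fix c a assume c: "c \<in> carrier C" and "a \<in> J"
      then obtain b y where bw: "a = b \<oplus> y \<otimes> x" "b \<in> L" "y \<in> carrier C" by (auto simp: J_def)
      then have "c \<otimes> a = (c \<otimes> b) \<oplus> (c \<otimes> y) \<otimes> x"
        using LC x c by (simp add: R.r_distr R.m_assoc)
      then show "c \<otimes> a \<in> J" using bw c mL by (auto simp: J_def)
    qed
    moreover have "L \<subseteq> J"
    proof
      fix a assume "a \<in> L"
      then have "a = a \<oplus> \<zero> \<otimes> x" using LC x by simp
      then show "a \<in> J" using \<open>a \<in> L\<close> by (auto simp: J_def)
    qed
    moreover have "x \<in> J"
    proof -
      have "x = \<zero> \<oplus> \<one> \<otimes> x" using x by simp
      then show ?thesis using L.zero_closed R.one_closed unfolding J_def by blast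
    qed
    ultimately have "\<one> \<in> J" using max[of J] xL by blast
    then obtain a y where ay: "\<one> = a \<oplus> y \<otimes> x" "a \<in> L" "y \<in> carrier C" by (auto simp: J_def)
    define t where "t = y \<otimes> x"
    have t: "t \<in> carrier C" using ay x by (simp add: t_def)
    have tt: "t \<otimes> t = \<zero>"
    proof -
      have "t \<otimes> t = y \<otimes> (x \<otimes> y \<otimes> x)" using ay x by (simp add: t_def R.m_assoc)
      then show ?thesis using nil ay by simp
    qed
    have "a \<oplus> t = \<one>" by (simp only: t_def ay(1)[symmetric])
    then have "t = t \<otimes> (a \<oplus> t)" using t by simp
    also have "\<dots> = t \<otimes> a" using t LC ay tt by (simp add: R.r_distr)
    finally have "t \<in> L" using mL[OF t ay(2)] by simp
    then have one: "\<one> \<in> L" using ay L.a_closed by (simp add: t_def)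
    have "carrier C \<subseteq> L"
    proof
      fix c assume "c \<in> carrier C"
      then show "c \<in> L" using mL[OF _ one, of c] by simp
    qed
    then show False using ne LC by blast
  qed
  then have "x \<in> jacobson_radical C" using x by (simp add: jacobson_radical_def)
  then show ?thesis using ss by (simp add: semisimple_alg_def)
qed

end

section \<open>Form and involution carried over to operators; the Gram matrix and the Casimir
  element\<close>

locale semisimple_star_alg = fd_alg C for C :: "(complex, 'a) module" (structure) +
  fixes l :: "'a \<Rightarrow> complex" and star :: "'a \<Rightarrow> 'a"
  assumes frob: "frobenius_pair C l" and invol: "involutive_anti_automorphism C star"
    and l_star: "x \<in> carrier C \<Longrightarrow> l (star x) = l x"
    and semisimple: "semisimple_alg C"
begin

lemma l_linear: "x \<in> carrier C \<Longrightarrow> y \<in> carrier C \<Longrightarrow> l (x \<oplus> y) = l x + l y"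
  "x \<in> carrier C \<Longrightarrow> l (c \<odot> x) = c * l x"
  "x \<in> carrier C \<Longrightarrow> y \<in> carrier C \<Longrightarrow> l (x \<otimes> y) = l (y \<otimes> x)"
  "x \<in> carrier C \<Longrightarrow> (\<And>y. y \<in> carrier C \<Longrightarrow> l (x \<otimes> y) = 0) \<Longrightarrow> x = \<zero>"
  using frob by (auto simp: frobenius_pair_def)

lemma star_props: "x \<in> carrier C \<Longrightarrow> star x \<in> carrier C"
  "x \<in> carrier C \<Longrightarrow> y \<in> carrier C \<Longrightarrow> star (x \<oplus> y) = star x \<oplus> star y"
  "x \<in> carrier C \<Longrightarrow> star (c \<odot> x) = c \<odot> star x"
  "x \<in> carrier C \<Longrightarrow> y \<in> carrier C \<Longrightarrow> star (x \<otimes> y) = star y \<otimes> star x"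
  "x \<in> carrier C \<Longrightarrow> star (star x) = x"
  using invol by (auto simp: involutive_anti_automorphism_def LinearCombinations.module_hom_def)

definition lE :: "lin_op \<Rightarrow> complex" where
  "lE x = l (\<tau> x)"

definition starE :: "lin_op \<Rightarrow> lin_op" where
  "starE x = \<rho> (star (\<tau> x))"

lemma starE_\<rho>: "x \<in> carrier C \<Longrightarrow> starE (\<rho> x) = \<rho> (star x)"
  by (simp add: starE_def)

lemma lE_\<rho>: "x \<in> carrier C \<Longrightarrow> lE (\<rho> x) = l x"
  by (simp add: lE_def)

sublocale E: involutive_frobenius scale_op SC "\<rho> \<one>" lE starE
proof (unfold_locales, goal_cases)
  case (8)
  show ?case using SC_span by (intro exI[of _ "(\<lambda>i. \<rho> (\<gamma> ! i)) ` {..<N}"]) auto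
next
  case (12 x)
  have "\<tau> x = \<zero>"
  proof (rule l_linear(4))
    fix y assume "y \<in> carrier C"
    then show "l (\<tau> x \<otimes> y) = 0"
      using 12(2)[of "\<rho> y"] 12(1) by (simp add: lE_def \<tau>_mult)
  qed (use 12 in auto)
  then show ?case using 12(1) \<rho>_\<tau> \<rho>_zero by metis
next
  case (19 x)
  have "\<tau> x = \<zero>"
  proof (rule semiprime_of_semisimple[OF semisimple])
    fix y assume y: "y \<in> carrier C"
    then have "\<tau> (x * \<rho> y * x) = \<tau> x \<otimes> y \<otimes> \<tau> x"
      using 19(1) SC_closed by (simp add: \<tau>_mult)
    then show "\<tau> x \<otimes> y \<otimes> \<tau> x = \<zero>" using 19(2)[of "\<rho> y"] y by (simp add: \<tau>_zero)
  qed (use 19 in auto)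
  then show ?case using 19(1) \<rho>_\<tau> \<rho>_zero by metis
qed (auto simp: SC_closed \<rho>_mult[symmetric] \<rho>_add[symmetric] \<rho>_smult[symmetric] \<rho>_zero[symmetric]
  lE_def starE_def l_linear star_props l_star)

text \<open>A vector killed by the Gram matrix consists of the coordinates of an element in the
  radical of the form.\<close>

lemma gram_inverse:
  defines "G \<equiv> mat N N (\<lambda>(i, j). l (\<gamma> ! i \<otimes> \<gamma> ! j))"
  shows "\<exists>F. F \<in> carrier_mat N N \<and> inverts_mat F G \<and> inverts_mat G F"
proof -
  have G: "G \<in> carrier_mat N N" by (simp add: G_def)
  have "det G \<noteq> 0"
  proof
    assume "det G = 0"
    then obtain v where v: "v \<in> carrier_vec N" "v \<noteq> 0\<^sub>v N" "G *\<^sub>v v = 0\<^sub>v N"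
      using det_0_iff_vec_prod_zero_field[OF G] by blast
    define x where "x = cf (\<lambda>i. v $ i)"
    have x: "x \<in> carrier C" by (simp add: x_def)
    have gx: "l (\<gamma> ! i \<otimes> x) = 0" if i: "i < N" for i
    proof -
      have gi: "\<gamma> ! i \<in> carrier C" using basis_closed[OF i] .
      have "l (\<gamma> ! i \<otimes> x) = (\<Sum>j<N. co x j * l (\<gamma> ! i \<otimes> \<gamma> ! j))"
        by (rule linear_via_coordinates[OF x, of "\<lambda>x. l (\<gamma> ! i \<otimes> x)"])
          (use gi in \<open>auto simp: R.r_distr l_linear mult_smult\<close>)
      also have "\<dots> = (\<Sum>j<N. v $ j * l (\<gamma> ! i \<otimes> \<gamma> ! j))"
        by (intro sum.cong refl arg_cong2[of _ _ _ _ "(*)"])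
          (use cf_inj[of "co x" "\<lambda>i. v $ i"] co(1)[OF x] in \<open>auto simp: x_def\<close>)
      also have "\<dots> = (G *\<^sub>v v) $ i"
        using i v(1) by (auto simp: G_def scalar_prod_def lessThan_atLeast0 mult.commute intro!: sum.cong)
      finally show ?thesis using v(3) i by simp
    qed
    have "x = \<zero>"
    proof (rule l_linear(4)[OF x])
      fix y assume y: "y \<in> carrier C"
      have "l (x \<otimes> y) = l (y \<otimes> x)" using x y by (rule l_linear(3))
      also have "\<dots> = (\<Sum>i<N. co y i * l (\<gamma> ! i \<otimes> x))"
        by (rule linear_via_coordinates[OF y, of "\<lambda>y. l (y \<otimes> x)"])
          (use x in \<open>auto simp: R.l_distr l_linear mult_smult\<close>)
      finally show "l (x \<otimes> y) = 0" by (simp add: gx)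
    qed
    also have "\<zero> = cf (\<lambda>i. 0)" using cf_scale[of 0 "\<lambda>i. 0"] V.smult_l_null[of "cf (\<lambda>i. 0)"] by simp
    finally have "v $ i = 0" if "i < N" for i using cf_inj[OF _ that] unfolding x_def by blast
    then show False using v(1,2) by auto
  qed
  then have "G \<in> Units (ring_mat TYPE(complex) N ())" by (rule det_non_zero_imp_unit[OF G])
  then obtain F where "F \<in> carrier_mat N N" "F * G = 1\<^sub>m N" "G * F = 1\<^sub>m N"
    unfolding Units_def ring_mat_def by auto
  then show ?thesis using G unfolding inverts_mat_def by auto
qed

text \<open>The coordinates of z are the values of f on the basis times the inverse Gram matrix.
  This supplies the existence behind \<open>phi_dual\<close>.\<close>

lemma ex_representing_element:
  assumes f_add: "\<And>x y. x \<in> carrier C \<Longrightarrow> y \<in> carrier C \<Longrightarrow> f (x \<oplus> y) = f x + f y"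
    and f_smult: "\<And>c x. x \<in> carrier C \<Longrightarrow> f (c \<odot> x) = c * f x"
  shows "\<exists>z\<in>carrier C. \<forall>a\<in>carrier C. l (z \<otimes> a) = f a"
proof -
  define G where "G = mat N N (\<lambda>(i, j). l (\<gamma> ! i \<otimes> \<gamma> ! j))"
  obtain F where F: "F \<in> carrier_mat N N" "F * G = 1\<^sub>m N"
    using gram_inverse unfolding G_def inverts_mat_def by auto
  define v where "v i = (\<Sum>j<N. f (\<gamma> ! j) * F $$ (j, i))" for i
  define z where "z = cf (\<lambda>i. if i < N then v i else 0)"
  have z: "z \<in> carrier C" by (simp add: z_def)
  have coz: "co z = (\<lambda>i. if i < N then v i else 0)" by (rule co_eqI) (auto simp: z_def)
  have zg: "l (z \<otimes> \<gamma> ! m) = f (\<gamma> ! m)" if m: "m < N" for m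
  proof -
    have "l (z \<otimes> \<gamma> ! m) = (\<Sum>i<N. co z i * l (\<gamma> ! i \<otimes> \<gamma> ! m))"
      by (rule linear_via_coordinates[OF z, of "\<lambda>z. l (z \<otimes> \<gamma> ! m)"])
        (use basis_closed[OF m] in \<open>auto simp: R.l_distr l_linear mult_smult\<close>)
    also have "\<dots> = (\<Sum>i<N. \<Sum>j<N. f (\<gamma> ! j) * (F $$ (j, i) * G $$ (i, m)))"
      using m by (simp add: coz v_def G_def sum_distrib_right mult.assoc)
    also have "\<dots> = (\<Sum>j<N. \<Sum>i<N. f (\<gamma> ! j) * (F $$ (j, i) * G $$ (i, m)))" by (rule sum.swap)
    also have "\<dots> = (\<Sum>j<N. f (\<gamma> ! j) * (F * G) $$ (j, m))"
      using F(1) m by (intro sum.cong refl)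
        (auto simp: G_def scalar_prod_def lessThan_atLeast0 sum_distrib_left intro!: sum.cong)
    also have "\<dots> = (\<Sum>j<N. if j = m then f (\<gamma> ! m) else 0)"
      unfolding F(2) by (intro sum.cong refl) (use m in auto)
    finally show ?thesis using m by simp
  qed
  have "l (z \<otimes> a) = f a" if a: "a \<in> carrier C" for a
  proof -
    have "l (z \<otimes> a) = (\<Sum>i<N. co a i * l (z \<otimes> \<gamma> ! i))"
      by (rule linear_via_coordinates[OF a, of "\<lambda>a. l (z \<otimes> a)"])
        (use z in \<open>auto simp: R.r_distr l_linear mult_smult\<close>)
    also have "\<dots> = (\<Sum>i<N. co a i * f (\<gamma> ! i))" by (simp add: zg)
    also have "\<dots> = f a" by (rule linear_via_coordinates[OF a, symmetric]) (auto simp: f_add f_smult)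
    finally show ?thesis .
  qed
  with z show ?thesis by blast
qed

text \<open>The sum of F_ij times the tensor of basis vectors i and j is the Casimir tensor of the
  form, and any dual-basis presentation computes it. Multiplying by star z replaces star \<gamma>_j
  with star (z \<gamma>_j), which the presentation of z expands. The remaining sum over j of F_ij l
  (\<gamma>_j w_k) is the i-th coordinate of w_k, and summing over i restores w_k.\<close>

lemma
  shows K_star_closed: "K_star C l star \<in> carrier C"
    and K_star_casimir: "\<And>z m w y. z \<in> SC \<Longrightarrow> (\<And>k. k < (m::nat) \<Longrightarrow> w k \<in> SC \<and> y k \<in> SC) \<Longrightarrow>
      (\<And>b. b \<in> SC \<Longrightarrow> z * b = (\<Sum>k<m. scale_op (lE (b * w k)) (y k))) \<Longrightarrow>
      \<rho> (K_star C l star) * starE z = (\<Sum>k<m. w k * starE (y k))"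
proof -
  define G where "G = mat N N (\<lambda>(i, j). l (\<gamma> ! i \<otimes> \<gamma> ! j))"
  define F where "F = (SOME F. F \<in> carrier_mat N N \<and> inverts_mat F G \<and> inverts_mat G F)"
  have F: "F \<in> carrier_mat N N" "inverts_mat F G"
    using someI_ex[OF gram_inverse] unfolding F_def G_def by auto
  have FG: "F * G = 1\<^sub>m N" using F by (simp add: inverts_mat_def)
  have K: "K_star C l star = (\<Oplus>i\<in>{..<N}. \<Oplus>j\<in>{..<N}. F $$ (i, j) \<odot> (\<gamma> ! i \<otimes> star (\<gamma> ! j)))"
    unfolding K_star_def Let_def F_def G_def ..
  have cl: "F $$ (i, j) \<odot> (\<gamma> ! i \<otimes> star (\<gamma> ! j)) \<in> carrier C" if "i < N" "j < N" for i j
    using that by (simp add: basis_closed star_props)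
  show KC: "K_star C l star \<in> carrier C"
    unfolding K by (intro R.finsum_closed) (auto intro!: R.finsum_closed cl)
  have \<rho>K: "\<rho> (K_star C l star) = (\<Sum>i<N. \<Sum>j<N. scale_op (F $$ (i, j)) (\<rho> (\<gamma> ! i) * starE (\<rho> (\<gamma> ! j))))"
  proof -
    have "\<rho> (K_star C l star) = (\<Sum>i<N. \<rho> (\<Oplus>j\<in>{..<N}. F $$ (i, j) \<odot> (\<gamma> ! i \<otimes> star (\<gamma> ! j))))"
      unfolding K by (rule \<rho>_finsum) (auto intro!: R.finsum_closed cl)
    also have "\<dots> = (\<Sum>i<N. \<Sum>j<N. \<rho> (F $$ (i, j) \<odot> (\<gamma> ! i \<otimes> star (\<gamma> ! j))))"
      by (intro sum.cong refl \<rho>_finsum) (auto intro!: cl)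
    also have "\<dots> = (\<Sum>i<N. \<Sum>j<N. scale_op (F $$ (i, j)) (\<rho> (\<gamma> ! i) * starE (\<rho> (\<gamma> ! j))))"
      by (intro sum.cong refl) (auto simp: \<rho>_smult \<rho>_mult basis_closed star_props starE_\<rho>)
    finally show ?thesis .
  qed
  have coF: "co x i = (\<Sum>j<N. F $$ (i, j) * l (\<gamma> ! j \<otimes> x))" if x: "x \<in> carrier C" and i: "i < N" for x i
  proof -
    have "l (\<gamma> ! j \<otimes> x) = (\<Sum>m<N. G $$ (j, m) * co x m)" if j: "j < N" for j
    proof -
      have "l (\<gamma> ! j \<otimes> x) = (\<Sum>m<N. co x m * l (\<gamma> ! j \<otimes> \<gamma> ! m))"
        by (rule linear_via_coordinates[OF x, of "\<lambda>x. l (\<gamma> ! j \<otimes> x)"])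
          (use basis_closed[OF j] in \<open>auto simp: R.r_distr l_linear mult_smult\<close>)
      then show ?thesis using j by (simp add: G_def mult.commute)
    qed
    then have "(\<Sum>j<N. F $$ (i, j) * l (\<gamma> ! j \<otimes> x)) = (\<Sum>j<N. \<Sum>m<N. F $$ (i, j) * G $$ (j, m) * co x m)"
      by (simp add: sum_distrib_left mult.assoc)
    also have "\<dots> = (\<Sum>m<N. \<Sum>j<N. F $$ (i, j) * G $$ (j, m) * co x m)" by (rule sum.swap)
    also have "\<dots> = (\<Sum>m<N. (F * G) $$ (i, m) * co x m)"
    proof (intro sum.cong refl)
      fix m assume "m \<in> {..<N}"
      then have "(F * G) $$ (i, m) = (\<Sum>j<N. F $$ (i, j) * G $$ (j, m))"
        using F(1) i by (auto simp: G_def scalar_prod_def lessThan_atLeast0 intro!: sum.cong)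
      then show "(\<Sum>j<N. F $$ (i, j) * G $$ (j, m) * co x m) = (F * G) $$ (i, m) * co x m"
        by (simp add: sum_distrib_right)
    qed
    also have "\<dots> = (\<Sum>m<N. if m = i then co x i else 0)"
      unfolding FG by (intro sum.cong refl) (use i in auto)
    finally show ?thesis using i by simp
  qed
  fix z m w y
  assume z: "z \<in> SC" and wy: "\<And>k. k < (m::nat) \<Longrightarrow> w k \<in> SC \<and> y k \<in> SC"
    and eq: "\<And>b. b \<in> SC \<Longrightarrow> z * b = (\<Sum>k<m. scale_op (lE (b * w k)) (y k))"
  have gS: "\<rho> (\<gamma> ! i) \<in> SC" if "i < N" for i using basis_closed[OF that] by simp
  have "\<rho> (K_star C l star) * starE z =
      (\<Sum>i<N. \<Sum>j<N. scale_op (F $$ (i, j)) (\<rho> (\<gamma> ! i) * starE (z * \<rho> (\<gamma> ! j))))"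
    unfolding \<rho>K sum_distrib_right
    by (intro sum.cong refl) (use z gS in \<open>auto simp: E.star_mult mult.assoc\<close>)
  also have "\<dots> = (\<Sum>i<N. \<Sum>j<N. \<Sum>k<m.
      scale_op (F $$ (i, j) * lE (\<rho> (\<gamma> ! j) * w k)) (\<rho> (\<gamma> ! i) * starE (y k)))"
  proof (intro sum.cong refl)
    fix i j assume "i \<in> {..<N}" "j \<in> {..<N}"
    then have ij: "i < N" "j < N" by auto
    have "starE (z * \<rho> (\<gamma> ! j)) = (\<Sum>k<m. starE (scale_op (lE (\<rho> (\<gamma> ! j) * w k)) (y k)))"
      unfolding eq[OF gS[OF ij(2)]] by (rule E.star_sum) (use wy in auto)
    also have "\<dots> = (\<Sum>k<m. scale_op (lE (\<rho> (\<gamma> ! j) * w k)) (starE (y k)))"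
      by (intro sum.cong refl E.star_scale) (use wy in auto)
    finally show "scale_op (F $$ (i, j)) (\<rho> (\<gamma> ! i) * starE (z * \<rho> (\<gamma> ! j))) =
        (\<Sum>k<m. scale_op (F $$ (i, j) * lE (\<rho> (\<gamma> ! j) * w k)) (\<rho> (\<gamma> ! i) * starE (y k)))"
      by (simp add: sum_distrib_left op.scale_sum_right)
  qed
  also have "\<dots> = (\<Sum>k<m. \<Sum>i<N. \<Sum>j<N.
      scale_op (F $$ (i, j) * lE (\<rho> (\<gamma> ! j) * w k)) (\<rho> (\<gamma> ! i) * starE (y k)))"
    by (subst sum.swap[of _ "{..<m}"]) (intro sum.cong refl sum.swap)
  also have "\<dots> = (\<Sum>k<m. w k * starE (y k))"
  proof (intro sum.cong refl)
    fix k assume "k \<in> {..<m}"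
    then have k: "w k \<in> SC" "y k \<in> SC" using wy by auto
    have "(\<Sum>j<N. scale_op (F $$ (i, j) * lE (\<rho> (\<gamma> ! j) * w k)) (\<rho> (\<gamma> ! i) * starE (y k))) =
        scale_op (co (\<tau> (w k)) i) (\<rho> (\<gamma> ! i)) * starE (y k)" if i: "i < N" for i
    proof -
      have "lE (\<rho> (\<gamma> ! j) * w k) = l (\<gamma> ! j \<otimes> \<tau> (w k))" if "j < N" for j
        using k gS[OF that] basis_closed[OF that] by (simp add: lE_def \<tau>_mult)
      then have "co (\<tau> (w k)) i = (\<Sum>j<N. F $$ (i, j) * lE (\<rho> (\<gamma> ! j) * w k))"
        using coF[OF \<tau>_closed[OF k(1)] i] by simp
      then show ?thesis by (simp add: op.scale_sum_left sum_distrib_right)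
    qed
    then have "(\<Sum>i<N. \<Sum>j<N. scale_op (F $$ (i, j) * lE (\<rho> (\<gamma> ! j) * w k)) (\<rho> (\<gamma> ! i) * starE (y k))) =
        (\<Sum>i<N. scale_op (co (\<tau> (w k)) i) (\<rho> (\<gamma> ! i))) * starE (y k)"
      by (simp add: sum_distrib_right)
    also have "(\<Sum>i<N. scale_op (co (\<tau> (w k)) i) (\<rho> (\<gamma> ! i))) = w k"
      using \<rho>_expansion[OF \<tau>_closed[OF k(1)]] k by simp
    finally show "(\<Sum>i<N. \<Sum>j<N. scale_op (F $$ (i, j) * lE (\<rho> (\<gamma> ! j) * w k)) (\<rho> (\<gamma> ! i) * starE (y k))) =
        w k * starE (y k)" .
  qed
  finally show "\<rho> (K_star C l star) * starE z = (\<Sum>k<m. w k * starE (y k))" .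
qed

end

section \<open>The isomorphism\<close>

locale semisimple_ecf_alg =
  fixes X :: "('a, 'b) ecf_data"
  assumes ecf: "equipped_cardy_frobenius X" and ss: "semisimple_ecf X"
begin

abbreviation "A \<equiv> algA X"
abbreviation "B \<equiv> algB X"

sublocale XA: semisimple_star_alg A "formA X" "starA X"
  using ecf ss
  by unfold_locales
    (auto simp: equipped_cardy_frobenius_def cardy_frobenius_def frobenius_pair_def semisimple_ecf_def)

sublocale XB: semisimple_star_alg B "formB X" "starB X"
  using ecf ss
  by unfold_locales
    (auto simp: equipped_cardy_frobenius_def cardy_frobenius_def frobenius_pair_def semisimple_ecf_def)

lemma phi_props:
  "a \<in> carrier A \<Longrightarrow> phi X a \<in> carrier B"
  "a \<in> carrier A \<Longrightarrow> a' \<in> carrier A \<Longrightarrow> phi X (a \<oplus>\<^bsub>A\<^esub> a') = phi X a \<oplus>\<^bsub>B\<^esub> phi X a'"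
  "a \<in> carrier A \<Longrightarrow> a' \<in> carrier A \<Longrightarrow> phi X (a \<otimes>\<^bsub>A\<^esub> a') = phi X a \<otimes>\<^bsub>B\<^esub> phi X a'"
  "a \<in> carrier A \<Longrightarrow> phi X (c \<odot>\<^bsub>A\<^esub> a) = c \<odot>\<^bsub>B\<^esub> phi X a"
  "phi X \<one>\<^bsub>A\<^esub> = \<one>\<^bsub>B\<^esub>"
  "a \<in> carrier A \<Longrightarrow> b \<in> carrier B \<Longrightarrow> phi X a \<otimes>\<^bsub>B\<^esub> b = b \<otimes>\<^bsub>B\<^esub> phi X a"
  "a \<in> carrier A \<Longrightarrow> phi X (starA X a) = starB X (phi X a)"
proof -
  have h: "phi X \<in> Ring.ring_hom A B" "phi X \<in> LinearCombinations.module_hom class_ring A B"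
    "phi X ` carrier A \<subseteq> ring_center B" "\<forall>a\<in>carrier A. phi X (starA X a) = starB X (phi X a)"
    using ecf by (auto simp: equipped_cardy_frobenius_def cardy_frobenius_def alg_hom_def)
  show "a \<in> carrier A \<Longrightarrow> phi X a \<in> carrier B"
    "a \<in> carrier A \<Longrightarrow> a' \<in> carrier A \<Longrightarrow> phi X (a \<oplus>\<^bsub>A\<^esub> a') = phi X a \<oplus>\<^bsub>B\<^esub> phi X a'"
    "a \<in> carrier A \<Longrightarrow> a' \<in> carrier A \<Longrightarrow> phi X (a \<otimes>\<^bsub>A\<^esub> a') = phi X a \<otimes>\<^bsub>B\<^esub> phi X a'"
    "phi X \<one>\<^bsub>A\<^esub> = \<one>\<^bsub>B\<^esub>"
    using h(1) by (auto simp: Ring.ring_hom_def)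
  show "a \<in> carrier A \<Longrightarrow> phi X (c \<odot>\<^bsub>A\<^esub> a) = c \<odot>\<^bsub>B\<^esub> phi X a"
    using h(2) by (auto simp: LinearCombinations.module_hom_def)
  show "a \<in> carrier A \<Longrightarrow> b \<in> carrier B \<Longrightarrow> phi X a \<otimes>\<^bsub>B\<^esub> b = b \<otimes>\<^bsub>B\<^esub> phi X a"
    using h(3) by (auto simp: ring_center_def)
  show "a \<in> carrier A \<Longrightarrow> phi X (starA X a) = starB X (phi X a)" using h(4) by blast
qed

lemma A_comm: "a \<in> carrier A \<Longrightarrow> a' \<in> carrier A \<Longrightarrow> a \<otimes>\<^bsub>A\<^esub> a' = a' \<otimes>\<^bsub>A\<^esub> a"
proof -
  have "cring A" using ecf by (auto simp: equipped_cardy_frobenius_def cardy_frobenius_def)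
  then interpret cring A .
  show "a \<in> carrier A \<Longrightarrow> a' \<in> carrier A \<Longrightarrow> a \<otimes>\<^bsub>A\<^esub> a' = a' \<otimes>\<^bsub>A\<^esub> a" by (rule m_comm)
qed

text \<open>Non-degeneracy of the form on A gives both existence and uniqueness, so the description
  by \<open>THE\<close> denotes the dual map.\<close>

lemma phi_dual:
  assumes b: "b \<in> carrier B"
  shows "phi_dual X b \<in> carrier A"
    "a \<in> carrier A \<Longrightarrow> formA X (phi_dual X b \<otimes>\<^bsub>A\<^esub> a) = formB X (b \<otimes>\<^bsub>B\<^esub> phi X a)"
proof -
  define P where "P z \<longleftrightarrow> z \<in> carrier A \<and>
    (\<forall>a\<in>carrier A. formA X (z \<otimes>\<^bsub>A\<^esub> a) = formB X (b \<otimes>\<^bsub>B\<^esub> phi X a))" for z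
  have "\<exists>z\<in>carrier A. \<forall>a\<in>carrier A. formA X (z \<otimes>\<^bsub>A\<^esub> a) = formB X (b \<otimes>\<^bsub>B\<^esub> phi X a)"
    by (rule XA.ex_representing_element[of "\<lambda>a. formB X (b \<otimes>\<^bsub>B\<^esub> phi X a)"])
      (use b in \<open>auto simp: phi_props XB.R.r_distr XB.l_linear XB.mult_smult\<close>)
  then obtain z where z: "P z" by (auto simp: P_def)
  have uniq: "z' = z" if z': "P z'" for z'
  proof -
    have zz: "z \<in> carrier A" "z' \<in> carrier A" using z z' by (auto simp: P_def)
    have "XA.\<rho> z' - XA.\<rho> z = 0"
    proof (rule XA.E.l_nondegenerate)
      show "XA.\<rho> z' - XA.\<rho> z \<in> XA.SC" using zz by (intro XA.E.diff_closed) auto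
      fix y assume "y \<in> XA.SC"
      then obtain a where a: "a \<in> carrier A" "y = XA.\<rho> a" by auto
      have "XA.lE (XA.\<rho> z' * y) = XA.lE (XA.\<rho> z * y)"
        using z z' zz a by (simp add: XA.\<rho>_mult[symmetric] XA.lE_\<rho> P_def)
      then show "XA.lE ((XA.\<rho> z' - XA.\<rho> z) * y) = 0"
        using zz a by (simp add: left_diff_distrib XA.E.l_diff)
    qed
    then show ?thesis using XA.inj_\<rho> zz by (simp add: inj_on_def)
  qed
  have "phi_dual X b = z" unfolding phi_dual_def P_def[symmetric] using z uniq by (rule the_equality)
  then show "phi_dual X b \<in> carrier A"
    "a \<in> carrier A \<Longrightarrow> formA X (phi_dual X b \<otimes>\<^bsub>A\<^esub> a) = formB X (b \<otimes>\<^bsub>B\<^esub> phi X a)"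
    using z by (auto simp: P_def)
qed

definition phiE :: "lin_op \<Rightarrow> lin_op" where
  "phiE x = XB.\<rho> (phi X (XA.\<tau> x))"

definition pdE :: "lin_op \<Rightarrow> lin_op" where
  "pdE x = XA.\<rho> (phi_dual X (XB.\<tau> x))"

definition UE :: lin_op where
  "UE = XA.\<rho> (elemU X)"

definition KE :: lin_op where
  "KE = XB.\<rho> (K_star B (formB X) (starB X))"

lemma phiE_\<rho>: "a \<in> carrier A \<Longrightarrow> phiE (XA.\<rho> a) = XB.\<rho> (phi X a)"
  by (simp add: phiE_def)

lemma U_props: "elemU X \<in> carrier A" "phi X (elemU X) = K_star B (formB X) (starB X)"
  using ecf by (auto simp: equipped_cardy_frobenius_def)

sublocale W: cardy_frobenius_data scale_op XA.SC "XA.\<rho> \<one>\<^bsub>A\<^esub>" XA.lE XA.starE XB.SC "XB.\<rho> \<one>\<^bsub>B\<^esub>" XB.lE XB.starE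
  phiE pdE UE KE
proof (unfold_locales, goal_cases)
  case (11 b' b'' N w y)
  have b: "XB.\<tau> b' \<in> carrier B" "XB.\<tau> b'' \<in> carrier B" using 11 by auto
  have "XA.lE (pdE b' * pdE b'') = formA X (phi_dual X (XB.\<tau> b') \<otimes>\<^bsub>A\<^esub> phi_dual X (XB.\<tau> b''))"
    using b phi_dual(1) by (simp add: pdE_def XA.\<rho>_mult[symmetric] XA.lE_\<rho>)
  also have "\<dots> = lin_trace B (\<lambda>b. XB.\<tau> b' \<otimes>\<^bsub>B\<^esub> b \<otimes>\<^bsub>B\<^esub> XB.\<tau> b'')"
    using ecf b by (auto simp: equipped_cardy_frobenius_def cardy_frobenius_def)
  also have "\<dots> = (\<Sum>k<N. formB X (XB.\<tau> (y k) \<otimes>\<^bsub>B\<^esub> XB.\<tau> (w k)))"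
  \<comment> \<open>The assumed presentation of b |-> b' b b'' is exactly the input needed to
    evaluate the basis-dependent trace.\<close>
  proof (rule XB.lin_trace_eq[of _ N y "\<lambda>k b. formB X (b \<otimes>\<^bsub>B\<^esub> XB.\<tau> (w k))"])
    fix b assume bb: "b \<in> carrier B"
    have "XB.\<rho> (XB.\<tau> b' \<otimes>\<^bsub>B\<^esub> b \<otimes>\<^bsub>B\<^esub> XB.\<tau> b'') = b' * XB.\<rho> b * b''"
      using b bb 11 by (simp add: XB.\<rho>_mult)
    also have "\<dots> = (\<Sum>k<N. scale_op (XB.lE (XB.\<rho> b * w k)) (y k))"
      using 11(4)[of "XB.\<rho> b"] bb by simp
    also have "\<dots> = (\<Sum>k<N. scale_op (formB X (b \<otimes>\<^bsub>B\<^esub> XB.\<tau> (w k))) (y k))"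
      by (intro sum.cong refl arg_cong2[of _ _ _ _ scale_op])
        (use 11(3) bb in \<open>simp add: XB.lE_def XB.\<tau>_mult\<close>)
    finally show "XB.\<rho> (XB.\<tau> b' \<otimes>\<^bsub>B\<^esub> b \<otimes>\<^bsub>B\<^esub> XB.\<tau> b'') =
      (\<Sum>k<N. scale_op (formB X (b \<otimes>\<^bsub>B\<^esub> XB.\<tau> (w k))) (y k))" .
  qed (use b 11(3) in \<open>auto simp: XB.R.l_distr XB.l_linear XB.mult_smult\<close>)
  also have "\<dots> = (\<Sum>k<N. XB.lE (y k * w k))"
    by (intro sum.cong refl) (use 11(3) in \<open>simp add: XB.lE_def XB.\<tau>_mult\<close>)
  finally show ?case .
next
  case (6 a b)
  then obtain a' b' where ab: "a' \<in> carrier A" "a = XA.\<rho> a'" "b' \<in> carrier B" "b = XB.\<rho> b'" by blast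
  then have "phiE a * b = XB.\<rho> (phi X a' \<otimes>\<^bsub>B\<^esub> b')" "b * phiE a = XB.\<rho> (b' \<otimes>\<^bsub>B\<^esub> phi X a')"
    by (simp_all add: phiE_\<rho> phi_props(1) XB.\<rho>_mult)
  then show ?case using phi_props(6)[OF ab(1,3)] by simp
next
  case (8 a a')
  then obtain x x' where x: "x \<in> carrier A" "a = XA.\<rho> x" "x' \<in> carrier A" "a' = XA.\<rho> x'" by blast
  then show ?case using A_comm[OF x(1,3)] by (simp add: XA.\<rho>_mult[symmetric])
next
  case (12 z N w y)
  then show ?case unfolding KE_def by (intro XB.K_star_casimir) auto
next
  case (10 b a)
  then show ?case using phi_dual
    by (auto simp: pdE_def phiE_def XA.\<rho>_mult[symmetric] XB.\<rho>_mult[symmetric] XA.lE_\<rho> XB.lE_\<rho> phi_props(1))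
qed (auto simp: phiE_def pdE_def UE_def KE_def phi_props(1-5,7) phi_dual U_props XB.K_star_closed
  XA.starE_\<rho> XB.starE_\<rho> XA.star_props
  XA.\<rho>_mult[symmetric] XA.\<rho>_add[symmetric] XA.\<rho>_smult[symmetric]
  XB.\<rho>_mult[symmetric] XB.\<rho>_add[symmetric] XB.\<rho>_smult[symmetric])

end

lemma alg_isoI:
  assumes closed: "\<And>x. x \<in> carrier C \<Longrightarrow> f x \<in> carrier C'"
    and mult: "\<And>x y. x \<in> carrier C \<Longrightarrow> y \<in> carrier C \<Longrightarrow> f (x \<otimes>\<^bsub>C\<^esub> y) = f x \<otimes>\<^bsub>C'\<^esub> f y"
    and add: "\<And>x y. x \<in> carrier C \<Longrightarrow> y \<in> carrier C \<Longrightarrow> f (x \<oplus>\<^bsub>C\<^esub> y) = f x \<oplus>\<^bsub>C'\<^esub> f y"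
    and one: "f \<one>\<^bsub>C\<^esub> = \<one>\<^bsub>C'\<^esub>"
    and smult: "\<And>c x. x \<in> carrier C \<Longrightarrow> f (c \<odot>\<^bsub>C\<^esub> x) = c \<odot>\<^bsub>C'\<^esub> f x"
    and inj: "\<And>x y. x \<in> carrier C \<Longrightarrow> y \<in> carrier C \<Longrightarrow> f x = f y \<Longrightarrow> x = y"
    and surj: "\<And>y. y \<in> carrier C' \<Longrightarrow> \<exists>x\<in>carrier C. f x = y"
  shows "f \<in> alg_iso C C'"
proof -
  have "f \<in> Ring.ring_hom C C'" by (rule ring_hom_memI) (use closed mult add one in auto)
  moreover have "f \<in> LinearCombinations.module_hom class_ring C C'"
    using closed add smult by (simp add: LinearCombinations.module_hom_def)
  moreover have "bij_betw f (carrier C) (carrier C')"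
    by (rule bij_betw_imageI) (use closed inj surj in \<open>auto intro!: inj_onI, blast\<close>)
  ultimately show ?thesis by (simp add: alg_iso_def ring_iso_def)
qed

section \<open>Construction of the isomorphism and its compatibility with the structure\<close>

locale semisimple_ecf_blocks = semisimple_ecf_alg X +
  Z: cardy_blocks scale_op XA.SC "XA.\<rho> \<one>\<^bsub>A\<^esub>" XA.lE XA.starE XB.SC "XB.\<rho> \<one>\<^bsub>B\<^esub>" XB.lE XB.starE
    phiE pdE UE KE k D n \<mu> \<Gamma>
  for X :: "('a, 'b) ecf_data" and k D n \<mu> \<Gamma>
begin

abbreviation "Y \<equiv> ecf_sum2 (ecf_sum {..<k} (\<lambda>i. H_ecf (D i) (n i) (\<mu> i))) (ecf_ker X)"
abbreviation "Ker \<equiv> a_kernel A B (phi X)"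

lemma Ker_iff: "x \<in> Ker \<longleftrightarrow> x \<in> carrier A \<and> XA.\<rho> x \<in> Z.kerA"
proof -
  have "phi X x = \<zero>\<^bsub>B\<^esub> \<longleftrightarrow> XB.\<rho> (phi X x) = 0" if "x \<in> carrier A"
    using XB.inj_\<rho> XB.\<rho>_zero phi_props(1)[OF that] by (metis inj_on_eq_iff XB.R.zero_closed)
  then show ?thesis
    by (cases "x \<in> carrier A") (simp_all add: a_kernel_def' Z.kerA_def phiE_\<rho>)
qed

lemma \<tau>_ker: "x \<in> Z.kerA \<Longrightarrow> XA.\<tau> x \<in> Ker \<and> XA.\<rho> (XA.\<tau> x) = x"
  by (auto simp: Ker_iff Z.kerA_def)

text \<open>A two-sided unit of an ideal is unique, so \<open>THE\<close> returns the element
  represented by \<open>\<kappa>\<close>.\<close>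

lemma ker_unit_eq: "XA.\<rho> (ker_unit X) = Z.\<kappa>" "ker_unit X \<in> Ker"
proof -
  have k: "XA.\<tau> Z.\<kappa> \<in> Ker" "XA.\<rho> (XA.\<tau> Z.\<kappa>) = Z.\<kappa>" using \<tau>_ker[OF Z.\<kappa>_ker] by auto
  have kc: "XA.\<tau> Z.\<kappa> \<in> carrier A" using k Ker_iff by blast
  have unit: "XA.\<tau> Z.\<kappa> \<otimes>\<^bsub>A\<^esub> x = x \<and> x \<otimes>\<^bsub>A\<^esub> XA.\<tau> Z.\<kappa> = x" if x: "x \<in> Ker" for x
  proof -
    have xc: "x \<in> carrier A" and xk: "XA.\<rho> x \<in> Z.kerA" using x Ker_iff by auto
    have "XA.\<rho> (XA.\<tau> Z.\<kappa> \<otimes>\<^bsub>A\<^esub> x) = XA.\<rho> x" "XA.\<rho> (x \<otimes>\<^bsub>A\<^esub> XA.\<tau> Z.\<kappa>) = XA.\<rho> x"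
      using xc kc k xk Z.\<kappa>_unit by (simp_all add: XA.\<rho>_mult)
    then show ?thesis using XA.inj_\<rho> xc kc by (metis inj_on_eq_iff XA.R.m_closed)
  qed
  have "ker_unit X = XA.\<tau> Z.\<kappa>"
    unfolding ker_unit_def
  proof (rule the_equality)
    show "XA.\<tau> Z.\<kappa> \<in> Ker \<and> (\<forall>x\<in>Ker. XA.\<tau> Z.\<kappa> \<otimes>\<^bsub>A\<^esub> x = x \<and> x \<otimes>\<^bsub>A\<^esub> XA.\<tau> Z.\<kappa> = x)"
      using k unit by blast
    fix e assume "e \<in> Ker \<and> (\<forall>x\<in>Ker. e \<otimes>\<^bsub>A\<^esub> x = x \<and> x \<otimes>\<^bsub>A\<^esub> e = x)"
    then show "e = XA.\<tau> Z.\<kappa>" using k unit by metis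
  qed
  then show "XA.\<rho> (ker_unit X) = Z.\<kappa>" "ker_unit X \<in> Ker" using k by auto
qed

lemma algA_Y: "algA Y = alg_sum2 Z.PA.CS (A\<lparr>carrier := Ker, one := ker_unit X\<rparr>)"
  by (simp add: ecf_sum2_def ecf_sum_def H_ecf_def ecf_ker_def Let_def)

lemma algB_Y: "algB Y = alg_sum2 Z.PB.CS (B\<lparr>carrier := {\<zero>\<^bsub>B\<^esub>}, one := \<zero>\<^bsub>B\<^esub>\<rparr>)"
  by (simp add: ecf_sum2_def ecf_sum_def H_ecf_def ecf_ker_def Let_def)

lemma alg_sum2_simps [simp]:
  "carrier (alg_sum2 P Q) = carrier P \<times> carrier Q"
  "(x, y) \<otimes>\<^bsub>alg_sum2 P Q\<^esub> (x', y') = (x \<otimes>\<^bsub>P\<^esub> x', y \<otimes>\<^bsub>Q\<^esub> y')"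
  "(x, y) \<oplus>\<^bsub>alg_sum2 P Q\<^esub> (x', y') = (x \<oplus>\<^bsub>P\<^esub> x', y \<oplus>\<^bsub>Q\<^esub> y')"
  "c \<odot>\<^bsub>alg_sum2 P Q\<^esub> (x, y) = (c \<odot>\<^bsub>P\<^esub> x, c \<odot>\<^bsub>Q\<^esub> y)"
  "\<one>\<^bsub>alg_sum2 P Q\<^esub> = (\<one>\<^bsub>P\<^esub>, \<one>\<^bsub>Q\<^esub>)"
  by (simp_all add: alg_sum2_def)

text \<open>The natural map (xs, x) |-> H xs + x runs from the direct sum to A, so \<open>f\<close>
  is introduced as its inverse. By \<open>HA_decomposition_unique\<close> the choice is forced, and
  \<open>f_eqI\<close> reduces each compatibility of \<open>f\<close> to an identity for
  \<open>H\<close>.\<close>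

definition f :: "'a \<Rightarrow> (nat \<Rightarrow> quat \<times> quat) \<times> 'a" where
  "f a = (SOME p. fst p \<in> carrier Z.PA.CS \<and> snd p \<in> Ker \<and> Z.PA.H (fst p) + XA.\<rho> (snd p) = XA.\<rho> a)"

text \<open>The second component is the only element of the B-part of the kernel summand.\<close>

definition g :: "'b \<Rightarrow> (nat \<Rightarrow> quat mat \<times> quat mat) \<times> 'b" where
  "g b = ((SOME xs. xs \<in> carrier Z.PB.CS \<and> Z.PB.H xs = XB.\<rho> b), \<zero>\<^bsub>B\<^esub>)"

lemma f_obtain:
  assumes "a \<in> carrier A"
  obtains xs x where "f a = (xs, x)" "xs \<in> carrier Z.PA.CS" "x \<in> Ker" "Z.PA.H xs + XA.\<rho> x = XA.\<rho> a"
proof -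
  have "XA.\<rho> a \<in> XA.SC" using assms by blast
  then obtain xs x where "xs \<in> carrier Z.PA.CS" "x \<in> Z.kerA" "Z.PA.H xs + x = XA.\<rho> a"
    using Z.HA_decomposition by blast
  then have "\<exists>p. fst p \<in> carrier Z.PA.CS \<and> snd p \<in> Ker \<and> Z.PA.H (fst p) + XA.\<rho> (snd p) = XA.\<rho> a"
    using \<tau>_ker by (intro exI[of _ "(xs, XA.\<tau> x)"]) auto
  from someI_ex[OF this] have "fst (f a) \<in> carrier Z.PA.CS \<and> snd (f a) \<in> Ker \<and>
    Z.PA.H (fst (f a)) + XA.\<rho> (snd (f a)) = XA.\<rho> a" by (simp add: f_def)
  then show thesis by (intro that[of "fst (f a)" "snd (f a)"]) auto
qed

lemma f_eqI:
  assumes a: "a \<in> carrier A" and xs: "xs \<in> carrier Z.PA.CS" and x: "x \<in> Ker"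
    and eq: "Z.PA.H xs + XA.\<rho> x = XA.\<rho> a"
  shows "f a = (xs, x)"
proof -
  obtain ys y where y: "f a = (ys, y)" "ys \<in> carrier Z.PA.CS" "y \<in> Ker" "Z.PA.H ys + XA.\<rho> y = XA.\<rho> a"
    using f_obtain[OF a] .
  have "ys = xs \<and> XA.\<rho> y = XA.\<rho> x"
    by (rule Z.HA_decomposition_unique) (use xs x y eq Ker_iff in auto)
  then show ?thesis using y x XA.inj_\<rho> Ker_iff by (auto dest: inj_onD)
qed

lemma g_obtain:
  assumes "b \<in> carrier B"
  obtains xs where "g b = (xs, \<zero>\<^bsub>B\<^esub>)" "xs \<in> carrier Z.PB.CS" "Z.PB.H xs = XB.\<rho> b"
proof -
  have "XB.\<rho> b \<in> XB.SC" using assms by blast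
  then have "\<exists>xs. xs \<in> carrier Z.PB.CS \<and> Z.PB.H xs = XB.\<rho> b" using Z.HB_surj by blast
  from someI_ex[OF this] show thesis by (intro that) (auto simp: g_def)
qed

lemma g_eqI:
  assumes b: "b \<in> carrier B" and xs: "xs \<in> carrier Z.PB.CS" and eq: "Z.PB.H xs = XB.\<rho> b"
  shows "g b = (xs, \<zero>\<^bsub>B\<^esub>)"
proof -
  obtain ys where y: "g b = (ys, \<zero>\<^bsub>B\<^esub>)" "ys \<in> carrier Z.PB.CS" "Z.PB.H ys = XB.\<rho> b"
    using g_obtain[OF b] .
  then have "ys = xs" using Z.PB.H_inj[OF y(2) xs] eq by simp
  then show ?thesis using y by simp
qed

lemma f_iso: "f \<in> alg_iso A (algA Y)"
proof (rule alg_isoI)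
  fix a assume "a \<in> carrier A"
  then show "f a \<in> carrier (algA Y)" by (rule f_obtain) (simp add: algA_Y)
next
  fix a b assume a: "a \<in> carrier A" and b: "b \<in> carrier A"
  obtain xs x where x: "f a = (xs, x)" "xs \<in> carrier Z.PA.CS" "x \<in> Ker" "Z.PA.H xs + XA.\<rho> x = XA.\<rho> a"
    using f_obtain[OF a] .
  obtain ys y where y: "f b = (ys, y)" "ys \<in> carrier Z.PA.CS" "y \<in> Ker" "Z.PA.H ys + XA.\<rho> y = XA.\<rho> b"
    using f_obtain[OF b] .
  have xy: "x \<in> carrier A" "XA.\<rho> x \<in> Z.kerA" "y \<in> carrier A" "XA.\<rho> y \<in> Z.kerA"
    using x y Ker_iff by auto
  have "f (a \<otimes>\<^bsub>A\<^esub> b) = (xs \<otimes>\<^bsub>Z.PA.CS\<^esub> ys, x \<otimes>\<^bsub>A\<^esub> y)"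
  proof (rule f_eqI)
    show "x \<otimes>\<^bsub>A\<^esub> y \<in> Ker" using xy Z.ker_closed by (auto simp: Ker_iff XA.\<rho>_mult)
    show "Z.PA.H (xs \<otimes>\<^bsub>Z.PA.CS\<^esub> ys) + XA.\<rho> (x \<otimes>\<^bsub>A\<^esub> y) = XA.\<rho> (a \<otimes>\<^bsub>A\<^esub> b)"
      using Z.HA_mult[OF x(2) y(2) xy(2,4)] xy a b x(4) y(4) by (simp add: XA.\<rho>_mult)
  qed (use a b x y Z.PA.CS_closed in auto)
  then show "f (a \<otimes>\<^bsub>A\<^esub> b) = f a \<otimes>\<^bsub>algA Y\<^esub> f b" by (simp add: algA_Y x y)
  have "f (a \<oplus>\<^bsub>A\<^esub> b) = (xs \<oplus>\<^bsub>Z.PA.CS\<^esub> ys, x \<oplus>\<^bsub>A\<^esub> y)"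
  proof (rule f_eqI)
    show "x \<oplus>\<^bsub>A\<^esub> y \<in> Ker" using xy Z.ker_closed by (auto simp: Ker_iff XA.\<rho>_add)
    show "Z.PA.H (xs \<oplus>\<^bsub>Z.PA.CS\<^esub> ys) + XA.\<rho> (x \<oplus>\<^bsub>A\<^esub> y) = XA.\<rho> (a \<oplus>\<^bsub>A\<^esub> b)"
      using Z.PA.H_add[OF x(2) y(2)] xy a b x(4)[symmetric] y(4)[symmetric] by (simp add: XA.\<rho>_add add_ac)
  qed (use a b x y Z.PA.CS_closed in auto)
  then show "f (a \<oplus>\<^bsub>A\<^esub> b) = f a \<oplus>\<^bsub>algA Y\<^esub> f b" by (simp add: algA_Y x y)
next
  have "f \<one>\<^bsub>A\<^esub> = (\<one>\<^bsub>Z.PA.CS\<^esub>, ker_unit X)"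
    by (rule f_eqI) (use Z.PA.CS_closed(2) ker_unit_eq in \<open>auto simp: Z.\<kappa>_def\<close>)
  then show "f \<one>\<^bsub>A\<^esub> = \<one>\<^bsub>algA Y\<^esub>" by (simp add: algA_Y)
next
  fix c a assume a: "a \<in> carrier A"
  obtain xs x where x: "f a = (xs, x)" "xs \<in> carrier Z.PA.CS" "x \<in> Ker" "Z.PA.H xs + XA.\<rho> x = XA.\<rho> a"
    using f_obtain[OF a] .
  have xk: "x \<in> carrier A" "XA.\<rho> x \<in> Z.kerA" using x Ker_iff by auto
  have "f (c \<odot>\<^bsub>A\<^esub> a) = (c \<odot>\<^bsub>Z.PA.CS\<^esub> xs, c \<odot>\<^bsub>A\<^esub> x)"
  proof (rule f_eqI)
    show "c \<odot>\<^bsub>A\<^esub> x \<in> Ker" using xk Z.ker_closed by (auto simp: Ker_iff XA.\<rho>_smult)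
    show "Z.PA.H (c \<odot>\<^bsub>Z.PA.CS\<^esub> xs) + XA.\<rho> (c \<odot>\<^bsub>A\<^esub> x) = XA.\<rho> (c \<odot>\<^bsub>A\<^esub> a)"
      using Z.PA.H_smult[OF x(2)] xk a x(4)[symmetric] by (simp add: XA.\<rho>_smult op.scale_right_distrib)
  qed (use a x Z.PA.CS_closed in auto)
  then show "f (c \<odot>\<^bsub>A\<^esub> a) = c \<odot>\<^bsub>algA Y\<^esub> f a" by (simp add: algA_Y x)
next
  fix a b assume ab: "a \<in> carrier A" "b \<in> carrier A" "f a = f b"
  then have "XA.\<rho> a = XA.\<rho> b" by (metis f_obtain prod.inject)
  then show "a = b" using XA.inj_\<rho> ab by (auto dest: inj_onD)
next
  fix p assume "p \<in> carrier (algA Y)"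
  then obtain xs x where p: "p = (xs, x)" "xs \<in> carrier Z.PA.CS" "x \<in> Ker"
    by (auto simp: algA_Y)
  have x: "x \<in> carrier A" using p Ker_iff by blast
  define a where "a = XA.\<tau> (Z.PA.H xs + XA.\<rho> x)"
  have S: "Z.PA.H xs + XA.\<rho> x \<in> XA.SC"
    by (rule XA.E.add_closed) (use Z.PA.H_closed[OF p(2)] x in auto)
  have a: "a \<in> carrier A" "XA.\<rho> a = Z.PA.H xs + XA.\<rho> x" using S by (simp_all add: a_def)
  have "f a = p" unfolding p(1) by (rule f_eqI) (use a p in auto)
  then show "\<exists>a\<in>carrier A. f a = p" using a by blast
qed

lemma g_iso: "g \<in> alg_iso B (algB Y)"
proof (rule alg_isoI)
  fix b assume "b \<in> carrier B"
  then show "g b \<in> carrier (algB Y)" by (rule g_obtain) (simp add: algB_Y)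
next
  fix a b assume a: "a \<in> carrier B" and b: "b \<in> carrier B"
  obtain xs where x: "g a = (xs, \<zero>\<^bsub>B\<^esub>)" "xs \<in> carrier Z.PB.CS" "Z.PB.H xs = XB.\<rho> a"
    using g_obtain[OF a] .
  obtain ys where y: "g b = (ys, \<zero>\<^bsub>B\<^esub>)" "ys \<in> carrier Z.PB.CS" "Z.PB.H ys = XB.\<rho> b"
    using g_obtain[OF b] .
  have "g (a \<otimes>\<^bsub>B\<^esub> b) = (xs \<otimes>\<^bsub>Z.PB.CS\<^esub> ys, \<zero>\<^bsub>B\<^esub>)"
    by (rule g_eqI) (use a b x y Z.PB.CS_closed Z.PB.H_mult[OF x(2) y(2)] in \<open>auto simp: XB.\<rho>_mult\<close>)
  then show "g (a \<otimes>\<^bsub>B\<^esub> b) = g a \<otimes>\<^bsub>algB Y\<^esub> g b" by (simp add: algB_Y x y)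
  have "g (a \<oplus>\<^bsub>B\<^esub> b) = (xs \<oplus>\<^bsub>Z.PB.CS\<^esub> ys, \<zero>\<^bsub>B\<^esub>)"
    by (rule g_eqI) (use a b x y Z.PB.CS_closed Z.PB.H_add[OF x(2) y(2)] in \<open>auto simp: XB.\<rho>_add\<close>)
  then show "g (a \<oplus>\<^bsub>B\<^esub> b) = g a \<oplus>\<^bsub>algB Y\<^esub> g b" by (simp add: algB_Y x y)
next
  have "g \<one>\<^bsub>B\<^esub> = (\<one>\<^bsub>Z.PB.CS\<^esub>, \<zero>\<^bsub>B\<^esub>)"
    by (rule g_eqI) (use Z.PB.CS_closed(2) Z.HB_one in auto)
  then show "g \<one>\<^bsub>B\<^esub> = \<one>\<^bsub>algB Y\<^esub>" by (simp add: algB_Y)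
next
  fix c a assume a: "a \<in> carrier B"
  obtain xs where x: "g a = (xs, \<zero>\<^bsub>B\<^esub>)" "xs \<in> carrier Z.PB.CS" "Z.PB.H xs = XB.\<rho> a"
    using g_obtain[OF a] .
  have "g (c \<odot>\<^bsub>B\<^esub> a) = (c \<odot>\<^bsub>Z.PB.CS\<^esub> xs, \<zero>\<^bsub>B\<^esub>)"
    by (rule g_eqI) (use a x Z.PB.CS_closed Z.PB.H_smult[OF x(2)] in \<open>auto simp: XB.\<rho>_smult\<close>)
  moreover have "c \<odot>\<^bsub>B\<^esub> \<zero>\<^bsub>B\<^esub> = \<zero>\<^bsub>B\<^esub>" using XB.V.smult_r_null[of c] by simp
  ultimately show "g (c \<odot>\<^bsub>B\<^esub> a) = c \<odot>\<^bsub>algB Y\<^esub> g a" by (simp add: algB_Y x)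
next
  fix a b assume ab: "a \<in> carrier B" "b \<in> carrier B" "g a = g b"
  then have "XB.\<rho> a = XB.\<rho> b" by (metis g_obtain prod.inject)
  then show "a = b" using XB.inj_\<rho> ab by (auto dest: inj_onD)
next
  fix p assume "p \<in> carrier (algB Y)"
  then obtain xs where p: "p = (xs, \<zero>\<^bsub>B\<^esub>)" "xs \<in> carrier Z.PB.CS"
    by (auto simp: algB_Y)
  define b where "b = XB.\<tau> (Z.PB.H xs)"
  have b: "b \<in> carrier B" "XB.\<rho> b = Z.PB.H xs" using Z.PB.H_closed[OF p(2)] by (simp_all add: b_def)
  have "g b = p" unfolding p(1) by (rule g_eqI) (use b p in auto)
  then show "\<exists>a\<in>carrier B. g a = p" using b by blast
qed

lemma D_dim: "i < k \<Longrightarrow> Real_Vector_Spaces.dim (D i) = Z.dd i"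
  using dim_real_form[OF block.D[OF Z.blocks]] by (simp add: Z.dd_def)

lemma isomorphic: "ecf_isomorphic X Y"
  unfolding ecf_isomorphic_def
proof (intro bexI[OF _ f_iso] bexI[OF _ g_iso] conjI ballI)
  fix a assume a: "a \<in> carrier A"
  obtain xs x where x: "f a = (xs, x)" "xs \<in> carrier Z.PA.CS" "x \<in> Ker" "Z.PA.H xs + XA.\<rho> x = XA.\<rho> a"
    using f_obtain[OF a] .
  have xk: "x \<in> carrier A" "XA.\<rho> x \<in> Z.kerA" "phi X x = \<zero>\<^bsub>B\<^esub>" using x Ker_iff by (auto simp: a_kernel_def')
  have HS: "Z.PA.H xs \<in> XA.SC" using Z.PA.H_closed[OF x(2)] .
  have "formA X a = XA.lE (Z.PA.H xs + XA.\<rho> x)" using a x(4) by (simp add: XA.lE_\<rho>)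
  also have "\<dots> = XA.lE (Z.PA.H xs) + formA X x" using HS xk by (simp add: XA.E.l_add XA.lE_\<rho>)
  also have "\<dots> = formA Y (f a)"
    by (simp add: Z.PA.H_form[OF x(2)] x(1) ecf_sum2_def ecf_sum_def H_ecf_def ecf_ker_def Let_def D_dim)
  finally show "formA Y (f a) = formA X a" by simp
  show "g (phi X a) = phi Y (f a)"
  proof -
    have "XB.\<rho> (phi X a) = phiE (Z.PA.H xs + XA.\<rho> x)" using a x(4) by (simp add: phiE_\<rho>)
    also have "\<dots> = phiE (Z.PA.H xs)" using HS xk by (simp add: W.phi_add Z.kerA_def)
    finally have "XB.\<rho> (phi X a) = phiE (Z.PA.H xs)" .
    then have "g (phi X a) = (\<lambda>i\<in>{..<k}. extend_map (\<lambda>a. a \<cdot>\<^sub>m 1\<^sub>m (n i)) (xs i), \<zero>\<^bsub>B\<^esub>)"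
      using Z.phi_HA[OF x(2)] a by (intro g_eqI) (auto simp: phi_props)
    then show ?thesis
      by (simp add: x(1) xk ecf_sum2_def ecf_sum_def H_ecf_def ecf_ker_def Let_def)
  qed
  show "f (starA X a) = starA Y (f a)"
  proof -
    have "f (starA X a) = (\<lambda>i\<in>{..<k}. extend_map qcnj (xs i), starA X x)"
    proof (rule f_eqI)
      show "starA X x \<in> Ker" using xk Z.ker_closed(4)[OF xk(2)] by (auto simp: Ker_iff XA.starE_\<rho> XA.star_props)
      have "XA.\<rho> (starA X a) = XA.starE (Z.PA.H xs + XA.\<rho> x)" using a x(4) by (simp add: XA.starE_\<rho>)
      also have "\<dots> = XA.starE (Z.PA.H xs) + XA.\<rho> (starA X x)"
        using HS xk by (simp add: XA.E.star_add XA.starE_\<rho>)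
      finally show "Z.PA.H (\<lambda>i\<in>{..<k}. extend_map qcnj (xs i)) + XA.\<rho> (starA X x) = XA.\<rho> (starA X a)"
        by (simp add: Z.PA.H_star[OF x(2)])
    qed (use a Z.PA.CS_closed(6)[OF x(2)] in \<open>auto simp: XA.star_props\<close>)
    then show ?thesis by (simp add: x(1) ecf_sum2_def ecf_sum_def H_ecf_def ecf_ker_def Let_def)
  qed
next
  fix b assume b: "b \<in> carrier B"
  obtain xs where x: "g b = (xs, \<zero>\<^bsub>B\<^esub>)" "xs \<in> carrier Z.PB.CS" "Z.PB.H xs = XB.\<rho> b"
    using g_obtain[OF b] .
  \<comment> \<open>The kernel summand keeps the form and the involution of B on its zero part, so
    their values at zero enter the comparison.\<close>
  have l0: "formB X \<zero>\<^bsub>B\<^esub> = 0" using XB.E.l_zero XB.lE_\<rho>[of "\<zero>\<^bsub>B\<^esub>"] by (simp add: XB.\<rho>_zero)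
  have s0: "starB X \<zero>\<^bsub>B\<^esub> = \<zero>\<^bsub>B\<^esub>"
    using XB.star_props(2)[of "\<zero>\<^bsub>B\<^esub>" "\<zero>\<^bsub>B\<^esub>"] XB.star_props(1)[of "\<zero>\<^bsub>B\<^esub>"]
    by (metis XB.R.add.l_cancel_one' XB.R.l_zero XB.R.zero_closed)
  have "formB X b = XB.lE (Z.PB.H xs)" using b x(3) by (simp add: XB.lE_\<rho>)
  also have "\<dots> = formB Y (g b)"
    by (simp add: Z.PB.H_form[OF x(2)] x(1) l0 ecf_sum2_def ecf_sum_def H_ecf_def ecf_ker_def Let_def)
  finally show "formB Y (g b) = formB X b" by simp
  show "g (starB X b) = starB Y (g b)"
  proof -
    have "g (starB X b) = (\<lambda>i\<in>{..<k}. extend_map (\<lambda>M. transpose_mat (map_mat qcnj M)) (xs i), \<zero>\<^bsub>B\<^esub>)"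
      using Z.PB.H_star[OF x(2)] Z.PB.CS_closed(6)[OF x(2)] b x(3)
      by (intro g_eqI) (auto simp: XB.star_props XB.starE_\<rho>)
    then show ?thesis by (simp add: x(1) s0 ecf_sum2_def ecf_sum_def H_ecf_def ecf_ker_def Let_def)
  qed
next
  \<comment> \<open>These are the block components of \<open>U\<close>. Here d is counted by the
    standard basis of D; \<open>D_dim\<close> identifies it with the real dimension used in
    \<open>H_ecf\<close>.\<close>
  define us where "us = (\<lambda>i\<in>{..<k}. ((2 - of_nat (Z.dd i)) / \<mu> i) \<odot>\<^bsub>Z.PA.CR i\<^esub> \<one>\<^bsub>Z.PA.CR i\<^esub>)"
  have "f (elemU X) = (us, ker_unit X \<otimes>\<^bsub>A\<^esub> elemU X)"
  proof (rule f_eqI)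
    show "us \<in> carrier Z.PA.CS"
      using Z.PA.CR_closed by (simp add: us_def alg_sum_def)
    have k: "ker_unit X \<in> carrier A" using ker_unit_eq Ker_iff by blast
    show "ker_unit X \<otimes>\<^bsub>A\<^esub> elemU X \<in> Ker"
      using Z.ker_closed(5)[OF Z.\<kappa>_ker W.U_closed] ker_unit_eq k U_props
      by (auto simp: Ker_iff XA.\<rho>_mult UE_def)
    show "Z.PA.H us + XA.\<rho> (ker_unit X \<otimes>\<^bsub>A\<^esub> elemU X) = XA.\<rho> (elemU X)"
      using Z.HA_U k U_props by (simp add: us_def XA.\<rho>_mult ker_unit_eq UE_def)
  qed (rule U_props)
  moreover have "us = (\<lambda>i\<in>{..<k}. elemU (H_ecf (D i) (n i) (\<mu> i)))"
    unfolding us_def by (rule restrict_ext) (simp add: H_ecf_def Let_def D_dim)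
  ultimately show "f (elemU X) = elemU Y"
    by (simp add: ecf_sum2_def ecf_sum_def ecf_ker_def)
qed

end

theorem theorem5:
  fixes X :: "('a, 'b) ecf_data"
  assumes "equipped_cardy_frobenius X"
    and "semisimple_ecf X"
  shows "\<exists>(k :: nat) (D :: nat \<Rightarrow> quat set) (n :: nat \<Rightarrow> nat) (\<mu> :: nat \<Rightarrow> complex).
           (\<forall>i<k. D i \<in> {\<real>, quat_complexes, UNIV} \<and> n i \<ge> 1 \<and> \<mu> i \<noteq> 0) \<and>
           ecf_isomorphic X
             (ecf_sum2 (ecf_sum {..<k} (\<lambda>i. H_ecf (D i) (n i) (\<mu> i))) (ecf_ker X))"
proof -
  interpret semisimple_ecf_alg X using assms by unfold_locales
  obtain k D n \<mu> \<Gamma> where Z: "cardy_blocks scale_op XA.SC (XA.\<rho> \<one>\<^bsub>A\<^esub>) XA.lE XA.starE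
      XB.SC (XB.\<rho> \<one>\<^bsub>B\<^esub>) XB.lE XB.starE phiE pdE UE KE k D n \<mu> \<Gamma>"
    using W.ex_cardy_blocks by blast
  have "semisimple_ecf_blocks X k D n \<mu> \<Gamma>"
    using semisimple_ecf_alg_axioms Z by (rule semisimple_ecf_blocks.intro)
  then have "ecf_isomorphic X (ecf_sum2 (ecf_sum {..<k} (\<lambda>i. H_ecf (D i) (n i) (\<mu> i))) (ecf_ker X))"
    by (rule semisimple_ecf_blocks.isomorphic)
  moreover have "D i \<in> {\<real>, quat_complexes, UNIV} \<and> n i \<ge> 1 \<and> \<mu> i \<noteq> 0" if "i < k" for i
  proof -
    note b = cardy_blocks.blocks[OF Z that]
    show ?thesis using block.D[OF b] block.n[OF b] block.mu[OF b] by (simp add: real_forms_def)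
  qed
  ultimately show ?thesis by blast
qed

end
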